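(* Assume all non-trivial zeros of $\zeta$ are simple, and fix $\beta,n\in\mathbb{N}$. The only singularities of the meromorphic continuation of $\varpi^{(\beta)}_n(z)$ to $\mathbb{C}$ are simple poles at the real points $z=\log q$, where $q\in\mathbb{N}$ satisfies $c_q^{(\beta)}(n)\neq0$, and $$\operatorname*{res}_{z=\log q}\varpi^{(\beta)}_n(z)=-\frac{1}{2\pi i}c_q^{(\beta)}(n).$$
   Context: For $\beta,q,n\in\mathbb{N}$, $c_q^{(\beta)}(n)=\sum e^{2\pi i nh/q^\beta}$, the sum over integers $0\le h<q^\beta$ such that $h$ and $q^\beta$ have no common divisor of the form $d^\beta$ with $d>1$. For $z\in\mathbb{C}$, $\sigma_z^{(\beta)}(n)=\sum_{d\in\mathbb{N},\ d^\beta\mid n}d^{\beta z}$. $\mathbb{H}=\{z\in\mathbb{C}:\operatorname{Im}z>0\}$. Fix a sequence $(T_m)_{m\ge1}$ with $m\le T_m\le m+1$ and $|\zeta(\sigma\pm iT_m)|^{-1}<T_m^{c_1}$ for $-1\le\sigma\le2$, for an absolute constant $c_1$. For $z\in\mathbb{H}$, $\varpi^{(\beta)}_n(z)=\lim_{m\to\infty}\sum_{\rho:\,0<\operatorname{Im}\rho<T_m}\frac{\sigma^{(\beta)}_{1-\rho/\beta}(n)}{\zeta'(\rho)}e^{\rho z}$, the sum over non-trivial zeros $\rho$ of $\zeta$; it is known to extend meromorphically to $\mathbb{C}$. *)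

theory Defs
  imports "HOL-Analysis.Analysis"
begin

text \<open>Riemann zeta function: the (unique) holomorphic function on the plane minus 1
  agreeing with the Dirichlet series for Re s > 1. Its value at the pole s = 1 is irrelevant.\<close>
definition riemann_zeta :: "complex \<Rightarrow> complex" where
  "riemann_zeta = (SOME f. f holomorphic_on (- {1}) \<and>
      (\<forall>s. 1 < Re s \<longrightarrow> f s = (\<Sum>k. 1 / (of_nat (Suc k)) powr s)))"

definition nontrivial_zero :: "complex \<Rightarrow> bool" where
  "nontrivial_zero \<rho> \<longleftrightarrow> \<rho> \<noteq> 1 \<and> riemann_zeta \<rho> = 0 \<and>
      \<not> (\<exists>k::nat. k \<ge> 1 \<and> \<rho> = - 2 * of_nat k)"

definition ramanujan_sum_beta :: "nat \<Rightarrow> nat \<Rightarrow> nat \<Rightarrow> complex" where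
  "ramanujan_sum_beta \<beta> q n =
     (\<Sum>h \<in> {h. h < q ^ \<beta> \<and> \<not> (\<exists>d::nat. d > 1 \<and> d ^ \<beta> dvd h \<and> d ^ \<beta> dvd q ^ \<beta>)}.
        exp (2 * of_real pi * \<i> * of_nat n * of_nat h / of_nat (q ^ \<beta>)))"

definition divisor_sigma_beta :: "nat \<Rightarrow> complex \<Rightarrow> nat \<Rightarrow> complex" where
  "divisor_sigma_beta \<beta> z n =
     (\<Sum>d \<in> {d::nat. d \<ge> 1 \<and> d ^ \<beta> dvd n}. (of_nat d) powr (of_nat \<beta> * z))"

definition varpi_partial :: "nat \<Rightarrow> nat \<Rightarrow> real \<Rightarrow> complex \<Rightarrow> complex" where
  "varpi_partial \<beta> n T z =
     (\<Sum>\<rho> \<in> {\<rho>. nontrivial_zero \<rho> \<and> 0 < Im \<rho> \<and> Im \<rho> < T}.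
        divisor_sigma_beta \<beta> (1 - \<rho> / of_nat \<beta>) n / deriv riemann_zeta \<rho> * exp (\<rho> * z))"

end

theory Submission
  imports Defs "HOL-Complex_Analysis.Complex_Analysis"
begin

text \<open>The sum of \<open>c\<^sub>d(n)\<close> over the divisors \<open>d\<close> of \<open>q\<close> is \<open>q\<^sup>\<beta>\<close> or \<open>0\<close> according as \<open>q\<^sup>\<beta>\<close> divides \<open>n\<close>
  or not, so the Dirichlet series of the sums \<open>c\<^sub>q(n)\<close> is \<open>A(s) / \<zeta>(s)\<close>, where \<open>A(s)\<close> is the
  finite sum \<open>\<sigma>(n)\<close> with exponent \<open>1 - s / \<beta>\<close>. By the residue theorem the partial sums of \<open>\<varpi>\<close> are
  \<open>1 / (2\<pi>\<i>)\<close> times the integral of \<open>A(s) exp(sz) / \<zeta>(s)\<close> around the rectangle with corners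
  \<open>-m + \<epsilon>\<i>\<close> and \<open>\<beta> + 2 + T\<^sub>m\<i>\<close>, with \<open>\<epsilon>\<close> below all the zeros in the upper half plane. By the
  functional equation \<open>1 / \<zeta>(s)\<close> decays faster than any exponential as \<open>Re s\<close> tends to \<open>-\<infinity>\<close>, so the
  left and upper edges vanish in the limit, and the lower edge converges to an entire function of \<open>z\<close>.
  On the right edge the Dirichlet series integrates termwise to the sum of
  \<open>-c\<^sub>q(n) exp(w(z - log q)) / (z - log q)\<close> with \<open>w = \<beta> + 2 + \<epsilon>\<i>\<close>, which exhibits the poles.

  For the functional equation, both sides are compared at real \<open>s\<close> between \<open>-1\<close> and \<open>0\<close>. There
  \<open>\<zeta>(s)\<close> is \<open>s(s + 1) / 2\<close> times the integral over the positive axis of \<open>{x}(1 - {x})\<close> times the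
  power of \<open>x\<close> with exponent \<open>-s - 2\<close>, and \<open>{x}(1 - {x})\<close> is the sum of the nonnegative functions
  \<open>2 sin\<^sup>2(\<pi>kx) / (\<pi>k)\<^sup>2\<close>, so that the integral may be taken term by term.\<close>

section \<open>Ramanujan sums\<close>

text \<open>Only zeros in the upper half plane are summed, so the contour must stay above the real
  axis: the lower edge at height epsilon avoids the pole at 1 and the trivial zeros, and there
  exp(sz) depends on Im z only through exp(-epsilon Im z), so its integral is entire. Poles can come
  only from the right edge. Integrating exp(s(z - log q)) upwards from w converges only for Im z >
  0, but leaves the value at w, which makes sense for all z other than log q. There exp(w(z - log
  q)) is 1, so the residue depends neither on epsilon nor on the abscissa beta + 2; that abscissa is
  chosen because |c_q(n)| <= q^beta then leaves the summable majorant q^(-2). On the upper edge the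
  hypothesis on T_m serves for -1 <= Re s <= 2; further left the functional equation bounds 1/zeta,
  and further right the Dirichlet series does. Since \<open>riemann_zeta\<close> is chosen by
  \<open>SOME\<close>, a continuation must first be constructed: one to Re s > -1 comes from the
  trapezoidal rule, and the functional equation, proved for that one, then supplies the rest of the
  plane.\<close>

definition free_residues :: "nat \<Rightarrow> nat \<Rightarrow> nat set" where
  "free_residues \<beta> q = {h. h < q ^ \<beta> \<and> \<not> (\<exists>d::nat. d > 1 \<and> d ^ \<beta> dvd h \<and> d ^ \<beta> dvd q ^ \<beta>)}"

text \<open>After the common factor G of a and b is split off, the cofactors are coprime, and so are
  their powers; both divide m / G^k, hence so does their product. This closes the set of g with
  g^beta dividing m under lcm, which is what singles out a member that all others divide.\<close>

lemma lcm_power_dvd: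
  fixes a b m :: nat
  assumes "a ^ k dvd m" "b ^ k dvd m"
  shows "lcm a b ^ k dvd m"
proof -
  obtain G a' b' where G: "G = gcd a b" "a = a' * G" "b = b' * G" "coprime a' b'"
  proof (cases "gcd a b = 0")
    case True
    \<comment> \<open>Here a = b = 0, and both cofactors may be taken to be 1.\<close>
    show ?thesis by (rule that[of 0 1 1]) (use True in auto)
  next
    case False
    with gcd_coprime_exists[of a b] show ?thesis using that by blast
  qed
  show ?thesis
  proof (cases "G = 0")
    case True
    with G assms show ?thesis by simp
  next
    case False
    have "G ^ k dvd m" using assms(1) unfolding G(2) power_mult_distrib by (rule dvd_mult_right)
    then obtain t where t: "m = G ^ k * t" by (rule dvdE)
    have "a' ^ k dvd t" "b' ^ k dvd t"
      using assms False unfolding G(2,3) power_mult_distrib t by (simp_all add: mult.commute[of _ "G ^ k"])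
    moreover have "coprime (a' ^ k) (b' ^ k)" using G(4) by simp
    ultimately have "a' ^ k * b' ^ k dvd t" by (rule divides_mult)
    hence "(G * (a' * b')) ^ k dvd m" by (simp add: t power_mult_distrib)
    moreover have "lcm a b = G * (a' * b')"
    proof -
      have "lcm a b * G = G * (a' * b') * G"
        using prod_gcd_lcm_nat[of a b] unfolding G(1)[symmetric] by (metis G(2,3) mult.assoc mult.commute)
      thus ?thesis using False by simp
    qed
    ultimately show ?thesis by simp
  qed
qed

text \<open>If lcm(g, g') = g e, then e^beta divides h and e divides d, so e = 1 by the choice of h.
  Thus g can be recovered from the product g^beta h, which gives injectivity below.\<close>

lemma free_residues_divisor_dvd:
  fixes g g' d h q :: nat
  assumes "q > 0" "q = d * g" "g' dvd q" "h \<in> free_residues \<beta> d" "g' ^ \<beta> dvd g ^ \<beta> * h"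
  shows "g' dvd g"
proof -
  define e where "e = lcm g g' div g"
  have g: "g > 0" using assms by (auto intro: Nat.gr0I)
  have l: "lcm g g' = g * e" by (simp add: e_def)
  have "lcm g g' ^ \<beta> dvd g ^ \<beta> * h"
    using assms by (intro lcm_power_dvd) auto
  hence "g ^ \<beta> * e ^ \<beta> dvd g ^ \<beta> * h" by (simp add: l power_mult_distrib)
  hence 1: "e ^ \<beta> dvd h" using g by simp
  have "lcm g g' dvd q" using assms by simp
  hence "g * e dvd g * d" by (simp add: l assms(2) mult.commute)
  hence 2: "e dvd d" using g by simp
  hence "e ^ \<beta> dvd d ^ \<beta>" by (rule dvd_power_same)
  with 1 assms(4) have "e \<le> 1" by (auto simp: free_residues_def not_le)
  moreover have "e > 0" using l assms g by (metis lcm_eq_0_iff mult_is_0 gr0I dvd_0_left_iff neq0_conv)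
  ultimately have "lcm g g' = g" using l by simp
  thus ?thesis by (metis dvd_lcm2)
qed

text \<open>Every residue has a unique largest divisor of the form \<open>g\<^sup>\<beta>\<close> with \<open>g\<close> dividing \<open>q\<close>.\<close>
lemma bij_betw_free_residues:
  fixes q :: nat
  assumes "q > 0" "\<beta> > 0"
  shows "bij_betw (\<lambda>(d,h). (q div d) ^ \<beta> * h) (SIGMA d:{d. d dvd q}. free_residues \<beta> d) {..<q ^ \<beta>}"
  unfolding bij_betw_def
proof
  show "inj_on (\<lambda>(d,h). (q div d) ^ \<beta> * h) (SIGMA d:{d. d dvd q}. free_residues \<beta> d)"
  proof (rule inj_onI, clarsimp)
    fix d h d' h'
    assume *: "d dvd q" "d' dvd q" "h \<in> free_residues \<beta> d" "h' \<in> free_residues \<beta> d'"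
      "(q div d) ^ \<beta> * h = (q div d') ^ \<beta> * h'"
    obtain g where g: "q = d * g" using *(1) by (rule dvdE)
    obtain g' where g': "q = d' * g'" using *(2) by (rule dvdE)
    have pos: "d > 0" "g > 0" "d' > 0" "g' > 0" using g g' assms by (auto intro!: Nat.gr0I)
    have qd: "q div d = g" "q div d' = g'"
      using g g' pos by (metis nonzero_mult_div_cancel_left neq0_conv)+
    have eq: "g ^ \<beta> * h = g' ^ \<beta> * h'" using *(5) by (simp only: qd)
    have "g' dvd g"
      by (rule free_residues_divisor_dvd[OF assms(1) g _ *(3)]) (use g' eq in auto)
    moreover have "g dvd g'"
      by (rule free_residues_divisor_dvd[OF assms(1) g' _ *(4)]) (use g eq in \<open>auto simp flip: eq\<close>)
    ultimately have gg: "g = g'" by (rule dvd_antisym[rotated])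
    have "d * g = d' * g" using g g' gg by metis
    hence "d = d'" using pos by simp
    thus "d = d' \<and> h = h'" using eq gg pos by simp
  qed
  show "(\<lambda>(d,h). (q div d) ^ \<beta> * h) ` (SIGMA d:{d. d dvd q}. free_residues \<beta> d) = {..<q ^ \<beta>}"
  proof (intro equalityI subsetI)
    fix m assume "m \<in> (\<lambda>(d,h). (q div d) ^ \<beta> * h) ` (SIGMA d:{d. d dvd q}. free_residues \<beta> d)"
    then obtain d h where *: "d dvd q" "h \<in> free_residues \<beta> d" "m = (q div d) ^ \<beta> * h" by auto
    obtain g where g: "q = d * g" using *(1) by (rule dvdE)
    have pos: "d > 0" "g > 0" using g assms by (auto intro!: Nat.gr0I)
    have qd: "q div d = g" using g pos by simp
    have "h < d ^ \<beta>" using *(2) by (simp add: free_residues_def)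
    hence "g ^ \<beta> * h < g ^ \<beta> * d ^ \<beta>" using pos by simp
    thus "m \<in> {..<q ^ \<beta>}" by (simp add: *(3) qd) (simp add: g power_mult_distrib mult.commute)
  next
    fix m assume m: "m \<in> {..<q ^ \<beta>}"
    \<comment> \<open>The preimage is read off from the largest such g. The residue m = 0 gives g =
      q, d = 1 and h = 0.\<close>
    define G where "G = {g. g dvd q \<and> g ^ \<beta> dvd m}"
    have fin: "finite G" unfolding G_def using assms by (auto intro: finite_subset[OF _ finite_divisors_nat[of q]])
    have "1 \<in> G" by (auto simp: G_def)
    define g where "g = Max G"
    have "g \<in> G" unfolding g_def using fin \<open>1 \<in> G\<close> by (intro Max_in) auto
    hence g: "g dvd q" "g ^ \<beta> dvd m" by (auto simp: G_def)
    then obtain d h where dh: "q = g * d" "m = g ^ \<beta> * h" by (auto elim!: dvdE)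
    have pos: "g > 0" "d > 0" using dh assms by (auto intro!: Nat.gr0I)
    have qd: "q div d = g" using dh pos by simp
    have "h \<in> free_residues \<beta> d"
    proof -
      have "g ^ \<beta> * h < g ^ \<beta> * d ^ \<beta>" using m dh by (simp add: power_mult_distrib)
      hence "h < d ^ \<beta>" by simp
      moreover have False if e: "e > 1" "e ^ \<beta> dvd h" "e ^ \<beta> dvd d ^ \<beta>" for e
      proof -
        have "e dvd d" using e(3) assms by (simp add: pow_divides_pow_iff)
        hence "g * e \<in> G" using e dh by (auto simp: G_def power_mult_distrib)
        hence "g * e \<le> g" unfolding g_def using fin by (intro Max_ge) (auto simp: g_def)
        thus False using e pos by simp
      qed
      ultimately show ?thesis by (auto simp: free_residues_def)
    qed
    thus "m \<in> (\<lambda>(d,h). (q div d) ^ \<beta> * h) ` (SIGMA d:{d. d dvd q}. free_residues \<beta> d)"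
      using dh qd by (intro image_eqI[of _ _ "(d, h)"]) auto
  qed
qed

lemma sum_exp_roots:
  fixes N n :: nat
  assumes "N > 0"
  shows "(\<Sum>h<N. exp (2 * of_real pi * \<i> * of_nat n * of_nat h / of_nat N)) = (if N dvd n then of_nat N else (0::complex))"
proof -
  define w where "w = exp (2 * of_real pi * \<i> * of_nat n / of_nat N :: complex)"
  have pw: "exp (2 * of_real pi * \<i> * of_nat n * of_nat h / of_nat N) = w ^ h" for h
    unfolding w_def by (simp add: exp_of_nat_mult [symmetric] mult_ac)
  have w1: "w = 1 \<longleftrightarrow> N dvd n"
  proof
    assume "N dvd n"
    then obtain k where k: "n = N * k" by (auto elim: dvdE)
    have "w = exp (2 * of_real pi * \<i> * of_nat k)"
      unfolding w_def using assms by (intro arg_cong[of _ _ exp]) (simp add: k)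
    also have "\<dots> = 1" unfolding exp_eq_1 by (auto intro: exI[of _ "int k"])
    finally show "w = 1" .
  next
    assume "w = 1"
    then obtain k :: int where "Im (2 * of_real pi * \<i> * of_nat n / of_nat N :: complex) = of_int (2 * k) * pi"
      unfolding w_def exp_eq_1 by auto
    hence "2 * pi * n / N = 2 * k * pi" by (simp add: Im_divide_of_nat)
    hence "real n = k * N" using assms by (simp add: field_simps)
    hence "int n = k * int N" by (metis of_int_eq_iff of_int_mult of_int_of_nat_eq)
    thus "N dvd n" by (metis dvd_triv_right int_dvd_int_iff)
  qed
  have wN: "w ^ N = 1"
  proof -
    have "w ^ N = exp (2 * of_real pi * \<i> * of_nat n * of_nat N / of_nat N)" by (simp only: pw)
    also have "\<dots> = exp (2 * of_real pi * \<i> * of_nat n)" using assms by simp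
    also have "\<dots> = 1" unfolding exp_eq_1 by (auto intro: exI[of _ "int n"])
    finally show ?thesis .
  qed
  show ?thesis
  proof (cases "N dvd n")
    case True
    with w1 show ?thesis by (simp add: pw)
  next
    case False
    with w1 have "w \<noteq> 1" by simp
    hence "(\<Sum>h<N. w ^ h) = 0" using wN by (simp add: sum_gp_strict)
    thus ?thesis using False by (simp add: pw)
  qed
qed

lemma ramanujan_sum_beta_altdef:
  "ramanujan_sum_beta \<beta> q n =
     (\<Sum>h\<in>free_residues \<beta> q. exp (2 * of_real pi * \<i> * of_nat n * of_nat h / of_nat (q ^ \<beta>)))"
  unfolding ramanujan_sum_beta_def free_residues_def ..

lemma finite_free_residues [simp]: "finite (free_residues \<beta> q)"
  by (rule finite_subset[of _ "{..<q ^ \<beta>}"]) (auto simp: free_residues_def)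

text \<open>The residues modulo q^beta are grouped by \<open>bij_betw_free_residues\<close>: the
  fraction (q/d)^beta h / q^beta reduces to h / d^beta, so each group contributes the sum for d,
  while the full sum is evaluated by orthogonality of the roots of unity.\<close>

lemma sum_ramanujan_sum_beta:
  assumes "q > 0" "\<beta> > 0"
  shows "(\<Sum>d | d dvd q. ramanujan_sum_beta \<beta> d n) = (if q ^ \<beta> dvd n then of_nat (q ^ \<beta>) else 0)"
proof -
  define e where "e = (\<lambda>N h. exp (2 * of_real pi * \<i> * of_nat n * of_nat h / of_nat N :: complex))"
  have "(if q ^ \<beta> dvd n then of_nat (q ^ \<beta>) else 0) = (\<Sum>h<q^\<beta>. e (q^\<beta>) h)"
    unfolding e_def using assms by (subst sum_exp_roots) simp_all
  also have "\<dots> = (\<Sum>(d,h)\<in>(SIGMA d:{d. d dvd q}. free_residues \<beta> d). e (q^\<beta>) ((q div d) ^ \<beta> * h))"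
    using sum.reindex_bij_betw[OF bij_betw_free_residues[OF assms], of "e (q^\<beta>)"]
    by (simp add: case_prod_unfold)
  also have "\<dots> = (\<Sum>d | d dvd q. \<Sum>h\<in>free_residues \<beta> d. e (q^\<beta>) ((q div d) ^ \<beta> * h))"
    using assms by (subst sum.Sigma) auto
  also have "\<dots> = (\<Sum>d | d dvd q. \<Sum>h\<in>free_residues \<beta> d. e (d^\<beta>) h)"
  proof (intro sum.cong refl)
    fix d h assume "d \<in> {d. d dvd q}"
    then obtain g where g: "q = d * g" by (auto elim: dvdE)
    have "d > 0" "g > 0" using g assms by auto
    thus "e (q^\<beta>) ((q div d) ^ \<beta> * h) = e (d^\<beta>) h"
      unfolding e_def by (intro arg_cong[of _ _ exp]) (simp add: g power_mult_distrib divide_simps)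
  qed
  finally show ?thesis by (simp add: e_def ramanujan_sum_beta_altdef)
qed

lemma norm_ramanujan_sum_beta_le: "norm (ramanujan_sum_beta \<beta> q n) \<le> real q ^ \<beta>"
proof -
  have "norm (ramanujan_sum_beta \<beta> q n) \<le> (\<Sum>h\<in>free_residues \<beta> q. 1)"
    unfolding ramanujan_sum_beta_altdef
  proof (rule sum_norm_le)
    fix h
    have "exp (2 * of_real pi * \<i> * of_nat n * of_nat h / of_nat (q ^ \<beta>)) = exp (\<i> * of_real (2 * pi * n * h / q ^ \<beta>))"
      by (simp add: mult_ac)
    also have "norm \<dots> = 1" by (rule norm_exp_i_times)
    finally show "norm (exp (2 * of_real pi * \<i> * of_nat n * of_nat h / of_nat (q ^ \<beta>))) \<le> 1" by simp
  qed
  also have "\<dots> = card (free_residues \<beta> q)" by simp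
  also have "card (free_residues \<beta> q) \<le> card {..<q ^ \<beta>}"
    by (intro card_mono) (auto simp: free_residues_def)
  finally show ?thesis by (simp flip: of_nat_power)
qed

section \<open>The functional equation of the zeta function\<close>

text \<open>The series is the dilogarithm. Along the circle z = r exp(it) its derivative in t is i z
  D, so the product z D is the form that is used, and it spares a division at z = 0.\<close>

lemma dilogarithm_deriv:
  fixes z :: complex
  assumes "norm z < 1"
  shows "\<exists>D. ((\<lambda>z. \<Sum>n. 1 / of_nat n ^ 2 * z ^ n) has_field_derivative D) (at z) \<and> z * D = - Ln (1 - z)"
proof -
  \<comment> \<open>Division by zero makes the coefficient at n = 0 vanish, so the series
    effectively starts at n = 1.\<close>
  define c where "c = (\<lambda>n. 1 / of_nat n ^ 2 :: complex)"
  have summ: "summable (\<lambda>n. c n * z ^ n)" if "norm z < 1" for z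
  proof (rule summable_comparison_test[OF _ summable_geometric[of "norm z"]])
    have "norm (c n * z ^ n) \<le> norm z ^ n" for n
    proof (cases "n = 0")
      case False
      hence "real n ^ 2 \<ge> 1" by simp
      hence "cmod z ^ n * 1 \<le> cmod z ^ n * real n ^ 2" by (intro mult_left_mono) auto
      thus ?thesis unfolding c_def using False by (simp add: norm_mult norm_divide norm_power divide_le_eq)
    qed (simp add: c_def)
    thus "\<exists>N. \<forall>n\<ge>N. norm (c n * z ^ n) \<le> norm z ^ n" by blast
    show "norm (norm z) < 1" using that by simp
  qed
  define D where "D = (\<Sum>n. diffs c n * z ^ n)"
  have D: "((\<lambda>z. \<Sum>n. c n * z ^ n) has_field_derivative D) (at z)"
    unfolding D_def by (rule termdiffs_strong'[OF summ]) (use assms in auto)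
  have 1: "(\<lambda>n. - (z ^ n) / of_nat n) sums Ln (1 - z)"
    using Ln_series'[of "-z"] assms by simp
  have "(\<lambda>n. - (z ^ Suc n) / of_nat (Suc n)) sums Ln (1 - z)"
    using sums_Suc_iff[of "\<lambda>n. - (z ^ n) / of_nat n" "Ln (1 - z)"] 1 by simp
  hence "(\<lambda>n. z * (diffs c n * z ^ n)) sums (- Ln (1 - z))"
  proof -
    have "z * (diffs c n * z ^ n) = - (- (z ^ Suc n) / of_nat (Suc n))" for n
    proof -
      have "diffs c n = 1 / of_nat (Suc n)" by (simp add: diffs_def c_def power2_eq_square del: of_nat_Suc)
      thus ?thesis by simp
    qed
    thus ?thesis using sums_minus[OF \<open>(\<lambda>n. - (z ^ Suc n) / of_nat (Suc n)) sums Ln (1 - z)\<close>] by simp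
  qed
  moreover have "summable (\<lambda>n. diffs c n * z ^ n)"
    using termdiff_converges[of z 1 c] summ assms by auto
  hence "(\<lambda>n. z * (diffs c n * z ^ n)) sums (z * D)"
    unfolding D_def by (intro sums_mult summable_sums)
  ultimately have "z * D = - Ln (1 - z)" by (metis sums_unique2)
  with D show ?thesis unfolding c_def by blast
qed

text \<open>1 - exp(it) = 2 sin(t/2) exp(i(t - pi)/2), and for 0 < t < 2 pi the angle (t - pi)/2
  lies in the range of the principal branch. This linear angle is what integrates to a quadratic
  polynomial.\<close>

lemma Ln_one_minus_cis:
  assumes "0 < t" "t < 2 * pi"
  shows "Im (Ln (1 - exp (\<i> * of_real t))) = (t - pi) / 2"
    and "1 - exp (\<i> * of_real t) \<notin> \<real>\<^sub>\<le>\<^sub>0"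
proof -
  have s: "sin (t / 2) > 0" using assms by (intro sin_gt_zero) auto
  define z where "z = of_real (ln (2 * sin (t / 2))) + \<i> * of_real ((t - pi) / 2)"
  have "exp z = of_real (2 * sin (t / 2)) * exp (\<i> * of_real (t / 2 - pi / 2))"
    unfolding z_def exp_add exp_of_real using s by (simp add: diff_divide_distrib)
  also have "exp (\<i> * of_real (t / 2 - pi / 2)) = Complex (sin (t/2)) (- cos (t/2))"
    by (simp add: exp_eq_polar complex_eq_iff cos_diff sin_diff flip: cis_conv_exp)
  also have "of_real (2 * sin (t / 2)) * Complex (sin (t/2)) (- cos (t/2)) = 1 - exp (\<i> * of_real t)"
  proof -
    have "cos t = cos (2 * (t / 2))" by simp
    also have "\<dots> = 1 - 2 * sin (t / 2) ^ 2" by (rule cos_double_sin)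
    finally have c: "cos t = 1 - 2 * sin (t / 2) ^ 2" .
    have "sin t = sin (2 * (t / 2))" by simp
    also have "\<dots> = 2 * sin (t / 2) * cos (t / 2)" by (rule sin_double)
    finally have d: "sin t = 2 * sin (t / 2) * cos (t / 2)" .
    show ?thesis by (simp add: complex_eq_iff Re_exp Im_exp c d power2_eq_square)
  qed
  finally have ez: "exp z = 1 - exp (\<i> * of_real t)" .
  have "Ln (1 - exp (\<i> * of_real t)) = z"
    by (rule Ln_unique[OF ez]) (use assms pi_gt_zero in \<open>auto simp: z_def\<close>)
  thus "Im (Ln (1 - exp (\<i> * of_real t))) = (t - pi) / 2" by (simp add: z_def)
  have "cos t < 1"
  proof -
    have "cos t = cos (2 * (t / 2))" by simp
    also have "\<dots> = 1 - 2 * sin (t / 2) ^ 2" by (rule cos_double_sin)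
    finally show ?thesis using s by simp
  qed
  thus "1 - exp (\<i> * of_real t) \<notin> \<real>\<^sub>\<le>\<^sub>0"
    by (auto simp: complex_nonpos_Reals_iff Re_exp)
qed

lemma summable_inverse_squares_real: "summable (\<lambda>n. 1 / real n ^ 2)"
  using inverse_power_summable[of 2, where ?'a = real] by (simp add: inverse_eq_divide)

text \<open>On the unit circle the differentiated series, with terms sin(nt)/n, has no summable
  majorant. So the derivative is integrated along circles of radius r < 1, and r tends to 1
  afterwards: the series passes to the limit by the majorant 1/n^2, the integral because the
  imaginary part of \<open>Ln\<close> is bounded by pi.\<close>

lemma cos_series_quadratic:
  fixes \<theta> :: real
  assumes "0 \<le> \<theta>" "\<theta> \<le> 2 * pi"
  shows "(\<lambda>n. (1 - cos (of_nat n * \<theta>)) / of_nat n ^ 2) sums (pi * \<theta> / 2 - \<theta> ^ 2 / 4)"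
proof -
  define L where "L = (\<lambda>z::complex. \<Sum>n. 1 / of_nat n ^ 2 * z ^ n)"
  \<comment> \<open>The offset 2 keeps the radius positive already at k = 0.\<close>
  define r where "r = (\<lambda>k. 1 - 1 / real (k + 2))"
  have r: "0 < r k" "r k < 1" for k unfolding r_def by (auto simp: field_simps)
  have r1: "r \<longlonglongrightarrow> 1"
  proof -
    have "(\<lambda>k. 1 - 1 / real (k + 2)) \<longlonglongrightarrow> 1 - 0"
      by (intro tendsto_diff tendsto_const LIMSEQ_ignore_initial_segment lim_1_over_n)
    thus ?thesis by (simp add: r_def)
  qed
  define e where "e = (\<lambda>t::real. exp (\<i> * of_real t))"
  have ne: "norm (e t) = 1" for t by (simp add: e_def)
  have lim: "(\<lambda>k. L (of_real (r k) * e t)) \<longlonglongrightarrow> L (e t)" for t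
  proof -
    have "((\<lambda>k. \<Sum>n. 1 / of_nat n ^ 2 * (of_real (r k) * e t) ^ n) \<longlongrightarrow> (\<Sum>n. 1 / of_nat n ^ 2 * (of_real 1 * e t) ^ n)) sequentially"
    proof (rule tannerys_theorem[where M = "\<lambda>n. 1 / real n ^ 2", THEN conjunct2, THEN conjunct2])
      fix n show "(\<lambda>k. 1 / of_nat n ^ 2 * (of_real (r k) * e t) ^ n) \<longlonglongrightarrow> 1 / of_nat n ^ 2 * (of_real 1 * e t) ^ n"
        by (intro tendsto_intros r1)
    next
      show "eventually (\<lambda>(n,k). norm (1 / of_nat n ^ 2 * (of_real (r k) * e t) ^ n) \<le> 1 / real n ^ 2) (at_top \<times>\<^sub>F sequentially)"
      proof (rule always_eventually, safe)
        fix n k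
        have "r k ^ n \<le> 1" using r[of k] by (intro power_le_one) auto
        thus "norm (1 / of_nat n ^ 2 * (of_real (r k) * e t) ^ n) \<le> 1 / real n ^ 2"
          using r[of k] by (simp add: norm_mult norm_divide norm_power ne divide_right_mono)
      qed
    qed (use summable_inverse_squares_real in auto)
    thus ?thesis by (simp add: L_def)
  qed
  have deriv: "((\<lambda>t. Re (L (of_real (r k) * e t))) has_real_derivative Im (Ln (1 - of_real (r k) * e t))) (at t within A)" for k t A
  proof -
    have "norm (of_real (r k) * e t) < 1" using r[of k] by (simp add: norm_mult ne)
    from dilogarithm_deriv[OF this] obtain D where
      D: "(L has_field_derivative D) (at (of_real (r k) * e t))" "of_real (r k) * e t * D = - Ln (1 - of_real (r k) * e t)"
      unfolding L_def by auto
    have "((\<lambda>w. L (of_real (r k) * exp (\<i> * w))) has_field_derivative D * (of_real (r k) * (exp (\<i> * of_real t) * \<i>))) (at (of_real t))"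
      by (rule DERIV_chain'[where f = "\<lambda>w. of_real (r k) * exp (\<i> * w)" and g = L])
         (use D(1) in \<open>auto intro!: derivative_eq_intros simp: e_def\<close>)
    hence "((\<lambda>t. L (of_real (r k) * e t)) has_vector_derivative D * (of_real (r k) * (exp (\<i> * of_real t) * \<i>))) (at t within A)"
      unfolding e_def by (rule has_vector_derivative_real_field)
    also have "D * (of_real (r k) * (exp (\<i> * of_real t) * \<i>)) = \<i> * (of_real (r k) * e t * D)"
      by (simp add: e_def)
    also have "\<dots> = - \<i> * Ln (1 - of_real (r k) * e t)" by (simp add: D(2))
    finally show ?thesis by (auto dest: has_field_derivative_Re)
  qed
  \<comment> \<open>The open interval avoids t = 0 and t = 2 pi, where 1 - exp(it) vanishes and
    continuity of \<open>Ln\<close> cannot be used.\<close>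
  have int: "((\<lambda>t. Im (Ln (1 - of_real (r k) * e t))) has_integral (Re (L (of_real (r k) * e \<theta>)) - Re (L (of_real (r k) * e 0)))) {0<..<\<theta>}" for k
    unfolding has_integral_Icc_iff_Ioo[symmetric]
    by (rule fundamental_theorem_of_calculus)
       (use assms deriv in \<open>auto simp: has_real_derivative_iff_has_vector_derivative[symmetric]\<close>)
  have int2: "((\<lambda>t. (t - pi) / 2) has_integral (\<theta> ^ 2 / 4 - pi * \<theta> / 2 - (0 ^ 2 / 4 - pi * 0 / 2))) {0<..<\<theta>}"
    unfolding has_integral_Icc_iff_Ioo[symmetric]
    by (rule fundamental_theorem_of_calculus)
       (use assms in \<open>auto simp: has_real_derivative_iff_has_vector_derivative[symmetric] diff_divide_distrib intro!: derivative_eq_intros\<close>)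
  have "(\<lambda>k. integral {0<..<\<theta>} (\<lambda>t. Im (Ln (1 - of_real (r k) * e t)))) \<longlonglongrightarrow> integral {0<..<\<theta>} (\<lambda>t. (t - pi) / 2)"
  proof (rule dominated_convergence(2)[where h = "\<lambda>_. pi"])
    show "(\<lambda>_. pi) integrable_on {0<..<\<theta>}" 
      unfolding integrable_on_Icc_iff_Ioo[symmetric] by (rule integrable_const_ivl)
  next
    fix k t
    have "1 - of_real (r k) * e t \<noteq> 0"
    proof
      assume "1 - of_real (r k) * e t = 0"
      hence "norm (of_real (r k) * e t) = 1" by (metis eq_iff_diff_eq_0 norm_one)
      thus False using r[of k] by (simp add: norm_mult ne)
    qed
    from mpi_less_Im_Ln[OF this] Im_Ln_le_pi[OF this]
    show "norm (Im (Ln (1 - of_real (r k) * e t))) \<le> pi" by auto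
  next
    fix t assume t: "t \<in> {0<..<\<theta>}"
    have "(\<lambda>k. Im (Ln (1 - of_real (r k) * e t))) \<longlonglongrightarrow> Im (Ln (1 - of_real 1 * e t))"
      using Ln_one_minus_cis(2)[of t] t assms by (intro tendsto_intros r1) (auto simp: e_def)
    also have "Im (Ln (1 - of_real 1 * e t)) = (t - pi) / 2"
      using Ln_one_minus_cis(1)[of t] t assms by (simp add: e_def)
    finally show "(\<lambda>k. Im (Ln (1 - of_real (r k) * e t))) \<longlonglongrightarrow> (t - pi) / 2" .
  qed (use int in blast)
  hence "(\<lambda>k. Re (L (of_real (r k) * e \<theta>)) - Re (L (of_real (r k) * e 0))) \<longlonglongrightarrow> \<theta> ^ 2 / 4 - pi * \<theta> / 2"
    using int by (simp only: integral_unique[OF int] integral_unique[OF int2]) simp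
  moreover have "(\<lambda>k. Re (L (of_real (r k) * e \<theta>)) - Re (L (of_real (r k) * e 0))) \<longlonglongrightarrow> Re (L (e \<theta>)) - Re (L (e 0))"
    by (intro tendsto_intros lim)
  ultimately have eq: "Re (L (e \<theta>)) - Re (L (e 0)) = \<theta> ^ 2 / 4 - pi * \<theta> / 2"
    by (rule LIMSEQ_unique[rotated])
  have sums: "(\<lambda>n. cos (of_nat n * t) / of_nat n ^ 2) sums Re (L (e t))" for t
  proof -
    have "summable (\<lambda>n. 1 / of_nat n ^ 2 * e t ^ n)"
      by (rule summable_comparison_test'[OF summable_inverse_squares_real, of 0])
         (simp add: norm_mult norm_divide norm_power ne)
    hence "(\<lambda>n. 1 / of_nat n ^ 2 * e t ^ n) sums L (e t)"
      unfolding L_def by (rule summable_sums)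
    hence "(\<lambda>n. Re (1 / of_nat n ^ 2 * e t ^ n)) sums Re (L (e t))" by (rule sums_Re)
    moreover have "Re (1 / of_nat n ^ 2 * e t ^ n) = cos (of_nat n * t) / of_nat n ^ 2" for n
    proof -
      have "e t ^ n = exp (\<i> * of_real (of_nat n * t))"
        by (simp add: e_def exp_of_nat_mult [symmetric] mult_ac)
      moreover have "1 / of_nat n ^ 2 = (of_real (1 / real n ^ 2) :: complex)" by simp
      ultimately have "Re (1 / of_nat n ^ 2 * e t ^ n) = 1 / real n ^ 2 * Re (exp (\<i> * of_real (of_nat n * t)))"
        by (simp only: Re_complex_of_real times_complex.sel Im_complex_of_real mult_zero_left diff_zero)
      thus ?thesis by (simp add: Re_exp)
    qed
    ultimately show ?thesis by (simp only:)
  qed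
  have "(\<lambda>n. cos (of_nat n * 0) / of_nat n ^ 2 - cos (of_nat n * \<theta>) / of_nat n ^ 2) sums (Re (L (e 0)) - Re (L (e \<theta>)))"
    by (intro sums_diff sums)
  moreover have "Re (L (e 0)) - Re (L (e \<theta>)) = pi * \<theta> / 2 - \<theta> ^ 2 / 4" using eq by simp
  ultimately show ?thesis by (simp add: diff_divide_distrib)
qed

lemma sin_square_series:
  fixes x :: real
  assumes "0 \<le> x" "x \<le> 1"
  shows "(\<lambda>k. 2 * sin (pi * real (Suc k) * x) ^ 2 / (pi * real (Suc k)) ^ 2) sums (x * (1 - x))"
proof -
  have "(\<lambda>n. (1 - cos (of_nat n * (2 * pi * x))) / of_nat n ^ 2) sums (pi * (2 * pi * x) / 2 - (2 * pi * x) ^ 2 / 4)"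
    using assms by (intro cos_series_quadratic) auto
  hence "(\<lambda>n. (1 / pi ^ 2) * ((1 - cos (of_nat n * (2 * pi * x))) / of_nat n ^ 2)) sums ((1 / pi ^ 2) * (pi * (2 * pi * x) / 2 - (2 * pi * x) ^ 2 / 4))"
    by (rule sums_mult)
  also have "(1 / pi ^ 2) * (pi * (2 * pi * x) / 2 - (2 * pi * x) ^ 2 / 4) = x * (1 - x)"
    by (simp add: field_simps power2_eq_square)
  finally have "(\<lambda>n. 2 * sin (pi * real n * x) ^ 2 / (pi * real n) ^ 2) sums (x * (1 - x))"
  proof (rule sums_cong[THEN iffD1, rotated])
    fix n
    have "cos (of_nat n * (2 * pi * x)) = cos (2 * (pi * real n * x))" by (simp add: mult_ac)
    also have "\<dots> = 1 - 2 * sin (pi * real n * x) ^ 2" by (rule cos_double_sin)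
    finally show "(1 / pi ^ 2) * ((1 - cos (of_nat n * (2 * pi * x))) / of_nat n ^ 2) = 2 * sin (pi * real n * x) ^ 2 / (pi * real n) ^ 2"
      by (simp add: power_mult_distrib)
  qed
  thus ?thesis by (subst sums_Suc_iff) simp
qed

section \<open>Integrals of Gamma type\<close>

text \<open>This and the following integrals are stated as nonnegative Lebesgue integrals, so that
  every exchange of integrations is Tonelli's theorem and requires measurability only.\<close>

lemma nn_integral_Gamma_scaled:
  fixes a w :: real
  assumes "a > 0" "w > 0"
  shows "(\<integral>\<^sup>+u. ennreal (indicator {0<..} u * u powr (a - 1) * exp (- (w * u))) \<partial>lborel) = ennreal (Gamma a * w powr (-a))"
proof -
  define f where "f = (\<lambda>u::real. ennreal (indicator {0<..} u * u powr (a - 1) * exp (- u)))"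
  define g where "g = (\<lambda>u::real. ennreal (indicator {0<..} u * u powr (a - 1) * exp (- (w * u))))"
  have [measurable]: "f \<in> borel_measurable borel" "g \<in> borel_measurable borel"
    unfolding f_def g_def by measurable
  have "ennreal (Gamma a) = (\<integral>\<^sup>+u. f u \<partial>lborel)"
    unfolding Gamma_conv_nn_integral_real[OF assms(1)] f_def
    by (intro nn_integral_cong) (auto simp: indicator_def exp_minus field_simps)
  also have "\<dots> = \<bar>w\<bar> * (\<integral>\<^sup>+u. f (0 + w * u) \<partial>lborel)"
    using assms by (intro nn_integral_real_affine) auto
  also have "(\<integral>\<^sup>+u. f (0 + w * u) \<partial>lborel) = (\<integral>\<^sup>+u. ennreal (w powr (a - 1)) * g u \<partial>lborel)"
    using assms unfolding f_def g_def
    by (intro nn_integral_cong) (auto simp: indicator_def zero_less_mult_iff powr_mult mult_ac simp flip: ennreal_mult')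
  also have "\<dots> = ennreal (w powr (a - 1)) * (\<integral>\<^sup>+u. g u \<partial>lborel)"
    by (rule nn_integral_cmult) simp
  also have "ennreal \<bar>w\<bar> * (ennreal (w powr (a - 1)) * (\<integral>\<^sup>+u. g u \<partial>lborel)) = ennreal (w powr a) * (\<integral>\<^sup>+u. g u \<partial>lborel)"
    using assms by (simp add: powr_diff mult.assoc[symmetric] ennreal_mult[symmetric])
  finally have "ennreal (w powr (-a)) * ennreal (Gamma a) = ennreal (w powr (-a)) * ennreal (w powr a) * (\<integral>\<^sup>+u. g u \<partial>lborel)"
    by (simp add: mult.assoc)
  also have "ennreal (w powr (-a)) * ennreal (w powr a) = 1"
    using assms by (simp add: ennreal_mult[symmetric] powr_minus)
  finally show ?thesis using assms by (simp add: g_def ennreal_mult[symmetric] mult.commute)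
qed

lemma nn_integral_Laplace_sin_square:
  fixes u :: real
  assumes "u > 0"
  shows "(\<integral>\<^sup>+x. ennreal (indicator {0<..} x * sin (pi * x) ^ 2 * exp (- (u * x))) \<partial>lborel) =
           ennreal (2 * pi ^ 2 / (u * (u ^ 2 + 4 * pi ^ 2)))"
proof -
  define b where "b = 2 * pi"
  define c where "c = 1 / (2 * (u ^ 2 + b ^ 2))"
  define k where "k = 1 / (2 * u)"
  \<comment> \<open>An antiderivative of exp(-ux)(1 - cos(bx))/2, which is exp(-ux) sin^2(pi x)
    since b = 2 pi.\<close>
  define F where "F = (\<lambda>x. - k * exp (-(u*x)) - c * (exp (-(u*x)) * (b * sin (b*x) - u * cos (b*x))))"
  have pos: "u ^ 2 + b ^ 2 > 0" using assms by (simp add: add_pos_nonneg)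
  have k: "k * u = 1 / 2" using assms by (simp add: k_def)
  have c2: "c * (u ^ 2 + b ^ 2) = 1 / 2" using pos by (simp add: c_def)
  have "(\<integral>\<^sup>+x. ennreal (indicator {0<..} x * sin (pi * x) ^ 2 * exp (- (u * x))) \<partial>lborel) =
        (\<integral>\<^sup>+x. ennreal (sin (pi * x) ^ 2 * exp (- (u * x))) * indicator {0..} x \<partial>lborel)"
    by (intro nn_integral_cong) (auto simp: indicator_def)
  also have "\<dots> = ennreal (0 - F 0)"
  proof (rule nn_integral_FTC_atLeast)
    fix x :: real
    have c: "cos (b * x) = 1 - 2 * sin (pi * x) ^ 2"
      using cos_double_sin[of "pi * x"] by (simp add: b_def mult_ac)
    have "(F has_real_derivative (k * u * exp (-(u*x)) - c * ((- u * exp (-(u*x))) * (b * sin (b*x) - u * cos (b*x)) + exp (-(u*x)) * (b * (b * cos (b*x)) + u * (b * sin (b*x)))))) (at x)"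
      unfolding F_def by (auto intro!: derivative_eq_intros simp: algebra_simps)
    also have "(- u * exp (-(u*x))) * (b * sin (b*x) - u * cos (b*x)) + exp (-(u*x)) * (b * (b * cos (b*x)) + u * (b * sin (b*x))) = (u^2 + b^2) * (exp (-(u*x)) * cos (b * x))"
      by (simp add: algebra_simps power2_eq_square)
    also have "c * ((u^2 + b^2) * (exp (-(u*x)) * cos (b * x))) = (exp (-(u*x)) * cos (b * x)) / 2"
      unfolding mult.assoc[symmetric] c2 by simp
    also have "k * u * exp (-(u*x)) - (exp (-(u*x)) * cos (b * x)) / 2 = sin (pi * x) ^ 2 * exp (- (u * x))"
      unfolding k c by (simp add: field_simps)
    finally show "(F has_real_derivative sin (pi * x) ^ 2 * exp (- (u * x))) (at x)" .
  next
    have e: "((\<lambda>x. exp (-(u*x))) \<longlongrightarrow> 0) at_top"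
      using assms by real_asymp
    have 2: "((\<lambda>x. exp (-(u*x)) * (b * sin (b*x) - u * cos (b*x))) \<longlongrightarrow> 0) at_top"
    proof (rule Lim_null_comparison)
      show "((\<lambda>x. exp (-(u*x)) * (b + u)) \<longlongrightarrow> 0) at_top" by (rule tendsto_mult_left_zero[OF e])
      show "eventually (\<lambda>x. norm (exp (-(u*x)) * (b * sin (b*x) - u * cos (b*x))) \<le> exp (-(u*x)) * (b + u)) at_top"
      proof (rule always_eventually, safe)
        fix x
        have "\<bar>b * sin (b*x) - u * cos (b*x)\<bar> \<le> \<bar>b * sin (b*x)\<bar> + \<bar>u * cos (b*x)\<bar>" by linarith
        also have "\<dots> \<le> b * 1 + u * 1"
          unfolding abs_mult using assms by (intro add_mono mult_mono) (auto simp: b_def)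
        finally show "norm (exp (-(u*x)) * (b * sin (b*x) - u * cos (b*x))) \<le> exp (-(u*x)) * (b + u)"
          by (simp add: abs_mult)
      qed
    qed
    have "(F \<longlongrightarrow> - k * 0 - c * 0) at_top"
      unfolding F_def by (intro tendsto_intros e 2)
    thus "(F \<longlongrightarrow> 0) at_top" by simp
  qed auto
  also have "0 - F 0 = 2 * pi ^ 2 / (u * (u ^ 2 + 4 * pi ^ 2))"
  proof -
    have "0 - F 0 = b ^ 2 / (2 * u * (u^2 + b^2))"
      unfolding F_def c_def k_def using assms pos by (simp add: divide_simps) (simp add: algebra_simps power2_eq_square)
    also have "\<dots> = 2 * pi ^ 2 / (u * (u ^ 2 + 4 * pi ^ 2))"
    proof -
      define N where "N = u ^ 2 + 4 * pi ^ 2"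
      have "N > 0" using pos by (simp add: N_def b_def)
      moreover have "u ^ 2 + b ^ 2 = N" "b ^ 2 = 4 * pi ^ 2" by (simp_all add: N_def b_def)
      ultimately show ?thesis unfolding N_def[symmetric] using assms by (simp add: divide_simps)
    qed
    finally show ?thesis .
  qed
  finally show ?thesis .
qed

text \<open>A beta integral: writing 1/(1 + t) as the integral of exp(-v(1 + t)) over v > 0 and
  exchanging the order separates it into two Gamma integrals.\<close>

lemma nn_integral_powr_over_one_plus:
  fixes q :: real
  assumes "0 < q" "q < 1"
  shows "(\<integral>\<^sup>+t. ennreal (indicator {0<..} t * t powr (q - 1) / (1 + t)) \<partial>lborel) = ennreal (Gamma q * Gamma (1 - q))"
proof -
  have "(\<integral>\<^sup>+t. ennreal (indicator {0<..} t * t powr (q - 1) / (1 + t)) \<partial>lborel) =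
        (\<integral>\<^sup>+t. (\<integral>\<^sup>+v. ennreal (indicator {0<..} t * t powr (q - 1) * (indicator {0<..} v * exp (- (v * (1 + t))))) \<partial>lborel) \<partial>lborel)"
  proof (intro nn_integral_cong)
    fix t :: real
    show "ennreal (indicator {0<..} t * t powr (q - 1) / (1 + t)) =
          (\<integral>\<^sup>+v. ennreal (indicator {0<..} t * t powr (q - 1) * (indicator {0<..} v * exp (- (v * (1 + t))))) \<partial>lborel)"
    proof (cases "t > 0")
      case True
      have "(\<integral>\<^sup>+v. ennreal (indicator {0<..} t * t powr (q - 1) * (indicator {0<..} v * exp (- (v * (1 + t))))) \<partial>lborel) =
            (\<integral>\<^sup>+v. ennreal (t powr (q - 1)) * ennreal (indicator {0<..} v * v powr (1 - 1) * exp (- ((1 + t) * v))) \<partial>lborel)"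
        using True by (intro nn_integral_cong) (auto simp: indicator_def mult_ac simp flip: ennreal_mult')
      also have "\<dots> = ennreal (t powr (q - 1)) * ennreal (Gamma 1 * (1 + t) powr (-1))"
        using True by (subst nn_integral_cmult) (simp, subst nn_integral_Gamma_scaled, auto)
      finally show ?thesis using True by (simp add: powr_minus field_simps flip: ennreal_mult')
    qed auto
  qed
  also have "\<dots> = (\<integral>\<^sup>+v. (\<integral>\<^sup>+t. ennreal (indicator {0<..} t * t powr (q - 1) * (indicator {0<..} v * exp (- (v * (1 + t))))) \<partial>lborel) \<partial>lborel)"
    by (rule lborel_pair.Fubini') measurable
  also have "\<dots> = (\<integral>\<^sup>+v. ennreal (Gamma q) * ennreal (indicator {0<..} v * v powr ((1 - q) - 1) * exp (- (1 * v))) \<partial>lborel)"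
  proof (intro nn_integral_cong)
    fix v :: real
    show "(\<integral>\<^sup>+t. ennreal (indicator {0<..} t * t powr (q - 1) * (indicator {0<..} v * exp (- (v * (1 + t))))) \<partial>lborel) =
          ennreal (Gamma q) * ennreal (indicator {0<..} v * v powr ((1 - q) - 1) * exp (- (1 * v)))"
    proof (cases "v > 0")
      case True
      have "(\<integral>\<^sup>+t. ennreal (indicator {0<..} t * t powr (q - 1) * (indicator {0<..} v * exp (- (v * (1 + t))))) \<partial>lborel) =
            (\<integral>\<^sup>+t. ennreal (exp (-v)) * ennreal (indicator {0<..} t * t powr (q - 1) * exp (- (v * t))) \<partial>lborel)"
        using True by (intro nn_integral_cong) (auto simp: indicator_def mult_ac exp_add[symmetric] algebra_simps simp flip: ennreal_mult')
      also have "\<dots> = ennreal (exp (-v)) * ennreal (Gamma q * v powr (-q))"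
        using True assms by (subst nn_integral_cmult) (simp, subst nn_integral_Gamma_scaled, auto)
      finally show ?thesis using True assms by (simp add: mult_ac flip: ennreal_mult')
    qed auto
  qed
  also have "\<dots> = ennreal (Gamma q) * ennreal (Gamma (1 - q) * 1 powr (-(1 - q)))"
    using assms by (subst nn_integral_cmult) (simp, subst nn_integral_Gamma_scaled, auto)
  finally show ?thesis using assms by (simp flip: ennreal_mult')
qed

lemma nn_integral_powr_over_one_plus_square:
  fixes p :: real
  assumes "0 < p" "p < 1"
  shows "(\<integral>\<^sup>+y. ennreal (indicator {0<..} y * y powr (-p) / (1 + y ^ 2)) \<partial>lborel) = ennreal (pi / (2 * cos (pi * p / 2)))"
proof -
  \<comment> \<open>The substitution t = y^2 turns y^(-p) dy into t^(q - 1) dt / 2 for this q, and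
    the reflection formula gives pi / sin(pi q) = pi / cos(pi p / 2).\<close>
  define q where "q = (1 - p) / 2"
  have q: "0 < q" "q < 1" using assms by (auto simp: q_def)
  define G where "G = Gamma q * Gamma (1 - q)"
  have "Gamma (of_real q :: complex) * Gamma (1 - of_real q) = of_real pi / sin (of_real pi * of_real q)"
    by (rule Gamma_reflection_complex)
  also have "1 - complex_of_real q = of_real (1 - q)" by simp
  finally have "complex_of_real G = of_real (pi / sin (pi * q))"
    unfolding G_def Gamma_complex_of_real of_real_mult[symmetric] sin_of_real of_real_divide[symmetric] .
  hence "G = pi / sin (pi * q)" by (simp only: of_real_eq_iff)
  also have "sin (pi * q) = cos (pi * p / 2)"
    by (simp add: q_def cos_sin_eq diff_divide_distrib algebra_simps)
  finally have G: "G = pi / cos (pi * p / 2)" .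
  define f where "f = (\<lambda>t::real. t powr (q - 1) / (1 + t))"
  have Gnn: "G \<ge> 0" unfolding G_def using q by simp
  have "((\<lambda>t. indicator {0<..} t * t powr (q - 1) / (1 + t)) has_integral G) UNIV"
    by (rule nn_integral_has_integral)
       (use nn_integral_powr_over_one_plus[OF q] Gnn in \<open>auto simp: G_def indicator_def\<close>)
  also have "(\<lambda>t. indicator {0<..} t * t powr (q - 1) / (1 + t)) = (\<lambda>t. if t \<in> {0<..} then f t else 0)"
    by (auto simp: f_def indicator_def fun_eq_iff)
  finally have hi: "(f has_integral G) {0<..}"
    unfolding has_integral_restrict_UNIV .
  have img: "(\<lambda>y::real. y ^ 2) ` {0<..} = {0<..}"
  proof (intro equalityI subsetI)
    fix t :: real assume "t \<in> {0<..}"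
    thus "t \<in> (\<lambda>y::real. y ^ 2) ` {0<..}" by (intro image_eqI[of _ _ "sqrt t"]) auto
  qed auto
  have "f absolutely_integrable_on {0<..}"
    by (rule nonnegative_absolutely_integrable_1) (use hi in \<open>auto simp: f_def\<close>)
  with hi have "f absolutely_integrable_on ((\<lambda>y::real. y ^ 2) ` {0<..}) \<and> integral ((\<lambda>y::real. y ^ 2) ` {0<..}) f = G"
    unfolding img by (simp add: integral_unique)
  moreover have "(\<lambda>x. \<bar>2 * x\<bar> *\<^sub>R f (x ^ 2)) absolutely_integrable_on {0<..} \<and> integral {0<..} (\<lambda>x. \<bar>2 * x\<bar> *\<^sub>R f (x ^ 2)) = G
      \<longleftrightarrow> f absolutely_integrable_on ((\<lambda>y::real. y ^ 2) ` {0<..}) \<and> integral ((\<lambda>y::real. y ^ 2) ` {0<..}) f = G"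
    by (rule has_absolute_integral_change_of_variables_real)
       (auto intro!: derivative_eq_intros inj_onI simp: power2_eq_iff)
  ultimately have "((\<lambda>x. \<bar>2 * x\<bar> *\<^sub>R f (x ^ 2)) has_integral G) {0<..}"
    by (auto simp: absolutely_integrable_on_def has_integral_iff)
  hence "((\<lambda>x. (1/2) * (\<bar>2 * x\<bar> *\<^sub>R f (x ^ 2))) has_integral (1/2) * G) {0<..}"
    by (rule has_integral_mult_right)
  also have "?this \<longleftrightarrow> ((\<lambda>y. y powr (-p) / (1 + y ^ 2)) has_integral (1/2) * G) {0<..}"
  proof (rule has_integral_cong)
    fix y :: real assume y: "y \<in> {0<..}"
    have "(y ^ 2) powr (q - 1) = y powr (2 * (q - 1))"
      using y by (simp add: powr_powr flip: powr_numeral)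
    also have "2 * (q - 1) = -p - 1" by (simp add: q_def field_simps)
    also have "y powr (-p - 1) = y powr (-p) / y" using y by (simp add: powr_diff)
    finally have *: "(y ^ 2) powr (q - 1) = y powr (-p) / y" .
    show "(1/2) * (\<bar>2 * y\<bar> *\<^sub>R f (y ^ 2)) = y powr (-p) / (1 + y ^ 2)"
      using y unfolding f_def * by simp
  qed
  finally have "(\<integral>\<^sup>+x. ennreal (indicator {0<..} x * (x powr (-p) / (1 + x ^ 2))) \<partial>lborel) = ennreal ((1/2) * G)"
    by (intro nn_integral_has_integral_lebesgue) (auto intro!: divide_nonneg_nonneg)
  thus ?thesis by (simp add: G)
qed

text \<open>The power x^(p - 2) is replaced by the integral of u^(1 - p) exp(-xu) / Gamma(2 - p)
  over u > 0. After the exchange the inner integral is the Laplace transform of sin^2(pi x), and u =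
  2 pi y reduces the rest to the preceding integral.\<close>

lemma nn_integral_sin_square_powr:
  fixes p :: real
  assumes p: "0 < p" "p < 1"
  shows "(\<integral>\<^sup>+x. ennreal (indicator {0<..} x * sin (pi * x) ^ 2 * x powr (p - 2)) \<partial>lborel) =
           ennreal (2 * pi ^ 2 / Gamma (2 - p) * (2 * pi) powr (-p - 1) * (pi / (2 * cos (pi * p / 2))))"
proof -
  define I where "I = (\<integral>\<^sup>+x. ennreal (indicator {0<..} x * sin (pi * x) ^ 2 * x powr (p - 2)) \<partial>lborel)"
  define G where "G = Gamma (2 - p)"
  have G: "G > 0" unfolding G_def using p by simp
  have cpos: "cos (pi * p / 2) > 0" using p by (intro cos_gt_zero) auto
  have "ennreal G * I = (\<integral>\<^sup>+x. ennreal G * ennreal (indicator {0<..} x * sin (pi * x) ^ 2 * x powr (p - 2)) \<partial>lborel)"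
    unfolding I_def by (rule nn_integral_cmult [symmetric]) simp
  also have "\<dots> = (\<integral>\<^sup>+x. (\<integral>\<^sup>+u. ennreal ((indicator {0<..} x * sin (pi * x) ^ 2) * (indicator {0<..} u * u powr (1 - p) * exp (- (x * u)))) \<partial>lborel) \<partial>lborel)"
  proof (intro nn_integral_cong)
    fix x :: real
    show "ennreal G * ennreal (indicator {0<..} x * sin (pi * x) ^ 2 * x powr (p - 2)) =
          (\<integral>\<^sup>+u. ennreal ((indicator {0<..} x * sin (pi * x) ^ 2) * (indicator {0<..} u * u powr (1 - p) * exp (- (x * u)))) \<partial>lborel)"
    proof (cases "x > 0")
      case True
      have "(\<integral>\<^sup>+u. ennreal ((indicator {0<..} x * sin (pi * x) ^ 2) * (indicator {0<..} u * u powr (1 - p) * exp (- (x * u)))) \<partial>lborel) =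
            (\<integral>\<^sup>+u. ennreal (sin (pi * x) ^ 2) * ennreal (indicator {0<..} u * u powr ((2 - p) - 1) * exp (- (x * u))) \<partial>lborel)"
        using True by (intro nn_integral_cong) (simp flip: ennreal_mult')
      also have "\<dots> = ennreal (sin (pi * x) ^ 2) * ennreal (Gamma (2 - p) * x powr (- (2 - p)))"
        using True p by (subst nn_integral_cmult) (simp, subst nn_integral_Gamma_scaled, auto)
      finally show ?thesis using True G by (simp add: G_def mult_ac flip: ennreal_mult')
    qed auto
  qed
  also have "\<dots> = (\<integral>\<^sup>+u. (\<integral>\<^sup>+x. ennreal ((indicator {0<..} x * sin (pi * x) ^ 2) * (indicator {0<..} u * u powr (1 - p) * exp (- (x * u)))) \<partial>lborel) \<partial>lborel)"
    by (rule lborel_pair.Fubini') measurable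
  also have "\<dots> = (\<integral>\<^sup>+u. ennreal (2 * pi ^ 2 * (indicator {0<..} u * u powr (-p) / (u ^ 2 + 4 * pi ^ 2))) \<partial>lborel)"
  proof (intro nn_integral_cong)
    fix u :: real
    show "(\<integral>\<^sup>+x. ennreal ((indicator {0<..} x * sin (pi * x) ^ 2) * (indicator {0<..} u * u powr (1 - p) * exp (- (x * u)))) \<partial>lborel) =
          ennreal (2 * pi ^ 2 * (indicator {0<..} u * u powr (-p) / (u ^ 2 + 4 * pi ^ 2)))"
    proof (cases "u > 0")
      case True
      have "(\<integral>\<^sup>+x. ennreal ((indicator {0<..} x * sin (pi * x) ^ 2) * (indicator {0<..} u * u powr (1 - p) * exp (- (x * u)))) \<partial>lborel) =
            (\<integral>\<^sup>+x. ennreal (u powr (1 - p)) * ennreal (indicator {0<..} x * sin (pi * x) ^ 2 * exp (- (u * x))) \<partial>lborel)"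
        using True by (intro nn_integral_cong) (simp add: mult_ac flip: ennreal_mult')
      also have "\<dots> = ennreal (u powr (1 - p)) * ennreal (2 * pi ^ 2 / (u * (u ^ 2 + 4 * pi ^ 2)))"
        using True by (subst nn_integral_cmult) (simp, subst nn_integral_Laplace_sin_square, auto)
      also have "\<dots> = ennreal (2 * pi ^ 2 * (u powr (-p) / (u ^ 2 + 4 * pi ^ 2)))"
      proof -
        define N where "N = u ^ 2 + 4 * pi ^ 2"
        have "N > 0" using True by (simp add: N_def add_pos_nonneg)
        thus ?thesis unfolding N_def[symmetric] using True
          by (simp add: powr_diff powr_minus divide_simps flip: ennreal_mult')
      qed
      finally show ?thesis using True by simp
    qed auto
  qed
  also have "\<dots> = ennreal \<bar>2 * pi\<bar> * (\<integral>\<^sup>+y. ennreal (2 * pi ^ 2 * (indicator {0<..} (0 + 2 * pi * y) * (0 + 2 * pi * y) powr (-p) / ((0 + 2 * pi * y) ^ 2 + 4 * pi ^ 2))) \<partial>lborel)"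
    by (rule nn_integral_real_affine[where c = "2 * pi" and t = 0]) auto
  also have "(\<integral>\<^sup>+y. ennreal (2 * pi ^ 2 * (indicator {0<..} (0 + 2 * pi * y) * (0 + 2 * pi * y) powr (-p) / ((0 + 2 * pi * y) ^ 2 + 4 * pi ^ 2))) \<partial>lborel) =
             (\<integral>\<^sup>+y. ennreal (2 * pi ^ 2 * (2 * pi) powr (-p) / (4 * pi ^ 2)) * ennreal (indicator {0<..} y * y powr (-p) / (1 + y ^ 2)) \<partial>lborel)"
  proof (intro nn_integral_cong)
    fix y :: real
    have "(2 * pi * y) ^ 2 + 4 * pi ^ 2 = (4 * pi ^ 2) * (1 + y ^ 2)" by (simp add: algebra_simps power_mult_distrib)
    moreover have "1 + y ^ 2 > 0" by (simp add: add_pos_nonneg)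
    ultimately show "ennreal (2 * pi ^ 2 * (indicator {0<..} (0 + 2 * pi * y) * (0 + 2 * pi * y) powr (-p) / ((0 + 2 * pi * y) ^ 2 + 4 * pi ^ 2))) =
                     ennreal (2 * pi ^ 2 * (2 * pi) powr (-p) / (4 * pi ^ 2)) * ennreal (indicator {0<..} y * y powr (-p) / (1 + y ^ 2))"
      by (subst ennreal_mult'[symmetric])
         (auto simp: indicator_def zero_less_mult_iff powr_mult divide_simps intro!: arg_cong[of _ _ ennreal])
  qed
  also have "\<dots> = ennreal (2 * pi ^ 2 * (2 * pi) powr (-p) / (4 * pi ^ 2)) * ennreal (pi / (2 * cos (pi * p / 2)))"
    by (subst nn_integral_cmult) (simp, subst nn_integral_powr_over_one_plus_square[OF p], auto)
  also have "ennreal \<bar>2 * pi\<bar> * \<dots> = ennreal (2 * pi ^ 2 * (2 * pi) powr (-p - 1) * (pi / (2 * cos (pi * p / 2))))"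
    using cpos by (subst ennreal_mult'[symmetric], simp, subst ennreal_mult'[symmetric], simp)
      (auto simp: powr_diff field_simps power2_eq_square intro!: arg_cong[of _ _ ennreal])
  finally have "ennreal (1 / G) * (ennreal G * I) = ennreal (1 / G) * ennreal (2 * pi ^ 2 * (2 * pi) powr (-p - 1) * (pi / (2 * cos (pi * p / 2))))"
    by simp
  also have "ennreal (1 / G) * (ennreal G * I) = I"
    using G by (simp add: mult.assoc[symmetric] ennreal_mult[symmetric])
  finally show ?thesis using G cpos unfolding I_def G_def[symmetric]
    by (simp add: ennreal_mult[symmetric])
qed

section \<open>Errors of the trapezoidal rule for powers\<close>

text \<open>Trapezoidal approximation minus exact value for the integral of x^p over [n, n + 1]. For
  n = 0 and p > 0 the convention \<open>0 powr p = 0\<close> gives the correct value at the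
  origin.\<close>

definition trapezoid_error :: "real \<Rightarrow> nat \<Rightarrow> real" where
  "trapezoid_error p n = (real (Suc n) powr p + real n powr p) / 2 -
     (real (Suc n) powr (p + 1) - real n powr (p + 1)) / (p + 1)"

text \<open>The Peano kernel form of the error: two integrations by parts express it as half the
  integral of (x - n)(n + 1 - x) f''(x), where f(x) = x^p.\<close>

lemma has_integral_trapezoid_error:
  fixes p :: real
  assumes p: "0 < p" "p < 1"
  shows "((\<lambda>x. (x - real n) * (real (Suc n) - x) * x powr (p - 2)) has_integral
            (2 / (p * (p - 1)) * trapezoid_error p n)) {real n..real (Suc n)}"
proof -
  define a where "a = real n"
  define b where "b = real (Suc n)"
  have ab: "b = a + 1" "a \<ge> 0" "b > 0" by (simp_all add: a_def b_def)
  define P where "P = (\<lambda>x. - (x powr (p + 1)) / (p + 1) + (a + b) * x powr p / p - b * (a * x powr (p - 1)) / (p - 1))"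
  have "((\<lambda>x. (x - a) * (b - x) * x powr (p - 2)) has_integral (P b - P a)) {a..b}"
  proof (rule fundamental_theorem_of_calculus_interior)
    \<comment> \<open>For n = 0 the factor a is 0 and removes the power x^(p - 1), which is
      unbounded near 0.\<close>
    show "continuous_on {a..b} P"
    proof (cases "n = 0")
      case True
      thus ?thesis unfolding P_def a_def b_def using p by (auto intro!: continuous_intros continuous_on_powr')
    next
      case False
      thus ?thesis unfolding P_def a_def b_def using p by (auto intro!: continuous_intros)
    qed
    fix x assume x: "x \<in> {a<..<b}"
    hence x0: "x > 0" using ab by auto
    have "(P has_real_derivative - ((p + 1) * x powr (p + 1 - 1)) / (p + 1) + (a + b) * (p * x powr (p - 1)) / p - b * (a * ((p - 1) * x powr (p - 1 - 1))) / (p - 1)) (at x)"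
      unfolding P_def by (intro DERIV_diff DERIV_add DERIV_minus DERIV_cdivide DERIV_cmult has_real_derivative_powr[OF x0])
    also have "- ((p + 1) * x powr (p + 1 - 1)) / (p + 1) + (a + b) * (p * x powr (p - 1)) / p - b * (a * ((p - 1) * x powr (p - 1 - 1))) / (p - 1) = - (x powr p) + (a + b) * x powr (p - 1) - b * (a * x powr (p - 2))"
      using p by simp
    also have "- (x powr p) + (a + b) * x powr (p - 1) - b * (a * x powr (p - 2)) = (x - a) * (b - x) * x powr (p - 2)"
    proof -
      have "x powr p = x ^ 2 * x powr (p - 2)" "x powr (p - 1) = x * x powr (p - 2)"
        using x0 by (simp_all add: powr_diff power2_eq_square)
      thus ?thesis by (simp add: algebra_simps power2_eq_square)
    qed
    finally show "(P has_vector_derivative (x - a) * (b - x) * x powr (p - 2)) (at x)"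
      by (simp add: has_real_derivative_iff_has_vector_derivative)
  qed (use ab in auto)
  also have "P b - P a = 2 / (p * (p - 1)) * trapezoid_error p n"
  proof -
    define A where "A = a powr p"
    define B where "B = b powr p"
    have "b powr (p + 1) = b * B" "a powr (p + 1) = a * A" "b * b powr (p - 1) = B" "a * a powr (p - 1) = A"
      using ab p by (auto simp: powr_add powr_diff A_def B_def)
    hence 1: "P b - P a = - (b * B - a * A) / (p + 1) + (a + b) * (B - A) / p - (a * B - b * A) / (p - 1)"
      unfolding P_def by (simp add: A_def[symmetric] B_def[symmetric] diff_divide_distrib algebra_simps)
    have 2: "trapezoid_error p n = (B + A) / 2 - (b * B - a * A) / (p + 1)"
      using \<open>b powr (p + 1) = b * B\<close> \<open>a powr (p + 1) = a * A\<close>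
      unfolding trapezoid_error_def by (simp add: a_def b_def A_def B_def)
    have "p \<noteq> 0" "p - 1 \<noteq> 0" "p + 1 \<noteq> 0" using p by auto
    thus ?thesis unfolding 1 2 unfolding ab(1) by (simp add: divide_simps) (simp add: algebra_simps)
  qed
  finally show ?thesis by (simp add: a_def b_def)
qed

text \<open>The errors add up to zeta(-p), so this is the functional equation at s = -p with the
  series of zeta(1 + p) on the right. In the Peano form the kernels on the unit intervals join to
  {x}(1 - {x}), and rescaling x in its k-th Fourier term produces the power k^(-p - 1).\<close>

lemma trapezoid_error_sums:
  fixes p :: real
  assumes p: "0 < p" "p < 1"
  shows "trapezoid_error p sums
     (-2 * (2 * pi) powr (-p - 1) * sin (pi * p / 2) * Gamma (1 + p) * (\<Sum>k. real (Suc k) powr (-p - 1)))"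
proof -
  define h where "h = (\<lambda>n. 2 / (p * (p - 1)) * trapezoid_error p n)"
  define C where "C = 2 * pi ^ 2 / Gamma (2 - p) * (2 * pi) powr (-p - 1) * (pi / (2 * cos (pi * p / 2)))"
  define a where "a = (\<lambda>k. 2 / pi ^ 2 * C * real (Suc k) powr (-p - 1))"
  \<comment> \<open>Half-open intervals put every x >= 0 into exactly one piece; the kernel vanishes
    at the omitted end point, so the integral is that over the closed interval.\<close>
  define f where "f = (\<lambda>n x::real. indicator {real n..<real (Suc n)} x * ((x - real n) * (real (Suc n) - x) * x powr (p - 2)))"
  define g where "g = (\<lambda>k x::real. 2 / (pi * real (Suc k)) ^ 2 * (indicator {0<..} x * sin (pi * real (Suc k) * x) ^ 2 * x powr (p - 2)))"
  have cpos: "cos (pi * p / 2) > 0" using p by (intro cos_gt_zero) auto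
  have C: "C > 0" unfolding C_def using p cpos by simp
  have f_nonneg: "f n x \<ge> 0" for n x by (auto simp: f_def indicator_def)
  have g_nonneg: "g k x \<ge> 0" for k x unfolding g_def by auto
  have h_nonneg: "h n \<ge> 0" for n
    unfolding h_def by (rule has_integral_nonneg[OF has_integral_trapezoid_error[OF p]]) auto
  have a_nonneg: "a k \<ge> 0" for k unfolding a_def using C by simp
  have int_f: "(\<integral>\<^sup>+x. ennreal (f n x) \<partial>lborel) = ennreal (h n)" for n
  proof -
    have "(\<integral>\<^sup>+x. ennreal (indicator {real n..real (Suc n)} x * ((x - real n) * (real (Suc n) - x) * x powr (p - 2))) \<partial>lborel) = ennreal (h n)"
      unfolding h_def by (rule nn_integral_has_integral_lebesgue[OF _ has_integral_trapezoid_error[OF p]]) auto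
    also have "(\<lambda>x. indicator {real n..real (Suc n)} x * ((x - real n) * (real (Suc n) - x) * x powr (p - 2))) = f n"
      by (auto simp: f_def indicator_def fun_eq_iff)
    finally show ?thesis .
  qed
  have int_g: "(\<integral>\<^sup>+x. ennreal (g k x) \<partial>lborel) = ennreal (a k)" for k
  proof -
    define K where "K = real (Suc k)"
    have K: "K > 0" by (simp add: K_def)
    have "ennreal C = (\<integral>\<^sup>+x. ennreal (indicator {0<..} x * sin (pi * x) ^ 2 * x powr (p - 2)) \<partial>lborel)"
      unfolding C_def by (rule nn_integral_sin_square_powr[OF p, symmetric])
    also have "\<dots> = ennreal \<bar>K\<bar> * (\<integral>\<^sup>+x. ennreal (indicator {0<..} (0 + K * x) * sin (pi * (0 + K * x)) ^ 2 * (0 + K * x) powr (p - 2)) \<partial>lborel)"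
      using K by (intro nn_integral_real_affine) auto
    also have "(\<integral>\<^sup>+x. ennreal (indicator {0<..} (0 + K * x) * sin (pi * (0 + K * x)) ^ 2 * (0 + K * x) powr (p - 2)) \<partial>lborel) =
               (\<integral>\<^sup>+x. ennreal (K powr (p - 2) * ((pi * K) ^ 2 / 2)) * ennreal (g k x) \<partial>lborel)"
      using K by (intro nn_integral_cong)
        (auto simp: g_def K_def[symmetric] indicator_def zero_less_mult_iff powr_mult mult_ac simp del: of_nat_Suc simp flip: ennreal_mult')
    also have "\<dots> = ennreal (K powr (p - 2) * ((pi * K) ^ 2 / 2)) * (\<integral>\<^sup>+x. ennreal (g k x) \<partial>lborel)"
      unfolding g_def by (rule nn_integral_cmult) auto
    also have "ennreal \<bar>K\<bar> * (ennreal (K powr (p - 2) * ((pi * K) ^ 2 / 2)) * (\<integral>\<^sup>+x. ennreal (g k x) \<partial>lborel)) =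
               ennreal (K powr (p + 1) * pi ^ 2 / 2) * (\<integral>\<^sup>+x. ennreal (g k x) \<partial>lborel)"
      using K by (simp add: mult.assoc[symmetric] ennreal_mult[symmetric] powr_diff powr_add power_mult_distrib power2_eq_square mult.commute[of "K powr p" K])
    finally have "ennreal (2 / pi ^ 2 * K powr (-p-1)) * ennreal C = ennreal (2 / pi ^ 2 * K powr (-p-1)) * ennreal (K powr (p + 1) * pi ^ 2 / 2) * (\<integral>\<^sup>+x. ennreal (g k x) \<partial>lborel)"
      by (simp add: mult.assoc)
    also have "ennreal (2 / pi ^ 2 * K powr (-p-1)) * ennreal (K powr (p + 1) * pi ^ 2 / 2) = ennreal ((2 / pi ^ 2 * K powr (-p-1)) * (K powr (p + 1) * pi ^ 2 / 2))"
      by (rule ennreal_mult[symmetric]) auto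
    also have "(2 / pi ^ 2 * K powr (-p-1)) * (K powr (p + 1) * pi ^ 2 / 2) = 1"
      using K by (simp flip: powr_add)
    finally show ?thesis unfolding a_def using C
      by (simp add: K_def[symmetric] ennreal_mult[symmetric] mult_ac del: of_nat_Suc)
  qed
  have pw: "(\<Sum>n. ennreal (f n x)) = (\<Sum>k. ennreal (g k x))" for x
  proof (cases "x > 0")
    case False
    hence "f n x = 0" for n using p by (cases "x = 0") (auto simp: f_def indicator_def)
    moreover have "g k x = 0" for k using False by (simp add: g_def)
    ultimately show ?thesis by simp
  next
    case True
    define n where "n = nat \<lfloor>x\<rfloor>"
    define y where "y = x - real n"
    have n: "real n \<le> x" "x < real (Suc n)" using True unfolding n_def by linarith+
    have y: "0 \<le> y" "y \<le> 1" "x = y + real n" using n by (auto simp: y_def)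
    have fm: "f m x = 0" if "m \<noteq> n" for m
    proof -
      have "\<not> (real m \<le> x \<and> x < real (Suc m))"
      proof
        assume *: "real m \<le> x \<and> x < real (Suc m)"
        hence "real m < real (Suc n)" "real n < real (Suc m)" using n by linarith+
        hence "m = n" by linarith
        thus False using that by simp
      qed
      thus ?thesis by (simp add: f_def)
    qed
    have "(\<Sum>m. ennreal (f m x)) = (\<Sum>m\<in>{n}. ennreal (f m x))"
      by (rule suminf_finite) (auto simp: fm)
    also have "\<dots> = ennreal (y * (1 - y) * x powr (p - 2))"
      using n by (simp add: f_def y_def algebra_simps)
    also have "\<dots> = (\<Sum>k. ennreal (g k x))"
    proof (rule suminf_ennreal_eq[symmetric])
      have "(\<lambda>k. 2 * sin (pi * real (Suc k) * y) ^ 2 / (pi * real (Suc k)) ^ 2 * x powr (p - 2)) sums (y * (1 - y) * x powr (p - 2))"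
        using y by (intro sums_mult2 sin_square_series) auto
      also have "(\<lambda>k. 2 * sin (pi * real (Suc k) * y) ^ 2 / (pi * real (Suc k)) ^ 2 * x powr (p - 2)) = (\<lambda>k. g k x)"
      proof
        fix k
        \<comment> \<open>Passing from x to its fractional part shifts the doubled angle by a
          multiple of 2 pi, and sin^2 depends only on the cosine of the doubled angle.\<close>
        have "cos (2 * (pi * real (Suc k) * x)) = cos (2 * (pi * real (Suc k) * y) + 2 * pi * of_int (int (Suc k * n)))"
          by (rule arg_cong[of _ _ cos]) (simp add: y(3) algebra_simps)
        also have "\<dots> = cos (2 * (pi * real (Suc k) * y))"
          by (simp only: cos_add cos_int_2pin sin_int_2pin)
        finally have "sin (pi * real (Suc k) * x) ^ 2 = sin (pi * real (Suc k) * y) ^ 2"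
          unfolding cos_double_sin by simp
        thus "2 * sin (pi * real (Suc k) * y) ^ 2 / (pi * real (Suc k)) ^ 2 * x powr (p - 2) = g k x"
          using True by (simp add: g_def)
      qed
      finally show "(\<lambda>k. g k x) sums (y * (1 - y) * x powr (p - 2))" .
    qed (auto simp: g_nonneg)
    finally show ?thesis .
  qed
  have [measurable]: "f n \<in> borel_measurable borel" "g n \<in> borel_measurable borel" for n
    unfolding f_def g_def by measurable
  have "(\<Sum>n. ennreal (h n)) = (\<integral>\<^sup>+x. (\<Sum>n. ennreal (f n x)) \<partial>lborel)"
    by (subst nn_integral_suminf) (simp_all add: int_f)
  also have "\<dots> = (\<Sum>n. ennreal (a n))"
    unfolding pw by (subst nn_integral_suminf) (simp_all add: int_g)
  finally have ha: "(\<Sum>n. ennreal (h n)) = (\<Sum>n. ennreal (a n))" .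
  have "summable (\<lambda>k. real k powr (-p - 1))"
    using p by (subst summable_real_powr_iff) auto
  hence summ: "summable (\<lambda>k. real (Suc k) powr (-p - 1))" by (subst summable_Suc_iff)
  define Z where "Z = (\<Sum>k. real (Suc k) powr (-p - 1))"
  have "(\<lambda>k. real (Suc k) powr (-p - 1)) sums Z" unfolding Z_def using summ by (rule summable_sums)
  hence asums: "a sums (2 / pi ^ 2 * C * Z)" unfolding a_def by (rule sums_mult)
  from suminf_ennreal_eq[OF a_nonneg asums] ha have hsum: "(\<Sum>n. ennreal (h n)) = ennreal (2 / pi ^ 2 * C * Z)" by simp
  \<comment> \<open>Summability of the errors comes from the finiteness of their sum in
    \<open>ennreal\<close>.\<close>
  have hs: "summable h"
    by (rule summable_suminf_not_top) (auto simp: h_nonneg hsum)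
  have "ennreal (suminf h) = (\<Sum>n. ennreal (h n))"
    by (rule suminf_ennreal2[symmetric]) (auto simp: h_nonneg hs)
  hence "ennreal (suminf h) = ennreal (2 / pi ^ 2 * C * Z)" by (simp add: hsum)
  moreover have "Z \<ge> 0" unfolding Z_def using summ by (intro suminf_nonneg) auto
  ultimately have "suminf h = 2 / pi ^ 2 * C * Z"
    using C h_nonneg hs by (subst (asm) ennreal_inj) (auto intro!: suminf_nonneg)
  hence "h sums (2 / pi ^ 2 * C * Z)" using hs by (simp add: sums_iff)
  hence "(\<lambda>n. p * (p - 1) / 2 * h n) sums (p * (p - 1) / 2 * (2 / pi ^ 2 * C * Z))" by (rule sums_mult)
  also have "(\<lambda>n. p * (p - 1) / 2 * h n) = trapezoid_error p"
    using p by (auto simp: h_def fun_eq_iff)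
  also have "p * (p - 1) / 2 * (2 / pi ^ 2 * C * Z) = -2 * (2 * pi) powr (-p - 1) * sin (pi * p / 2) * Gamma (1 + p) * Z"
  proof -
    \<comment> \<open>The reflection formula turns pi / (2 cos(pi p / 2)) into Gamma(p) Gamma(1 - p)
      sin(pi p / 2); the factor Gamma(1 - p) then cancels against Gamma(2 - p).\<close>
    define s where "s = sin (pi * p / 2)"
    define c where "c = cos (pi * p / 2)"
    have spos: "s > 0" unfolding s_def using p by (intro sin_gt_zero) auto
    have G1: "Gamma (1 + p) = p * Gamma p"
    proof -
      have "p \<notin> \<int>\<^sub>\<le>\<^sub>0" using p by (auto elim!: nonpos_Ints_cases)
      thus ?thesis using Gamma_plus1[of p] by (simp add: add.commute)
    qed
    have G2: "Gamma (2 - p) = (1 - p) * Gamma (1 - p)"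
    proof -
      have "1 - p \<notin> \<int>\<^sub>\<le>\<^sub>0" using p by (auto elim!: nonpos_Ints_cases)
      thus ?thesis using Gamma_plus1[of "1 - p"] by (simp add: algebra_simps)
    qed
    have "Gamma (of_real p :: complex) * Gamma (1 - of_real p) = of_real pi / sin (of_real pi * of_real p)"
      by (rule Gamma_reflection_complex)
    also have "1 - complex_of_real p = of_real (1 - p)" by simp
    finally have "complex_of_real (Gamma p * Gamma (1 - p)) = of_real (pi / sin (pi * p))"
      unfolding Gamma_complex_of_real of_real_mult[symmetric] sin_of_real of_real_divide[symmetric] .
    hence "Gamma p * Gamma (1 - p) = pi / sin (2 * (pi * p / 2))" by (simp only: of_real_eq_iff) simp
    also have "\<dots> = pi / (2 * s * c)" unfolding sin_double by (simp add: s_def c_def)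
    finally have G3: "pi / (2 * c) = Gamma p * Gamma (1 - p) * s" using spos cpos by (simp add: field_simps c_def)
    have G4: "Gamma (1 - p) > 0" using p by simp
    have "C = 2 * pi ^ 2 / ((1 - p) * Gamma (1 - p)) * (2 * pi) powr (-p - 1) * (Gamma p * Gamma (1 - p) * s)"
      unfolding C_def c_def[symmetric] G3 G2 by simp
    also have "\<dots> = 2 * pi ^ 2 / (1 - p) * (2 * pi) powr (-p - 1) * Gamma p * s"
      using G4 by simp
    finally have "p * (p - 1) / 2 * (2 / pi ^ 2 * C * Z) = p * (p - 1) / 2 * (2 / pi ^ 2 * (2 * pi ^ 2 / (1 - p) * (2 * pi) powr (-p - 1) * Gamma p * s) * Z)"
      by (simp only:)
    also have "\<dots> = - (2 * p * (2 * pi) powr (-p - 1) * Gamma p * s * Z)"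
      using p by (simp add: divide_simps) (simp add: algebra_simps)
    finally show ?thesis by (simp add: G1 s_def)
  qed
  finally show ?thesis by (simp add: Z_def)
qed

section \<open>Continuation of zeta and the functional equation\<close>

lemma holomorphic_on_suminf:
  fixes f :: "nat \<Rightarrow> complex \<Rightarrow> complex"
  assumes "open S" and "\<And>n. f n holomorphic_on S"
    and bound: "\<And>z. z \<in> S \<Longrightarrow> \<exists>d>0. \<exists>M. summable M \<and> (\<forall>n. \<forall>w\<in>cball z d \<inter> S. norm (f n w) \<le> M n)"
  shows "(\<lambda>z. \<Sum>n. f n z) holomorphic_on S"
proof (rule holomorphic_uniform_sequence[where f = "\<lambda>N z. \<Sum>n<N. f n z"])
  fix z assume z: "z \<in> S"
  from bound[OF z] obtain d M where d: "d > 0" "summable M"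
    "\<And>n w. w \<in> cball z d \<inter> S \<Longrightarrow> norm (f n w) \<le> M n" by blast
  obtain d' where d': "d' > 0" "cball z d' \<subseteq> S" using z \<open>open S\<close> open_contains_cball by blast
  have "cball z (min d d') \<subseteq> cball z d \<inter> S" using d'(2) by auto
  moreover have "uniform_limit (cball z (min d d')) (\<lambda>N z. \<Sum>n<N. f n z) (\<lambda>z. \<Sum>n. f n z) sequentially"
    using d calculation by (intro Weierstrass_m_test[of _ _ M]) auto
  ultimately show "\<exists>d>0. cball z d \<subseteq> S \<and> uniform_limit (cball z d) (\<lambda>N z. \<Sum>n<N. f n z) (\<lambda>z. \<Sum>n. f n z) sequentially"
    using d d' by (intro exI[of _ "min d d'"]) auto
qed (use assms in \<open>auto intro!: holomorphic_intros\<close>)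

text \<open>The trapezoidal error for x^(-s) on [n + 1, n + 2], multiplied by s - 1 so that no
  division by 1 - s remains. The interval [0, 1] is left out because x^(-s) is unbounded there for
  Re s > 0; its contribution is the explicit (s - 1)/2 + 1 in \<open>zeta_reg\<close>.\<close>

definition trapezoid_term :: "nat \<Rightarrow> complex \<Rightarrow> complex" where
  "trapezoid_term n s = (s - 1) / 2 * (of_nat (Suc n) powr (-s) + of_nat (Suc (Suc n)) powr (-s)) +
     (of_nat (Suc (Suc n)) powr (1 - s) - of_nat (Suc n) powr (1 - s))"

text \<open>The complex version of the Peano kernel: \<open>Q\<close> is a primitive of c (z - a)(b
  - z) z^(-s - 2), so the mean value inequality on [a, b] applies. The gain of two in the exponent
  makes the terms summable for Re s > -1.\<close>

lemma norm_trapezoid_term_le: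
  assumes "Re s \<ge> -2"
  shows "norm (trapezoid_term n s) \<le> norm s * norm (s + 1) * norm (s - 1) * real (Suc n) powr (- Re s - 2)"
proof -
  define a where "a = real (Suc n)"
  define b where "b = a + 1"
  have a: "a > 0" "b > a" by (simp_all add: a_def b_def)
  define c where "c = s * (s + 1) * (s - 1) / 2"
  define Q where "Q = (\<lambda>z::complex. s * (s + 1) / 2 * z powr (1 - s) - (s + 1) * (s - 1) * (a + b) / 2 * z powr (-s) + s * (s - 1) / 2 * (a * b) * z powr (- s - 1))"
  define Q' where "Q' = (\<lambda>z::complex. s * (s + 1) / 2 * ((1 - s) * z powr (1 - s - 1)) - (s + 1) * (s - 1) * (a + b) / 2 * (-s * z powr (-s - 1)) + s * (s - 1) / 2 * (a * b) * ((- s - 1) * z powr (- s - 1 - 1)))"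
  have Q'_eq: "Q' z = c * ((z - of_real a) * (of_real b - z)) * z powr (- s - 2)" if "z \<noteq> 0" for z
  proof -
    have "z powr (-s) = z ^ 2 * z powr (-s-2)" "z powr (-s - 1) = z * z powr (-s-2)"
      using that by (simp_all add: powr_diff power2_eq_square)
    moreover have "1 - s - 1 = -s" "-s - 1 - 1 = -s - 2" by simp_all
    ultimately show ?thesis unfolding Q'_def c_def
      by (simp only:) (simp add: field_simps power2_eq_square)
  qed
  have "norm (Q b - Q a) \<le> (norm s * norm (s + 1) * norm (s - 1) * a powr (- Re s - 2)) * norm (complex_of_real b - of_real a)"
  proof (rule field_differentiable_bound[where S = "closed_segment (of_real a) (of_real b)" and f' = Q'])
    fix z assume "z \<in> closed_segment (complex_of_real a) (of_real b)"
    then obtain x where x: "z = of_real x" "a \<le> x" "x \<le> b"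
      using a by (auto simp: closed_segment_of_real closed_segment_eq_real_ivl)
    have z: "z \<notin> \<real>\<^sub>\<le>\<^sub>0" using x a by (auto simp: complex_nonpos_Reals_iff)
    have "(Q has_field_derivative Q' z) (at z)"
      unfolding Q_def Q'_def by (intro DERIV_add DERIV_diff DERIV_cmult has_field_derivative_powr z)
    thus "(Q has_field_derivative Q' z) (at z within closed_segment (of_real a) (of_real b))"
      by (rule has_field_derivative_at_within)
    have "norm (Q' z) = norm c * ((x - a) * (b - x)) * x powr (- Re s - 2)"
    proof -
      have "Q' z = c * of_real ((x - a) * (b - x)) * of_real x powr (- s - 2)"
        using Q'_eq[of z] x a by auto
      moreover have "norm (complex_of_real x powr (- s - 2)) = x powr (- Re s - 2)"
        using x a by (subst norm_powr_real_powr) auto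
      ultimately show ?thesis using x by (simp add: norm_mult del: of_real_mult)
    qed
    also have "\<dots> \<le> norm c * 1 * a powr (- Re s - 2)"
    proof (intro mult_mono mult_left_mono)
      have "(x - a) * (b - x) \<le> 1 * 1" using x by (intro mult_mono) (auto simp: b_def)
      thus "(x - a) * (b - x) \<le> 1" by simp
      show "x powr (- Re s - 2) \<le> a powr (- Re s - 2)"
        using x a assms by (intro powr_mono2') auto
    qed (use x in auto)
    also have "norm c \<le> norm s * norm (s + 1) * norm (s - 1)" by (simp add: c_def norm_mult norm_divide)
    finally show "norm (Q' z) \<le> norm s * norm (s + 1) * norm (s - 1) * a powr (- Re s - 2)"
      by (simp add: mult_right_mono)
  qed auto
  also have "norm (complex_of_real b - of_real a) = 1" by (simp add: b_def)
  also have "Q b - Q a = trapezoid_term n s"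
  proof -
    define A where "A = complex_of_real a powr (-s)"
    define B where "B = complex_of_real b powr (-s)"
    have ab: "complex_of_real a \<noteq> 0" "complex_of_real b \<noteq> 0" using a by auto
    have 1: "of_real a powr (1 - s) = of_real a * A" "of_real b powr (1 - s) = of_real b * B"
      using ab by (simp_all add: powr_diff powr_minus A_def B_def field_simps)
    have 2: "of_real a * of_real a powr (-s - 1) = A" "of_real b * of_real b powr (-s - 1) = B"
      using ab by (simp_all add: powr_diff A_def B_def)
    have 3: "of_nat (Suc n) = complex_of_real a" "of_nat (Suc (Suc n)) = complex_of_real b"
      by (simp_all add: a_def b_def)
    have 4: "Q z = s * (s + 1) / 2 * z powr (1 - s) - (s + 1) * (s - 1) * (a + b) / 2 * z powr (-s) + s * (s - 1) / 2 * (a * (b * z powr (- s - 1)))"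
      "Q z = s * (s + 1) / 2 * z powr (1 - s) - (s + 1) * (s - 1) * (a + b) / 2 * z powr (-s) + s * (s - 1) / 2 * (b * (a * z powr (- s - 1)))" for z
      by (simp_all add: Q_def)
    show ?thesis unfolding trapezoid_term_def 3 unfolding 4(1)[of b] 4(2)[of a] 1 2 A_def[symmetric] B_def[symmetric]
      by (simp add: b_def field_simps)
  qed
  finally show ?thesis by (simp add: a_def)
qed

text \<open>The trapezoidal rule for \<open>(s - 1) \<zeta>(s)\<close>: the factor \<open>s - 1\<close> removes the pole, and the sum of the errors converges for \<open>Re s > -1\<close>.\<close>
definition zeta_reg :: "complex \<Rightarrow> complex" where
  "zeta_reg s = (s - 1) / 2 + 1 + (\<Sum>n. trapezoid_term n s)"

lemma summable_powr_Suc: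
  assumes "a < -1"
  shows "summable (\<lambda>n. real (Suc n) powr a)"
  using assms by (subst summable_Suc_iff) (simp add: summable_real_powr_iff)

lemma summable_trapezoid_term:
  assumes "Re s > -1"
  shows "summable (\<lambda>n. trapezoid_term n s)"
proof (rule summable_comparison_test')
  show "summable (\<lambda>n. norm s * norm (s + 1) * norm (s - 1) * real (Suc n) powr (- Re s - 2))"
    using assms by (intro summable_mult summable_powr_Suc) auto
  show "norm (trapezoid_term n s) \<le> norm s * norm (s + 1) * norm (s - 1) * real (Suc n) powr (- Re s - 2)" for n
    using assms by (intro norm_trapezoid_term_le) auto
qed

lemma zeta_reg_1 [simp]: "zeta_reg 1 = 1"
  by (simp add: zeta_reg_def trapezoid_term_def del: of_nat_Suc)

lemma open_Re_greater: "open {s. Re s > c}"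
  by (rule open_halfspace_Re_gt)

lemma holomorphic_zeta_reg: "zeta_reg holomorphic_on {s. Re s > -1}"
proof -
  have "(\<lambda>s. \<Sum>n. trapezoid_term n s) holomorphic_on {s. Re s > -1}"
  proof (rule holomorphic_on_suminf)
    show "trapezoid_term n holomorphic_on {s. Re s > -1}" for n
      unfolding trapezoid_term_def by (intro holomorphic_intros) (auto simp del: of_nat_Suc)
    fix s assume s: "s \<in> {s. Re s > -1}"
    define d where "d = (Re s + 1) / 2"
    have d: "d > 0" using s by (simp add: d_def)
    define R where "R = norm s + d + 1"
    show "\<exists>d>0. \<exists>M. summable M \<and> (\<forall>n. \<forall>w\<in>cball s d \<inter> {s. Re s > -1}. norm (trapezoid_term n w) \<le> M n)"
    proof (intro exI conjI ballI allI)
      show "summable (\<lambda>n. R * R * R * real (Suc n) powr (-1 - d))"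
        using d by (intro summable_mult summable_powr_Suc) auto
      fix n w assume w: "w \<in> cball s d \<inter> {s. Re s > -1}"
      have "dist s w \<le> d" using w by auto
      hence dn: "norm (s - w) \<le> d" by (simp add: dist_norm)
      have "norm w \<le> norm s + d" using dn norm_triangle_ineq2[of w s] by (simp add: norm_minus_commute)
      hence nR: "norm w \<le> R" "norm (w + 1) \<le> R" "norm (w - 1) \<le> R"
        unfolding R_def using norm_triangle_ineq[of w 1] norm_triangle_ineq4[of w 1] by auto
      have "Re s - Re w \<le> d" using dn abs_Re_le_cmod[of "s - w"] by simp
      hence re: "- Re w - 2 \<le> - 1 - d" by (simp add: d_def field_simps)
      have "norm (trapezoid_term n w) \<le> norm w * norm (w + 1) * norm (w - 1) * real (Suc n) powr (- Re w - 2)"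
        using w by (intro norm_trapezoid_term_le) auto
      also have "\<dots> \<le> R * R * R * real (Suc n) powr (-1 - d)"
      proof -
        have "R \<ge> 0" using d by (simp add: R_def)
        thus ?thesis using re by (intro mult_mono nR powr_mono) auto
      qed
      finally show "norm (trapezoid_term n w) \<le> R * R * R * real (Suc n) powr (-1 - d)" .
    qed (use d in auto)
  qed (rule open_Re_greater)
  thus ?thesis unfolding zeta_reg_def by (auto intro!: holomorphic_intros)
qed

lemma norm_zeta_term: "norm (1 / of_nat (Suc k) powr s :: complex) = real (Suc k) powr (- Re s)"
proof -
  have "norm ((of_nat (Suc k) :: complex) powr s) = real (Suc k) powr Re s"
    by (subst norm_powr_real_powr) auto
  thus ?thesis by (simp add: norm_divide powr_minus field_simps del: of_nat_Suc)
qed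

lemma summable_zeta_norm:
  assumes "Re s > 1"
  shows "summable (\<lambda>k. norm (1 / of_nat (Suc k) powr s :: complex))"
  unfolding norm_zeta_term using assms by (intro summable_powr_Suc) auto

lemma zeta_reg_eq_series:
  assumes "Re s > 1"
  shows "zeta_reg s = (s - 1) * (\<Sum>k. 1 / of_nat (Suc k) powr s)"
proof -
  define Z where "Z = (\<Sum>k. 1 / (of_nat (Suc k) :: complex) powr s)"
  define c where "c = (\<lambda>k. 1 / (of_nat (Suc k) :: complex) powr s)"
  have c_altdef: "c k = of_nat (Suc k) powr (-s)" for k
    by (simp add: c_def powr_minus field_simps)
  \<comment> \<open>Adding trapezoids counts interior points once and the two end points half, while
    the integrals telescope.\<close>
  have partial: "(\<Sum>n<M. trapezoid_term n s) = (s - 1) * ((\<Sum>k<Suc M. c k) - 1 / 2 - c M / 2) + of_nat (Suc M) powr (1 - s) - 1" for M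
  proof (induction M)
    case 0
    show ?case by (simp add: c_altdef algebra_simps)
  next
    case (Suc M)
    define A where "A = (\<Sum>k<Suc M. c k)"
    have "(\<Sum>n<Suc M. trapezoid_term n s) = (\<Sum>n<M. trapezoid_term n s) + trapezoid_term M s" by simp
    also have "(\<Sum>n<M. trapezoid_term n s) = (s - 1) * (A - 1 / 2 - c M / 2) + of_nat (Suc M) powr (1 - s) - 1"
      unfolding A_def by (rule Suc.IH)
    also have "trapezoid_term M s = (s - 1) / 2 * (c M + c (Suc M)) + (of_nat (Suc (Suc M)) powr (1 - s) - of_nat (Suc M) powr (1 - s))"
      unfolding trapezoid_term_def c_altdef ..
    also have "(s - 1) * (A - 1 / 2 - x / 2) + u - 1 + ((s - 1) / 2 * (x + y) + (v - u)) =
                 (s - 1) * (A + y - 1 / 2 - y / 2) + v - 1" for x y u v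
      by (simp add: field_simps)
    finally have "(\<Sum>n<Suc M. trapezoid_term n s) = (s - 1) * (A + c (Suc M) - 1 / 2 - c (Suc M) / 2) + of_nat (Suc (Suc M)) powr (1 - s) - 1" .
    thus ?case unfolding A_def sum.lessThan_Suc[of c "Suc M"] .
  qed
  have "summable c" unfolding c_def using summable_norm_cancel[OF summable_zeta_norm[OF assms]] .
  hence "c sums Z" unfolding Z_def c_def by (rule summable_sums)
  hence l1: "(\<lambda>M. \<Sum>k<Suc M. c k) \<longlonglongrightarrow> Z" unfolding sums_def by (rule LIMSEQ_Suc)
  have l2: "c \<longlonglongrightarrow> 0" using \<open>summable c\<close> by (rule summable_LIMSEQ_zero)
  have l3: "(\<lambda>M. (of_nat (Suc M) :: complex) powr (1 - s)) \<longlonglongrightarrow> 0"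
    using assms by (intro tendsto_neg_powr_complex_of_nat filterlim_Suc) auto
  have "(\<lambda>M. \<Sum>n<M. trapezoid_term n s) \<longlonglongrightarrow> (s - 1) * (Z - 1 / 2 - 0 / 2) + 0 - 1"
    unfolding partial by (intro tendsto_intros l1 l2 l3) auto
  moreover have "(\<lambda>M. \<Sum>n<M. trapezoid_term n s) \<longlonglongrightarrow> (\<Sum>n. trapezoid_term n s)"
    using assms by (intro summable_LIMSEQ summable_trapezoid_term) auto
  ultimately have "(\<Sum>n. trapezoid_term n s) = (s - 1) * (Z - 1 / 2 - 0 / 2) + 0 - 1"
    by (rule LIMSEQ_unique[rotated])
  thus ?thesis by (simp add: zeta_reg_def Z_def[symmetric] algebra_simps add_divide_distrib diff_divide_distrib del: of_nat_Suc)
qed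

text \<open>The factor traditionally written chi(s) in zeta(s) = chi(s) zeta(1 - s).\<close>

definition zeta_factor :: "complex \<Rightarrow> complex" where
  "zeta_factor s = 2 * of_real (2 * pi) powr (s - 1) * sin (of_real pi * s / 2) * Gamma (1 - s)"

lemma holomorphic_zeta_factor: "zeta_factor holomorphic_on {s. Re s < 1}"
proof -
  have "1 - s \<notin> \<int>\<^sub>\<le>\<^sub>0" if "Re s < 1" for s :: complex
    using that by (auto elim!: nonpos_Ints_cases simp: complex_eq_iff)
  thus ?thesis unfolding zeta_factor_def by (intro holomorphic_intros) auto
qed

text \<open>Multiplied by s - 1, the errors of index n + 1 become the terms of
  \<open>zeta_reg\<close> at s = -p, and the error on [0, 1] becomes its explicit summand. The right
  side uses the series, because nothing is known about \<open>riemann_zeta\<close> before a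
  continuation has been shown to exist.\<close>

lemma zeta_reg_functional_real:
  assumes p: "0 < p" "p < 1"
  defines "s \<equiv> - complex_of_real p"
  shows "zeta_reg s = (s - 1) * (zeta_factor s * (\<Sum>k. 1 / of_nat (Suc k) powr (1 - s)))"
proof -
  define Z where "Z = (\<Sum>k. real (Suc k) powr (-p - 1))"
  define C where "C = -2 * (2 * pi) powr (-p - 1) * sin (pi * p / 2) * Gamma (1 + p)"
  have powr_real: "(of_nat m :: complex) powr of_real r = of_real (real m powr r)" for m r
    by (subst powr_of_real[symmetric]) auto
  have tterm: "(s - 1) * of_real (trapezoid_error p (Suc n)) = trapezoid_term n s" for n
  proof -
    have *: "- s = of_real p" "1 - s = of_real (p + 1)" by (simp_all add: s_def)
    have **: "s - 1 = - of_real (p + 1)" by (simp add: s_def)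
    have "p + 1 \<noteq> 0" using p by auto
    have "(s - 1) * of_real (trapezoid_error p (Suc n)) = of_real (- (p + 1) * trapezoid_error p (Suc n))"
      unfolding ** by simp
    also have "- (p + 1) * trapezoid_error p (Suc n) = - (p + 1) / 2 * (real (Suc n) powr p + real (Suc (Suc n)) powr p) + (real (Suc (Suc n)) powr (p + 1) - real (Suc n) powr (p + 1))"
      unfolding trapezoid_error_def using \<open>p + 1 \<noteq> 0\<close> by (simp add: divide_simps del: of_nat_Suc) (simp add: algebra_simps)
    finally show ?thesis
      unfolding trapezoid_term_def * ** powr_real by simp
  qed
  have t0: "(s - 1) * of_real (trapezoid_error p 0) = (s - 1) / 2 + 1"
  proof -
    have "- (p + 1) * trapezoid_error p 0 = - (p + 1) / 2 + 1"
      using p unfolding trapezoid_error_def by (simp add: divide_simps) (simp add: algebra_simps)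
    hence "complex_of_real (- (p + 1) * trapezoid_error p 0) = of_real (- (p + 1) / 2 + 1)" by (simp only:)
    thus ?thesis unfolding s_def by simp
  qed
  have "trapezoid_error p sums (C * Z)"
    unfolding C_def Z_def by (rule trapezoid_error_sums[OF p])
  hence "(\<lambda>n. of_real (trapezoid_error p n)) sums complex_of_real (C * Z)"
    by (rule sums_of_real)
  hence "(\<lambda>n. (s - 1) * of_real (trapezoid_error p n)) sums ((s - 1) * of_real (C * Z))"
    by (rule sums_mult)
  hence "(\<lambda>n. (s - 1) * of_real (trapezoid_error p (Suc n))) sums ((s - 1) * of_real (C * Z) - (s - 1) * of_real (trapezoid_error p 0))"
    by (subst sums_Suc_iff) simp
  hence "(\<Sum>n. trapezoid_term n s) = (s - 1) * of_real (C * Z) - ((s - 1) / 2 + 1)"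
    unfolding tterm t0 by (simp add: sums_iff)
  hence "zeta_reg s = (s - 1) * (of_real C * of_real Z)"
    by (simp add: zeta_reg_def)
  also have "complex_of_real C = zeta_factor s"
  proof -
    have 1: "complex_of_real (2 * pi) powr (s - 1) = of_real ((2 * pi) powr (-p - 1))"
      by (subst powr_of_real[symmetric]) (auto simp: s_def)
    have 2: "sin (of_real pi * s / 2) = of_real (- sin (pi * p / 2))"
      by (simp add: s_def flip: sin_of_real)
    have 3: "Gamma (1 - s) = of_real (Gamma (1 + p))"
      by (simp add: s_def flip: Gamma_complex_of_real)
    show ?thesis unfolding zeta_factor_def 1 2 3 C_def by simp
  qed
  also have "complex_of_real Z = (\<Sum>k. 1 / of_nat (Suc k) powr (1 - s))"
  proof -
    have "1 / of_nat (Suc k) powr (1 - s) = complex_of_real (real (Suc k) powr (-p - 1))" for k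
    proof -
      have "1 - s = of_real (p + 1)" by (simp add: s_def)
      hence "1 / of_nat (Suc k) powr (1 - s) = complex_of_real (1 / (real (Suc k) powr (p + 1)))"
        by (simp only: powr_real) simp
      also have "1 / (real (Suc k) powr (p + 1)) = real (Suc k) powr (- (p + 1))"
        by (simp only: powr_minus inverse_eq_divide)
      finally show ?thesis by simp
    qed
    moreover have "summable (\<lambda>k. real (Suc k) powr (-p - 1))"
      using p by (intro summable_powr_Suc) auto
    ultimately show ?thesis unfolding Z_def by (simp only: suminf_of_real)
  qed
  finally show ?thesis .
qed

lemma holomorphic_zeta_series: "(\<lambda>s. \<Sum>k. 1 / of_nat (Suc k) powr s) holomorphic_on {s::complex. Re s > 1}"
proof -
  have "(\<lambda>s. zeta_reg s / (s - 1)) holomorphic_on {s. Re s > 1}"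
    by (intro holomorphic_intros holomorphic_on_subset[OF holomorphic_zeta_reg]) auto
  also have "?this \<longleftrightarrow> ?thesis"
    by (intro holomorphic_cong) (auto simp: zeta_reg_eq_series)
  finally show ?thesis .
qed

text \<open>The identity theorem in the strip: the real points between -1 and 0, where the equation
  is known, accumulate at -1/2.\<close>

lemma zeta_reg_functional:
  assumes "-1 < Re s" "Re s < 0"
  shows "zeta_reg s = (s - 1) * (zeta_factor s * (\<Sum>k. 1 / of_nat (Suc k) powr (1 - s)))"
proof -
  define S where "S = {s. -1 < Re s} \<inter> {s. Re s < 0}"
  define U where "U = (\<lambda>p. - complex_of_real p) ` {0<..<1}"
  define f where "f = (\<lambda>s. zeta_reg s - (s - 1) * (zeta_factor s * (\<Sum>k. 1 / of_nat (Suc k) powr (1 - s))))"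
  have "f s = 0"
  proof (rule analytic_continuation[of f S U "-1/2"])
    have "((\<lambda>s. \<Sum>k. 1 / of_nat (Suc k) powr s) \<circ> (\<lambda>s::complex. 1 - s)) holomorphic_on S"
      by (intro holomorphic_on_compose holomorphic_on_subset[OF holomorphic_zeta_series] holomorphic_intros)
         (auto simp: S_def)
    thus "f holomorphic_on S"
      unfolding f_def o_def
      by (intro holomorphic_intros holomorphic_on_subset[OF holomorphic_zeta_reg] holomorphic_on_subset[OF holomorphic_zeta_factor])
         (auto simp: S_def)
    show "open S" unfolding S_def by (intro open_Int open_halfspace_Re_gt open_halfspace_Re_lt)
    show "connected S" unfolding S_def
      by (intro convex_connected convex_Int convex_halfspace_Re_gt convex_halfspace_Re_lt)
    show "U \<subseteq> S" by (auto simp: U_def S_def)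
    show "-1/2 \<in> S" by (simp add: S_def)
    show "- 1 / 2 islimpt U"
      unfolding islimpt_sequential
    \<comment> \<open>The offset 3 keeps 1/2 + 1/(n + 3) below 1.\<close>
    proof (intro exI[of _ "\<lambda>n. - complex_of_real (1 / 2 + 1 / real (n + 3))"] conjI allI)
      fix n
      have "1 / real (n + 3) \<le> 1 / 3" by (intro divide_left_mono) auto
      moreover have "1 / real (n + 3) > 0" by simp
      ultimately have *: "1 / 2 + 1 / real (n + 3) \<in> {0<..<1}"
        unfolding greaterThanLessThan_iff by linarith
      have "- complex_of_real (1 / 2 + 1 / real (n + 3)) \<noteq> - 1 / 2"
      proof
        assume "- complex_of_real (1 / 2 + 1 / real (n + 3)) = - 1 / 2"
        hence "Re (- complex_of_real (1 / 2 + 1 / real (n + 3))) = Re (- 1 / 2)" by (simp only:)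
        thus False by simp
      qed
      thus "- complex_of_real (1 / 2 + 1 / real (n + 3)) \<in> U - {- 1 / 2}"
        unfolding U_def using * by blast
    next
      have "(\<lambda>n. - complex_of_real (1 / 2 + 1 / real (n + 3))) \<longlonglongrightarrow> - complex_of_real (1 / 2 + 0)"
        by (intro tendsto_intros LIMSEQ_ignore_initial_segment[OF lim_1_over_n])
      thus "(\<lambda>n. - complex_of_real (1 / 2 + 1 / real (n + 3))) \<longlonglongrightarrow> - 1 / 2" by simp
    qed
    show "s \<in> S" using assms by (simp add: S_def)
    fix z assume "z \<in> U"
    thus "f z = 0" using zeta_reg_functional_real by (auto simp: U_def f_def)
  qed
  thus ?thesis by (simp add: f_def)
qed

definition zeta_spec :: "(complex \<Rightarrow> complex) \<Rightarrow> bool" where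
  "zeta_spec f \<longleftrightarrow> f holomorphic_on (- {1}) \<and>
      (\<forall>s. 1 < Re s \<longrightarrow> f s = (\<Sum>k. 1 / (of_nat (Suc k)) powr s))"

text \<open>Two pieces are glued: \<open>zeta_reg s / (s - 1)\<close> for Re s > -1 and the right
  side of the functional equation for Re s < 0. They agree on the common strip by
  \<open>zeta_reg_functional\<close>. This witness gives the \<open>SOME\<close> in
  \<open>riemann_zeta\<close> its meaning.\<close>

lemma zeta_spec_exists: "\<exists>f. zeta_spec f"
proof -
  define f1 where "f1 = (\<lambda>s. zeta_reg s / (s - 1))"
  define f2 where "f2 = (\<lambda>s::complex. zeta_factor s * (\<Sum>k. 1 / of_nat (Suc k) powr (1 - s)))"
  define f where "f = (\<lambda>s. if s \<in> {s. Re s > -1} - {1} then f1 s else f2 s)"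
  have "f holomorphic_on ({s. Re s > -1} - {1}) \<union> {s. Re s < 0}"
    unfolding f_def
  proof (rule holomorphic_on_If_Un)
    show "f1 holomorphic_on {s. Re s > -1} - {1}"
      unfolding f1_def by (intro holomorphic_intros holomorphic_on_subset[OF holomorphic_zeta_reg]) auto
    have "((\<lambda>s. \<Sum>k. 1 / of_nat (Suc k) powr s) \<circ> (\<lambda>s::complex. 1 - s)) holomorphic_on {s. Re s < 0}"
      by (intro holomorphic_on_compose holomorphic_on_subset[OF holomorphic_zeta_series] holomorphic_intros) auto
    thus "f2 holomorphic_on {s. Re s < 0}"
      unfolding f2_def o_def by (intro holomorphic_intros holomorphic_on_subset[OF holomorphic_zeta_factor]) auto
    show "f1 z = f2 z" if "z \<in> {s. Re s > -1} - {1}" "z \<in> {s. Re s < 0}" for z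
      using that zeta_reg_functional[of z] by (auto simp: f1_def f2_def)
  qed (auto intro!: open_halfspace_Re_gt open_halfspace_Re_lt open_delete)
  also have "({s. Re s > -1} - {1}) \<union> {s. Re s < 0} = - {1::complex}" by auto
  finally have "f holomorphic_on - {1}" .
  moreover have "f s = (\<Sum>k. 1 / (of_nat (Suc k)) powr s)" if "Re s > 1" for s
    using that zeta_reg_eq_series[of s] by (auto simp: f_def f1_def)
  ultimately show ?thesis unfolding zeta_spec_def by blast
qed

lemma zeta_spec_riemann_zeta: "zeta_spec riemann_zeta"
  using someI_ex[OF zeta_spec_exists[unfolded zeta_spec_def]]
  unfolding riemann_zeta_def zeta_spec_def .

lemma holomorphic_riemann_zeta: "riemann_zeta holomorphic_on (- {1})"
  using zeta_spec_riemann_zeta by (simp add: zeta_spec_def)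

lemma riemann_zeta_sums:
  assumes "Re s > 1"
  shows "(\<lambda>k. 1 / of_nat (Suc k) powr s) sums riemann_zeta s"
proof -
  have "riemann_zeta s = (\<Sum>k. 1 / (of_nat (Suc k)) powr s)"
    using zeta_spec_riemann_zeta assms by (simp add: zeta_spec_def)
  thus ?thesis using summable_norm_cancel[OF summable_zeta_norm[OF assms]] by (simp add: sums_iff)
qed

text \<open>Of the chosen function \<open>riemann_zeta\<close> only the specification is available,
  so it is matched with the explicit continuation by the identity theorem, starting from Re s > 1 in
  the punctured half plane.\<close>

lemma zeta_reg_eq:
  assumes "Re s > -1" "s \<noteq> 1"
  shows "zeta_reg s = (s - 1) * riemann_zeta s"
proof (rule analytic_continuation_open[of "{s. Re s > 1}" "{s. Re s > -1} - {1}" zeta_reg "\<lambda>s. (s - 1) * riemann_zeta s" s])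
  show "open {s. 1 < Re s}" by (rule open_halfspace_Re_gt)
  show "open ({s. Re s > -1} - {1})" by (intro open_delete open_halfspace_Re_gt)
  have "2 \<in> {s. 1 < Re s}" by simp
  thus "{s. 1 < Re s} \<noteq> {}" by blast
  show "connected ({s. Re s > -1} - {1})"
    by (intro connected_open_delete open_halfspace_Re_gt convex_connected convex_halfspace_Re_gt) auto
  show "zeta_reg holomorphic_on {s. Re s > -1} - {1}"
    by (rule holomorphic_on_subset[OF holomorphic_zeta_reg]) auto
  show "(\<lambda>s. (s - 1) * riemann_zeta s) holomorphic_on {s. Re s > -1} - {1}"
    by (intro holomorphic_intros holomorphic_on_subset[OF holomorphic_riemann_zeta]) auto
qed (use assms in \<open>auto simp: zeta_reg_eq_series riemann_zeta_sums[THEN sums_unique]\<close>)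

theorem riemann_zeta_functional_equation:
  assumes "Re s < 0"
  shows "riemann_zeta s = zeta_factor s * riemann_zeta (1 - s)"
proof (rule analytic_continuation_open[of "{s. Re s > -1} \<inter> {s. Re s < 0}" "{s. Re s < 0}" riemann_zeta "\<lambda>s. zeta_factor s * riemann_zeta (1 - s)" s])
  show "open ({s. Re s > -1} \<inter> {s. Re s < 0})" by (intro open_Int open_halfspace_Re_gt open_halfspace_Re_lt)
  show "open {s. Re s < 0}" by (rule open_halfspace_Re_lt)
  have "-1/2 \<in> {s. Re s > -1} \<inter> {s. Re s < 0}" by simp
  thus "{s. Re s > -1} \<inter> {s. Re s < 0} \<noteq> {}" by blast
  show "connected {s. Re s < 0}" by (intro convex_connected convex_halfspace_Re_lt)
  show "riemann_zeta holomorphic_on {s. Re s < 0}"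
    by (rule holomorphic_on_subset[OF holomorphic_riemann_zeta]) auto
  have "(riemann_zeta \<circ> (\<lambda>s::complex. 1 - s)) holomorphic_on {s. Re s < 0}"
    by (intro holomorphic_on_compose holomorphic_on_subset[OF holomorphic_riemann_zeta] holomorphic_intros) auto
  thus "(\<lambda>s. zeta_factor s * riemann_zeta (1 - s)) holomorphic_on {s. Re s < 0}"
    unfolding o_def by (intro holomorphic_intros holomorphic_on_subset[OF holomorphic_zeta_factor]) auto
  fix z assume z: "z \<in> {s. Re s > -1} \<inter> {s. Re s < 0}"
  hence "z \<noteq> 1" by auto
  hence "(z - 1) * riemann_zeta z = (z - 1) * (zeta_factor z * riemann_zeta (1 - z))"
    using z zeta_reg_functional[of z] zeta_reg_eq[of z] riemann_zeta_sums[of "1 - z", THEN sums_unique] by auto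
  with \<open>z \<noteq> 1\<close> show "riemann_zeta z = zeta_factor z * riemann_zeta (1 - z)" by simp
qed (use assms in auto)

section \<open>Lower bounds for the zeta function\<close>

text \<open>The tail of the Dirichlet series from k = 2 on has norm at most 2/3, by comparing 1/k^2
  with the telescoping 1/((k - 1/2)(k + 1/2)).\<close>

lemma norm_riemann_zeta_ge:
  assumes "Re w \<ge> 2"
  shows "norm (riemann_zeta w) \<ge> 1 / 3"
proof -
  define c where "c = (\<lambda>k. 1 / (of_nat (Suc k) :: complex) powr w)"
  define f where "f = (\<lambda>k. 1 / (real k + 3 / 2))"
  have "c sums riemann_zeta w" unfolding c_def using assms by (intro riemann_zeta_sums) auto
  hence "(\<lambda>k. c (Suc k)) sums (riemann_zeta w - c 0)" by (subst sums_Suc_iff) simp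
  hence eq: "riemann_zeta w - 1 = (\<Sum>k. c (Suc k))" by (simp add: sums_iff c_def)
  have le: "norm (c (Suc k)) \<le> f k - f (Suc k)" for k
  proof -
    have "norm (c (Suc k)) = real (Suc (Suc k)) powr (- Re w)" unfolding c_def by (rule norm_zeta_term)
    also have "\<dots> \<le> real (Suc (Suc k)) powr (-2)" using assms by (intro powr_mono) auto
    also have "\<dots> = 1 / (real k + 2) ^ 2" by (simp add: powr_minus field_simps)
    also have "\<dots> \<le> 1 / ((real k + 3 / 2) * (real k + 5 / 2))"
      by (intro divide_left_mono mult_pos_pos) (auto simp: power2_eq_square field_simps intro: add_pos_nonneg)
    also have "\<dots> = f k - f (Suc k)"
      unfolding f_def by (simp add: field_simps)
    finally show ?thesis .
  qed
  have "f \<longlonglongrightarrow> 0" unfolding f_def by real_asymp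
  from telescope_sums'[OF this] have f: "(\<lambda>k. f k - f (Suc k)) sums (2 / 3)" by (simp add: f_def)
  have "norm (riemann_zeta w - 1) \<le> (\<Sum>k. f k - f (Suc k))"
    unfolding eq using f by (intro norm_suminf_le le) (auto simp: sums_iff)
  also have "\<dots> = 2 / 3" using f by (simp add: sums_iff)
  finally have "norm (1 - riemann_zeta w) \<le> 2 / 3" by (simp add: norm_minus_commute)
  moreover have "1 \<le> norm (1 - riemann_zeta w) + norm (riemann_zeta w)"
    using norm_triangle_ineq[of "1 - riemann_zeta w" "riemann_zeta w"] by simp
  ultimately show ?thesis by linarith
qed

text \<open>In Euler's product for \<open>\<bar>\<Gamma>(v + t\<i>)\<bar> / \<Gamma>(v)\<close> every factor increases with \<open>v\<close>.\<close>
lemma norm_Gamma_Complex_ge: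
  assumes "v \<ge> (1::real)"
  shows "norm (Gamma (Complex v t)) \<ge> Gamma v * norm (Gamma (Complex 1 t))"
proof -
  have mono: "norm (Complex (1 + real k) t) * (v + real k) \<ge> norm (Complex (v + real k) t) * (1 + real k)" for k
  proof -
    define x where "x = 1 + real k"
    define y where "y = v + real k"
    have xy: "0 \<le> x" "x \<le> y" using assms by (auto simp: x_def y_def)
    have "(norm (Complex y t) * x) ^ 2 \<le> (norm (Complex x t) * y) ^ 2"
    proof -
      have "x ^ 2 * t ^ 2 \<le> y ^ 2 * t ^ 2" using xy by (intro mult_right_mono power_mono) auto
      thus ?thesis by (simp add: power_mult_distrib cmod_power2 algebra_simps)
    qed
    thus ?thesis using xy by (auto simp: x_def y_def dest: power2_le_imp_le)
  qed
  have le: "Gamma_series v n * norm (Gamma_series (Complex 1 t) n) \<le> norm (Gamma_series (Complex v t) n) * Gamma_series 1 n" if n: "n > 0" for n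
  proof -
    have nr: "norm (Gamma_series (Complex u t) n) = fact n * exp (u * ln (real n)) / (\<Prod>k\<le>n. norm (Complex (u + real k) t))" for u
    proof -
      have "norm (pochhammer (Complex u t) (Suc n)) = (\<Prod>k\<le>n. norm (Complex (u + real k) t))"
        unfolding pochhammer_prod prod_norm[symmetric]
        by (intro prod.cong) (auto simp: complex_eq_iff lessThan_Suc_atMost intro!: arg_cong[of _ _ norm])
      moreover have "norm (exp (Complex u t * of_real (ln (real_of_nat n)))) = exp (u * ln (real n))"
        by simp
      ultimately show ?thesis unfolding Gamma_series_def by (simp add: norm_mult norm_divide)
    qed
    have rl: "Gamma_series u n = fact n * exp (u * ln (real n)) / (\<Prod>k\<le>n. (u + real k))" for u :: real
      unfolding Gamma_series_def pochhammer_prod by (simp add: lessThan_Suc_atMost atLeast0AtMost atLeast0LessThan)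
    define A where "A = (fact n * exp (v * ln (real n)) :: real)"
    define B where "B = (fact n * exp (1 * ln (real n)) :: real)"
    have pos: "(\<Prod>k\<le>n. (u + real k)) > 0" "(\<Prod>k\<le>n. norm (Complex (u + real k) t)) > 0" if "u > 0" for u
      using that by (auto intro!: prod_pos simp: complex_eq_iff)
    have AB: "A \<ge> 0" "B \<ge> 0" by (simp_all add: A_def B_def)
    have "(\<Prod>k\<le>n. norm (Complex (v + real k) t)) * (\<Prod>k\<le>n. (1 + real k)) \<le> (\<Prod>k\<le>n. norm (Complex (1 + real k) t)) * (\<Prod>k\<le>n. (v + real k))"
      unfolding prod.distrib[symmetric] using mono by (intro prod_mono) auto
    hence "A * B * ((\<Prod>k\<le>n. norm (Complex (v + real k) t)) * (\<Prod>k\<le>n. (1 + real k))) \<le> A * B * ((\<Prod>k\<le>n. norm (Complex (1 + real k) t)) * (\<Prod>k\<le>n. (v + real k)))"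
      using AB by (intro mult_left_mono) auto
    thus ?thesis unfolding nr rl A_def[symmetric] B_def[symmetric]
      using pos[of v] pos[of 1] assms by (simp add: divide_simps mult_ac)
  qed
  have "(\<lambda>n. Gamma_series v n * norm (Gamma_series (Complex 1 t) n)) \<longlonglongrightarrow> Gamma v * norm (Gamma (Complex 1 t))"
    by (intro tendsto_intros)
  moreover have "(\<lambda>n. norm (Gamma_series (Complex v t) n) * Gamma_series 1 n) \<longlonglongrightarrow> norm (Gamma (Complex v t)) * Gamma 1"
    by (intro tendsto_intros)
  ultimately have "Gamma v * norm (Gamma (Complex 1 t)) \<le> norm (Gamma (Complex v t)) * Gamma 1"
    by (rule LIMSEQ_le) (use le in \<open>auto intro!: exI[of _ 1]\<close>)
  thus ?thesis by simp
qed

lemma norm_sin_complex_le: "norm (sin z) \<le> exp \<bar>Im z\<bar>" for z :: complex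
proof -
  have "norm (exp (\<i> * z) - exp (- (\<i> * z))) \<le> norm (exp (\<i> * z)) + norm (exp (- (\<i> * z)))"
    by (rule norm_triangle_ineq4)
  also have "\<dots> \<le> exp \<bar>Im z\<bar> + exp \<bar>Im z\<bar>" by (intro add_mono) auto
  finally show ?thesis unfolding sin_exp_eq by (simp add: norm_divide norm_mult)
qed

lemma norm_sin_complex_ge: "norm (sin z) \<ge> (exp (Im z) - exp (- Im z)) / 2" for z :: complex
proof -
  have "norm (exp (- (\<i> * z))) - norm (exp (\<i> * z)) \<le> norm (exp (- (\<i> * z)) - exp (\<i> * z))"
    by (rule norm_triangle_ineq2)
  also have "\<dots> = norm (exp (\<i> * z) - exp (- (\<i> * z)))" by (rule norm_minus_commute)
  finally show ?thesis unfolding sin_exp_eq by (simp add: norm_divide norm_mult)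
qed

text \<open>Reflection at z = it: Gamma(1 + it) times its conjugate Gamma(1 - it) is pi z / sin(pi
  z), that is pi t / sinh(pi t), and the sine has norm at most exp(pi t).\<close>

lemma norm_Gamma_Complex_1_ge:
  assumes "t > 0"
  shows "norm (Gamma (Complex 1 t)) ^ 2 \<ge> pi * t * exp (- pi * t)"
proof -
  define z where "z = \<i> * complex_of_real t"
  have z: "z \<notin> \<int>\<^sub>\<le>\<^sub>0" using assms by (auto simp: z_def complex_eq_iff elim!: nonpos_Ints_cases)
  have 1: "Complex 1 t = z + 1" "cnj (Complex 1 t) = 1 - z" by (simp_all add: z_def complex_eq_iff)
  have "complex_of_real (norm (Gamma (Complex 1 t)) ^ 2) = Gamma (Complex 1 t) * cnj (Gamma (Complex 1 t))"
    by (simp only: complex_norm_square)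
  also have "\<dots> = Gamma (z + 1) * Gamma (1 - z)"
    unfolding cnj_Gamma 1(2) unfolding 1(1) ..
  also have "Gamma (z + 1) = z * Gamma z" by (rule Gamma_plus1[OF z])
  also have "z * Gamma z * Gamma (1 - z) = z * (of_real pi / sin (of_real pi * z))"
    by (simp only: mult.assoc Gamma_reflection_complex)
  finally have "norm (complex_of_real (norm (Gamma (Complex 1 t)) ^ 2)) = norm (z * (of_real pi / sin (of_real pi * z)))"
    by (simp only:)
  hence eq: "norm (Gamma (Complex 1 t)) ^ 2 = t * pi / norm (sin (of_real pi * z))"
    using assms by (simp add: norm_mult norm_divide norm_power z_def)
  have nz: "norm (sin (of_real pi * z)) > 0"
  proof -
    have "0 < (exp (Im (of_real pi * z)) - exp (- Im (of_real pi * z))) / 2"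
      using assms by (simp add: z_def)
    thus ?thesis using norm_sin_complex_ge[of "of_real pi * z"] by linarith
  qed
  have le: "norm (sin (of_real pi * z)) \<le> exp (pi * t)"
    using norm_sin_complex_le[of "of_real pi * z"] assms by (simp add: z_def)
  have "pi * t * exp (- pi * t) = t * pi / exp (pi * t)"
    by (simp add: exp_minus field_simps)
  also have "\<dots> \<le> t * pi / norm (sin (of_real pi * z))"
    using nz le assms by (intro divide_left_mono) auto
  finally show ?thesis unfolding eq .
qed

text \<open>In the vertical direction the growth exp(pi t / 2) of the sine cancels the decay exp(-pi
  t / 2) of Gamma, so that a bound depending on Re s alone survives, uniformly for t >=
  epsilon.\<close>

lemma sin_Gamma_lower_bound:
  assumes "\<epsilon> > 0"
  shows "\<exists>c>0. \<forall>s. Re s \<le> 0 \<and> Im s \<ge> \<epsilon> \<longrightarrow> norm (sin (of_real pi * s / 2) * Gamma (1 - s)) \<ge> c * Gamma (1 - Re s)"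
proof (intro exI conjI allI impI)
  \<comment> \<open>The value at t = epsilon of sqrt(pi t)(1 - exp(-pi t))/2, which increases with
    t.\<close>
  define c where "c = sqrt (pi * \<epsilon>) * (1 - exp (- pi * \<epsilon>)) / 2"
  show "c > 0" unfolding c_def using assms by simp
  fix s :: complex assume s: "Re s \<le> 0 \<and> Im s \<ge> \<epsilon>"
  define t where "t = Im s"
  have t: "t > 0" "t \<ge> \<epsilon>" using s assms by (auto simp: t_def)
  \<comment> \<open>The conjugate enters because 1 - s has the negative imaginary part -t.\<close>
  have "norm (Gamma (1 - s)) = norm (cnj (Gamma (1 - s)))" by simp
  also have "cnj (Gamma (1 - s)) = Gamma (Complex (1 - Re s) t)"
    unfolding cnj_Gamma by (intro arg_cong[of _ _ Gamma]) (simp add: complex_eq_iff t_def)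
  also have "norm \<dots> \<ge> Gamma (1 - Re s) * norm (Gamma (Complex 1 t))"
    using s by (intro norm_Gamma_Complex_ge) auto
  finally have 1: "norm (Gamma (1 - s)) \<ge> Gamma (1 - Re s) * norm (Gamma (Complex 1 t))" .
  have G: "Gamma (1 - Re s) > 0" using s by simp
  have 2: "norm (Gamma (Complex 1 t)) \<ge> sqrt (pi * t) * exp (- pi * t / 2)"
  proof (rule power2_le_imp_le)
    have "(sqrt (pi * t) * exp (- pi * t / 2)) ^ 2 = pi * t * exp (- pi * t)"
      using t by (simp add: power_mult_distrib exp_double[symmetric])
    also have "\<dots> \<le> norm (Gamma (Complex 1 t)) ^ 2" by (rule norm_Gamma_Complex_1_ge[OF t(1)])
    finally show "(sqrt (pi * t) * exp (- pi * t / 2)) ^ 2 \<le> norm (Gamma (Complex 1 t)) ^ 2" .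
  qed auto
  have 3: "norm (sin (of_real pi * s / 2)) \<ge> (exp (pi * t / 2) - exp (- (pi * t / 2))) / 2"
    using norm_sin_complex_ge[of "of_real pi * s / 2"] by (simp add: t_def)
  have 4: "c \<le> (exp (pi * t / 2) - exp (- (pi * t / 2))) / 2 * (sqrt (pi * t) * exp (- pi * t / 2))"
  proof -
    have "c \<le> sqrt (pi * t) * (1 - exp (- pi * t)) / 2"
      unfolding c_def using t assms by (intro divide_right_mono mult_mono) auto
    also have "1 - exp (- pi * t) = (exp (pi * t / 2) - exp (- (pi * t / 2))) * exp (- pi * t / 2)"
      by (simp add: left_diff_distrib exp_add[symmetric])
    finally show ?thesis by (simp add: mult_ac)
  qed
  have "c * Gamma (1 - Re s) \<le> ((exp (pi * t / 2) - exp (- (pi * t / 2))) / 2 * (sqrt (pi * t) * exp (- pi * t / 2))) * Gamma (1 - Re s)"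
    using 4 G by (intro mult_right_mono) auto
  also have "\<dots> = (exp (pi * t / 2) - exp (- (pi * t / 2))) / 2 * (Gamma (1 - Re s) * (sqrt (pi * t) * exp (- pi * t / 2)))"
    by (simp add: mult_ac)
  also have "\<dots> \<le> norm (sin (of_real pi * s / 2)) * norm (Gamma (1 - s))"
  proof (rule mult_mono[OF 3])
    have "Gamma (1 - Re s) * (sqrt (pi * t) * exp (- pi * t / 2)) \<le> Gamma (1 - Re s) * norm (Gamma (Complex 1 t))"
      using 2 G by (intro mult_left_mono) auto
    thus "Gamma (1 - Re s) * (sqrt (pi * t) * exp (- pi * t / 2)) \<le> norm (Gamma (1 - s))" using 1 by linarith
  qed (use G t in auto)
  finally show "norm (sin (of_real pi * s / 2) * Gamma (1 - s)) \<ge> c * Gamma (1 - Re s)" by (simp add: norm_mult)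
qed

text \<open>The part of the Gamma integral over [B, B + 1] alone is already this large.\<close>

lemma Gamma_real_ge_powr:
  fixes u B :: real
  assumes "u \<ge> 1" "B > 0"
  shows "Gamma u \<ge> B powr (u - 1) * exp (- (B + 1))"
proof -
  define f where "f = (\<lambda>t. t powr (u - 1) / exp t)"
  have f: "(f has_integral Gamma u) {0..}" unfolding f_def using assms by (intro Gamma_integral_real) auto
  have c: "((\<lambda>_. B powr (u - 1) * exp (- (B + 1))) has_integral (B powr (u - 1) * exp (- (B + 1))) * (B + 1 - B)) {B..B + 1}"
    using has_integral_const_real[of "B powr (u - 1) * exp (- (B + 1))" B "B + 1"] by simp
  have fi: "f integrable_on {B..B + 1}"
    unfolding f_def using assms by (intro integrable_continuous_real continuous_intros) auto
  have "B powr (u - 1) * exp (- (B + 1)) * (B + 1 - B) \<le> integral {B..B + 1} f"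
  proof (rule has_integral_le[OF c integrable_integral[OF fi]])
    fix x assume x: "x \<in> {B..B + 1}"
    have "B powr (u - 1) * exp (- (B + 1)) \<le> x powr (u - 1) * exp (- x)"
      using x assms by (intro mult_mono powr_mono2) auto
    thus "B powr (u - 1) * exp (- (B + 1)) \<le> f x" by (simp add: f_def exp_minus field_simps)
  qed
  also have "\<dots> \<le> Gamma u"
    by (rule has_integral_subset_le[OF _ integrable_integral[OF fi] f]) (use assms in \<open>auto simp: f_def\<close>)
  finally show ?thesis by simp
qed

text \<open>On the left the factor \<open>\<Gamma>(1 - s)\<close> of the functional equation beats every exponential.\<close>
lemma inverse_riemann_zeta_left_bound:
  assumes "\<epsilon> > 0" "B > 0"
  shows "\<exists>K>0. \<forall>s. Re s \<le> -1 \<and> Im s \<ge> \<epsilon> \<longrightarrow> riemann_zeta s \<noteq> 0 \<and> norm (1 / riemann_zeta s) \<le> K * B powr Re s"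
proof -
  obtain c where c: "c > 0"
    "\<And>s. Re s \<le> 0 \<Longrightarrow> Im s \<ge> \<epsilon> \<Longrightarrow> norm (sin (of_real pi * s / 2) * Gamma (1 - s)) \<ge> c * Gamma (1 - Re s)"
    using sin_Gamma_lower_bound[OF assms(1)] by blast
  \<comment> \<open>\<open>Gamma_real_ge_powr\<close> is applied with 2 pi B in place of B, which
    absorbs the power of 2 pi in the functional equation; 1/3 bounds zeta(1 - s) from below, where
    Re (1 - s) >= 2.\<close>
  define C where "C = 2 / (2 * pi) * c * exp (- (2 * pi * B + 1)) * (1 / 3)"
  have C: "C > 0" unfolding C_def using c by simp
  have main: "norm (riemann_zeta s) \<ge> C * B powr (- Re s)" if s: "Re s \<le> -1" "Im s \<ge> \<epsilon>" for s
  proof -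
    have "C * B powr (- Re s) = 2 * (2 * pi) powr (Re s - 1) * (c * ((2 * pi * B) powr ((1 - Re s) - 1) * exp (- (2 * pi * B + 1)))) * (1 / 3)"
    proof -
      have "(2 * pi * B) powr (- Re s) = (2 * pi) powr (- Re s) * B powr (- Re s)"
        using assms by (subst powr_mult) auto
      moreover have "(2 * pi) powr (Re s - 1) * (2 * pi) powr (- Re s) = 1 / (2 * pi)"
        by (simp add: powr_minus powr_diff)
      moreover have "2 * x * (c * (y * b * e)) * (1 / 3) = 2 * (x * y) * c * e * (1 / 3) * b" for x y b e :: real
        by simp
      moreover have "(1 - Re s) - 1 = - Re s" by simp
      ultimately show ?thesis unfolding C_def by (simp only:)
    qed
    also have "\<dots> \<le> 2 * (2 * pi) powr (Re s - 1) * (c * Gamma (1 - Re s)) * norm (riemann_zeta (1 - s))"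
      using s c(1) assms by (intro mult_mono mult_left_mono Gamma_real_ge_powr norm_riemann_zeta_ge) auto
    also have "\<dots> \<le> 2 * (2 * pi) powr (Re s - 1) * norm (sin (of_real pi * s / 2) * Gamma (1 - s)) * norm (riemann_zeta (1 - s))"
      using s c(2)[of s] by (intro mult_right_mono mult_left_mono) auto
    also have "\<dots> = norm (zeta_factor s * riemann_zeta (1 - s))"
    proof -
      have "norm (complex_of_real (2 * pi) powr (s - 1)) = (2 * pi) powr (Re s - 1)"
        by (subst norm_powr_real_powr) (auto simp del: of_real_mult)
      thus ?thesis unfolding zeta_factor_def norm_mult by simp
    qed
    also have "zeta_factor s * riemann_zeta (1 - s) = riemann_zeta s"
      using s by (intro riemann_zeta_functional_equation[symmetric]) auto
    finally show ?thesis .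
  qed
  show ?thesis
  proof (intro exI[of _ "1 / C"] conjI allI impI)
    fix s assume "Re s \<le> -1 \<and> Im s \<ge> \<epsilon>"
    hence m: "norm (riemann_zeta s) \<ge> C * B powr (- Re s)" using main by auto
    have p: "C * B powr (- Re s) > 0" using C assms by simp
    show "riemann_zeta s \<noteq> 0" using m p by auto
    have "1 / norm (riemann_zeta s) \<le> 1 / (C * B powr (- Re s))"
      by (rule divide_left_mono[OF m zero_le_one mult_pos_pos[OF order_less_le_trans[OF p m] p]])
    also have "\<dots> = 1 / C * B powr Re s" by (simp add: powr_minus field_simps)
    finally show "norm (1 / riemann_zeta s) \<le> 1 / C * B powr Re s" by (simp add: norm_divide)
  qed (use C in auto)
qed

text \<open>This crude strip suffices: it lies in the range of real parts where the hypothesis on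
  T_m controls zeta.\<close>

lemma riemann_zeta_zero_Re:
  assumes "riemann_zeta \<rho> = 0" "Im \<rho> > 0"
  shows "-1 < Re \<rho>" "Re \<rho> < 2"
proof -
  from inverse_riemann_zeta_left_bound[OF assms(2), of 1] assms show "-1 < Re \<rho>"
    by (metis not_less order_refl zero_less_one)
  show "Re \<rho> < 2" using norm_riemann_zeta_ge[of \<rho>] assms(1) by (rule_tac ccontr) auto
qed

lemma nontrivial_zero_iff:
  assumes "Im \<rho> > 0"
  shows "nontrivial_zero \<rho> \<longleftrightarrow> riemann_zeta \<rho> = 0"
  using assms unfolding nontrivial_zero_def by auto

text \<open>Multiplication by s - 1 makes zeta entire, and a nonconstant entire function has
  finitely many zeros in a compact box. The values 1 at s = 1 and 0 at the trivial zero -2 show that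
  it is not constant.\<close>

lemma finite_riemann_zeta_zeros: "finite {\<rho>. riemann_zeta \<rho> = 0 \<and> 0 < Im \<rho> \<and> Im \<rho> \<le> T}"
proof -
  define G where "G = (\<lambda>s. if s = 1 then 1 else (s - 1) * riemann_zeta s)"
  have "G holomorphic_on (- {1}) \<union> {s. Re s > -1}"
  proof (rule holomorphic_on_Un)
    show "G holomorphic_on - {1}"
      by (rule holomorphic_transform[of "\<lambda>s. (s - 1) * riemann_zeta s"])
         (auto simp: G_def intro!: holomorphic_intros holomorphic_riemann_zeta)
    show "G holomorphic_on {s. Re s > -1}"
      by (rule holomorphic_transform[OF holomorphic_zeta_reg]) (auto simp: G_def zeta_reg_eq)
  qed (auto intro: open_halfspace_Re_gt)
  also have "(- {1}) \<union> {s. Re s > -1} = (UNIV :: complex set)" by auto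
  finally have G: "G holomorphic_on UNIV" .
  have nc: "\<not> G constant_on UNIV"
  proof
    assume "G constant_on UNIV"
    hence "G (-2) = G 1" by (auto simp: constant_on_def)
    moreover have "zeta_factor (-2) = 0"
    proof -
      have "sin (of_real pi * (-2) / 2 :: complex) = - sin (of_real pi)" by simp
      also have "\<dots> = 0" by (simp flip: sin_of_real)
      finally show ?thesis by (simp add: zeta_factor_def)
    qed
    hence "riemann_zeta (-2) = 0" by (subst riemann_zeta_functional_equation) auto
    ultimately show False by (simp add: G_def)
  qed
  have "finite {z \<in> cbox (Complex (-1) 0) (Complex 2 T). G z = 0}"
    by (rule holomorphic_compact_finite_zeros[OF G _ _ _ _ nc]) auto
  thus ?thesis
  proof (rule finite_subset[rotated], safe)
    fix \<rho> assume *: "riemann_zeta \<rho> = 0" "0 < Im \<rho>" "Im \<rho> \<le> T"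
    show "\<rho> \<in> cbox (Complex (-1) 0) (Complex 2 T)"
      using * riemann_zeta_zero_Re[of \<rho>] by (auto simp: in_cbox_complex_iff)
    show "G \<rho> = 0" using * by (auto simp: G_def)
  qed
qed

lemma riemann_zeta_zero_gap:
  "\<exists>\<epsilon>>0. \<epsilon> < 1 \<and> (\<forall>\<rho>. riemann_zeta \<rho> = 0 \<and> 0 < Im \<rho> \<longrightarrow> \<epsilon> < Im \<rho>)"
proof -
  define Z where "Z = {\<rho>. riemann_zeta \<rho> = 0 \<and> 0 < Im \<rho> \<and> Im \<rho> \<le> 1}"
  \<comment> \<open>The inserted 1 covers the case of no zero up to height 1; halving M makes the
    inequality strict.\<close>
  define M where "M = Min (insert 1 (Im ` Z))"
  have fin: "finite (insert 1 (Im ` Z))" unfolding Z_def using finite_riemann_zeta_zeros[of 1] by auto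
  have "M \<in> insert 1 (Im ` Z)" unfolding M_def using fin by (intro Min_in) auto
  hence M: "M > 0" by (auto simp: Z_def)
  have M1: "M \<le> 1" unfolding M_def using fin by (intro Min_le) auto
  have "M / 2 < Im \<rho>" if "riemann_zeta \<rho> = 0" "0 < Im \<rho>" for \<rho>
  proof (cases "Im \<rho> \<le> 1")
    case True
    hence "Im \<rho> \<in> insert 1 (Im ` Z)" using that by (auto simp: Z_def)
    hence "M \<le> Im \<rho>" unfolding M_def using fin by (intro Min_le) auto
    thus ?thesis using M by linarith
  qed (use M1 M in linarith)
  thus ?thesis using M M1 by (intro exI[of _ "M / 2"]) auto
qed

section \<open>The contour integral\<close>

text \<open>The divisor sum with exponent 1 - s/beta, written as a sum of exponentials in s, hence
  visibly entire.\<close>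

definition zeta_numerator :: "nat \<Rightarrow> nat \<Rightarrow> complex \<Rightarrow> complex" where
  "zeta_numerator \<beta> n s = (\<Sum>d \<in> {d::nat. d \<ge> 1 \<and> d ^ \<beta> dvd n}. of_nat d powr (of_nat \<beta> - s))"

lemma divisor_sigma_beta_eq:
  assumes "\<beta> \<ge> 1"
  shows "divisor_sigma_beta \<beta> (1 - s / of_nat \<beta>) n = zeta_numerator \<beta> n s"
proof -
  have "of_nat \<beta> * (1 - s / of_nat \<beta>) = of_nat \<beta> - s"
    using assms by (simp add: field_simps)
  thus ?thesis unfolding divisor_sigma_beta_def zeta_numerator_def by simp
qed

lemma power_divisor_le:
  fixes d n \<beta> :: nat
  assumes "\<beta> \<ge> 1" "n \<ge> 1" "d \<ge> 1" "d ^ \<beta> dvd n"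
  shows "d \<le> n"
proof -
  have "d ^ 1 \<le> d ^ \<beta>" using assms by (intro power_increasing) auto
  also have "d ^ \<beta> \<le> n" using assms by (intro dvd_imp_le) auto
  finally show ?thesis by simp
qed

lemma finite_power_divisors:
  assumes "\<beta> \<ge> 1" "n \<ge> 1"
  shows "finite {d::nat. d \<ge> 1 \<and> d ^ \<beta> dvd n}"
  by (rule finite_subset[of _ "{..n}"]) (use power_divisor_le[OF assms] in auto)

lemma holomorphic_zeta_numerator [holomorphic_intros]: "zeta_numerator \<beta> n holomorphic_on A"
  unfolding zeta_numerator_def by (intro holomorphic_intros) auto

text \<open>The trivial bound q^beta for c_q(n) costs beta in the exponent; the two further units to
  the right ensure absolute convergence.\<close>

lemma norm_ramanujan_term_le:
  assumes "Re s \<ge> real \<beta> + 2"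
  shows "norm (ramanujan_sum_beta \<beta> (Suc k) n / of_nat (Suc k) powr s) \<le> real (Suc k) powr (-2)"
proof -
  have "norm (ramanujan_sum_beta \<beta> (Suc k) n / of_nat (Suc k) powr s) =
        norm (ramanujan_sum_beta \<beta> (Suc k) n) * norm (1 / of_nat (Suc k) powr s)"
    by (simp add: norm_divide)
  also have "\<dots> \<le> real (Suc k) ^ \<beta> * real (Suc k) powr (- Re s)"
    unfolding norm_zeta_term by (intro mult_right_mono norm_ramanujan_sum_beta_le) auto
  also have "\<dots> = real (Suc k) powr (real \<beta> - Re s)"
    by (simp add: powr_realpow[symmetric] powr_add[symmetric] del: of_nat_Suc)
  also have "\<dots> \<le> real (Suc k) powr (-2)" using assms by (intro powr_mono) auto
  finally show ?thesis .
qed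

lemma summable_ramanujan_series:
  assumes "Re s \<ge> real \<beta> + 2"
  shows "summable (\<lambda>k. norm (ramanujan_sum_beta \<beta> (Suc k) n / of_nat (Suc k) powr s))"
  by (rule summable_comparison_test'[of "\<lambda>k. real (Suc k) powr (-2)" 0])
     (use norm_ramanujan_term_le[OF assms] in \<open>auto intro!: summable_powr_Suc simp del: of_nat_Suc\<close>)

lemma of_nat_mult_powr:
  assumes "a > 0" "b > 0"
  shows "(of_nat (a * b) :: complex) powr s = of_nat a powr s * of_nat b powr s"
proof -
  have Ln_nat: "Ln (of_nat m) = complex_of_real (ln (real m))" if "m > 0" for m
    using that Ln_of_real[of "real m"] by simp
  have "ln (real (a * b)) = ln (real a) + ln (real b)" using assms by (simp add: ln_mult)
  thus ?thesis using assms unfolding powr_def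
    by (simp add: Ln_nat exp_add[symmetric] distrib_left del: of_nat_mult)
qed

lemma norm_summable_Suc_imp_has_sum:
  fixes f :: "nat \<Rightarrow> complex"
  assumes "summable (\<lambda>k. norm (f (Suc k)))"
  shows "(f has_sum (\<Sum>k. f (Suc k))) {1..}"
proof -
  have "((\<lambda>k. f (Suc k)) has_sum (\<Sum>k. f (Suc k))) UNIV"
    by (intro norm_summable_imp_has_sum assms summable_sums summable_norm_cancel[OF assms])
  hence "((f \<circ> Suc) has_sum (\<Sum>k. f (Suc k))) UNIV" by (simp add: o_def)
  hence "(f has_sum (\<Sum>k. f (Suc k))) (Suc ` UNIV)" by (subst has_sum_reindex) auto
  also have "range Suc = {1..}" by (auto simp: image_iff) (metis Suc_le_D)
  finally show ?thesis .
qed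

text \<open>Multiplying by \<open>\<zeta>\<close> sums the coefficients \<open>c\<^sub>d\<close> over the divisors \<open>d\<close> of \<open>q\<close>, which leaves only the \<open>q\<close> with \<open>q\<^sup>\<beta> dvd n\<close>.\<close>
lemma ramanujan_dirichlet_series:
  assumes \<beta>: "\<beta> \<ge> 1" and n: "n \<ge> 1" and s: "Re s \<ge> real \<beta> + 2"
  shows "riemann_zeta s * (\<Sum>k. ramanujan_sum_beta \<beta> (Suc k) n / of_nat (Suc k) powr s) = zeta_numerator \<beta> n s"
proof -
  define f where "f = (\<lambda>k. 1 / (of_nat k :: complex) powr s)"
  define c where "c = (\<lambda>q. ramanujan_sum_beta \<beta> q n)"
  define g where "g = (\<lambda>q. c q / (of_nat q :: complex) powr s)"
  define D where "D = (\<Sum>k. ramanujan_sum_beta \<beta> (Suc k) n / of_nat (Suc k) powr s)"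
  have s1: "Re s > 1" using s by simp
  have fsum: "summable (\<lambda>k. norm (f (Suc k)))" unfolding f_def using s1 by (intro summable_zeta_norm)
  have f: "(f has_sum riemann_zeta s) {1..}"
    using norm_summable_Suc_imp_has_sum[OF fsum] riemann_zeta_sums[OF s1] by (simp add: f_def sums_iff)
  have gsum: "summable (\<lambda>k. norm (g (Suc k)))" unfolding g_def c_def by (intro summable_ramanujan_series s)
  have g: "(g has_sum D) {1..}"
    using norm_summable_Suc_imp_has_sum[OF gsum] by (simp add: g_def c_def D_def)
  define h where "h = (\<lambda>(q, k). g q * f k)"
  have fabs: "(\<lambda>k. norm (f k)) summable_on {1..}" 
    using f summable_on_iff_abs_summable_on_complex has_sum_imp_summable by blast
  have gabs: "(\<lambda>k. norm (g k)) summable_on {1..}" 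
    using g summable_on_iff_abs_summable_on_complex has_sum_imp_summable by blast
  have "(\<lambda>x. norm (h x)) summable_on ({1..} \<times> {1..})"
    unfolding Infinite_Sum.abs_summable_on_Sigma_iff
  proof (intro conjI ballI)
    fix q :: nat
    show "(\<lambda>k. norm (h (q, k))) summable_on {1..}"
      unfolding h_def using fabs by (simp add: norm_mult summable_on_cmult_right)
  next
    have "(\<Sum>\<^sub>\<infinity>k\<in>{1..}. norm (h (q, k))) = norm (g q) * (\<Sum>\<^sub>\<infinity>k\<in>{1..}. norm (f k))" for q
      unfolding h_def by (simp add: norm_mult infsum_cmult_right')
    thus "(\<lambda>q. norm (\<Sum>\<^sub>\<infinity>k\<in>{1..}. norm (h (q, k)))) summable_on {1..}"
      using gabs by (simp add: summable_on_cmult_left abs_mult infsum_nonneg)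
  qed
  hence "h summable_on ({1..} \<times> {1..})" using summable_on_iff_abs_summable_on_complex by blast
  then obtain S where S: "(h has_sum S) ({1..} \<times> {1..})" by (auto simp: summable_on_def)
  have "((\<lambda>q. g q * riemann_zeta s) has_sum S) {1..}"
    by (rule has_sum_SigmaD[OF S]) (use has_sum_cmult_right[OF f] in \<open>auto simp: h_def\<close>)
  moreover have "((\<lambda>q. g q * riemann_zeta s) has_sum (D * riemann_zeta s)) {1..}"
    by (intro has_sum_cmult_left g)
  ultimately have S1: "S = D * riemann_zeta s" by (rule has_sum_unique)
  \<comment> \<open>The pairs (q, k) are regrouped by their product N = q k.\<close>
  have "((\<lambda>(N, q). c q / of_nat N powr s) has_sum S) (SIGMA N:{1..}. {q. q dvd N})"
  proof (rule has_sum_reindex_bij_witness[THEN iffD1, OF _ _ _ _ _ refl S])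
    show "(\<lambda>(q, k). (q * k, q)) x \<in> (SIGMA N:{1..}. {q. q dvd N})" if "x \<in> {1..} \<times> {1..}" for x :: "nat \<times> nat"
      using that by (auto simp: Suc_le_eq)
    show "(\<lambda>(N, q). (q, N div q)) y \<in> {1..} \<times> {1..}" if "y \<in> (SIGMA N:{1..}. {q. q dvd N})" for y :: "nat \<times> nat"
      using that by (auto elim!: dvdE simp: Suc_le_eq)
    show "(\<lambda>(N, q). c q / of_nat N powr s) ((\<lambda>(q, k). (q * k, q)) x) = h x" if "x \<in> {1..} \<times> {1..}" for x :: "nat \<times> nat"
      using that by (auto simp: h_def f_def g_def of_nat_mult_powr Suc_le_eq simp del: of_nat_mult)
  qed (auto elim!: dvdE)
  hence "((\<lambda>N. \<Sum>q | q dvd N. c q / of_nat N powr s) has_sum S) {1..}"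
    by (rule has_sum_SigmaD) (auto intro!: has_sum_finite)
  moreover have "((\<lambda>N. \<Sum>q | q dvd N. c q / of_nat N powr s) has_sum zeta_numerator \<beta> n s) {1..}"
  proof (rule has_sum_finite_neutralI)
    have *: "(\<Sum>q | q dvd N. c q / of_nat N powr s) = (if N ^ \<beta> dvd n then of_nat N powr (of_nat \<beta> - s) else 0)"
      if "N \<ge> 1" for N
    proof -
      have "(\<Sum>q | q dvd N. c q / of_nat N powr s) = (\<Sum>q | q dvd N. c q) / of_nat N powr s"
        by (rule sum_divide_distrib[symmetric])
      also have "(\<Sum>q | q dvd N. c q) = (if N ^ \<beta> dvd n then of_nat (N ^ \<beta>) else 0)"
        unfolding c_def using that \<beta> by (intro sum_ramanujan_sum_beta) auto
      finally show ?thesis using that by (simp add: powr_diff powr_nat')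
    qed
    show "finite {d. 1 \<le> d \<and> d ^ \<beta> dvd n}" by (rule finite_power_divisors[OF \<beta> n])
    show "zeta_numerator \<beta> n s = (\<Sum>N\<in>{d. 1 \<le> d \<and> d ^ \<beta> dvd n}. \<Sum>q | q dvd N. c q / of_nat N powr s)"
      unfolding zeta_numerator_def by (intro sum.cong refl) (auto simp: *)
    show "(\<Sum>q | q dvd N. c q / of_nat N powr s) = 0" if "N \<in> {1..} - {d. 1 \<le> d \<and> d ^ \<beta> dvd n}" for N
      using that by (subst *) auto
  qed auto
  ultimately have "S = zeta_numerator \<beta> n s" by (rule has_sum_unique)
  with S1 show ?thesis by (simp add: D_def mult.commute)
qed

text \<open>There are at most n divisors, each at most n. To the left of Re s = beta the bound grows
  exponentially, and the decay of 1/zeta has to absorb this.\<close>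

lemma norm_zeta_numerator_le:
  assumes \<beta>: "\<beta> \<ge> 1" and n: "n \<ge> 1"
  shows "norm (zeta_numerator \<beta> n s) \<le> real n * real n powr max 0 (real \<beta> - Re s)"
proof -
  have "norm (zeta_numerator \<beta> n s) \<le> (\<Sum>d \<in> {d::nat. d \<ge> 1 \<and> d ^ \<beta> dvd n}. real n powr max 0 (real \<beta> - Re s))"
    unfolding zeta_numerator_def
  proof (rule sum_norm_le)
    fix d assume "d \<in> {d. d \<ge> 1 \<and> d ^ \<beta> dvd n}"
    hence d: "d \<ge> 1" "d \<le> n" using power_divisor_le[OF \<beta> n] by auto
    have "norm ((of_nat d :: complex) powr (of_nat \<beta> - s)) = real d powr (real \<beta> - Re s)"
      by (subst norm_powr_real_powr) auto
    also have "\<dots> \<le> real d powr max 0 (real \<beta> - Re s)" using d by (intro powr_mono) auto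
    also have "\<dots> \<le> real n powr max 0 (real \<beta> - Re s)" using d by (intro powr_mono2) auto
    finally show "norm ((of_nat d :: complex) powr (of_nat \<beta> - s)) \<le> real n powr max 0 (real \<beta> - Re s)" .
  qed
  also have "\<dots> = real (card {d::nat. d \<ge> 1 \<and> d ^ \<beta> dvd n}) * real n powr max 0 (real \<beta> - Re s)" by simp
  also have "card {d::nat. d \<ge> 1 \<and> d ^ \<beta> dvd n} \<le> card {1..n}"
    using power_divisor_le[OF \<beta> n] by (intro card_mono) auto
  hence "real (card {d::nat. d \<ge> 1 \<and> d ^ \<beta> dvd n}) * real n powr max 0 (real \<beta> - Re s) \<le> real n * real n powr max 0 (real \<beta> - Re s)"
    by (intro mult_right_mono) auto
  finally show ?thesis .
qed

section \<open>The rectangle and its lower edge\<close>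

lemma holomorphic_contour_integral_exp:
  assumes "continuous_on (closed_segment p q) g"
  shows "(\<lambda>z. contour_integral (linepath p q) (\<lambda>s. g s * exp (s * z))) holomorphic_on UNIV"
proof -
  have cont: "continuous_on {0..1} (\<lambda>t. g (linepath p q t))"
    by (rule continuous_on_compose2[OF assms]) (auto intro!: continuous_intros simp: linepath_in_path)
  have "(\<lambda>z. integral (cbox 0 1) (\<lambda>t. g (linepath p q t) * exp (linepath p q t * z) * (q - p))) holomorphic_on UNIV"
  proof (rule leibniz_rule_holomorphic)
    fix z :: complex and t :: real
    show "((\<lambda>z. g (linepath p q t) * exp (linepath p q t * z) * (q - p)) has_field_derivative
            g (linepath p q t) * (exp (linepath p q t * z) * linepath p q t) * (q - p)) (at z within UNIV)"
      by (auto intro!: derivative_eq_intros)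
    show "(\<lambda>t. g (linepath p q t) * exp (linepath p q t * z) * (q - p)) integrable_on cbox 0 1"
      using cont by (intro integrable_continuous continuous_intros) auto
  next
    have "continuous_on (UNIV \<times> cbox 0 1) (\<lambda>y::complex \<times> real. g (linepath p q (snd y)))"
      by (rule continuous_on_compose2[OF cont]) (auto intro!: continuous_intros)
    moreover have "continuous_on (UNIV \<times> cbox 0 1) (\<lambda>y::complex \<times> real. linepath p q (snd y))"
      unfolding linepath_def by (intro continuous_intros)
    ultimately show "continuous_on (UNIV \<times> cbox 0 1) (\<lambda>(z, t). g (linepath p q t) * (exp (linepath p q t * z) * linepath p q t) * (q - p))"
      unfolding case_prod_unfold by (intro continuous_intros)
  qed auto
  also have "(\<lambda>z. integral (cbox 0 1) (\<lambda>t. g (linepath p q t) * exp (linepath p q t * z) * (q - p))) =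
             (\<lambda>z. contour_integral (linepath p q) (\<lambda>s. g s * exp (s * z)))"
    by (simp add: contour_integral_integral)
  finally show ?thesis .
qed

lemma contour_integral_rectpath_split:
  assumes "continuous_on (path_image (rectpath p r)) f"
  defines "q \<equiv> Complex (Re r) (Im p)" and "s \<equiv> Complex (Re p) (Im r)"
  shows "contour_integral (rectpath p r) f = contour_integral (linepath p q) f + contour_integral (linepath q r) f
           + contour_integral (linepath r s) f + contour_integral (linepath s p) f"
proof -
  have eq: "rectpath p r = linepath p q +++ linepath q r +++ linepath r s +++ linepath s p"
    by (simp add: rectpath_def Let_def q_def s_def)
  have "path_image (rectpath p r) = closed_segment p q \<union> closed_segment q r \<union> closed_segment r s \<union> closed_segment s p"
    unfolding eq by (auto simp: path_image_join)
  hence "f contour_integrable_on linepath p q" "f contour_integrable_on linepath q r"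
        "f contour_integrable_on linepath r s" "f contour_integrable_on linepath s p"
    using assms(1) by (auto intro!: contour_integrable_continuous_linepath elim: continuous_on_subset)
  thus ?thesis unfolding eq by (simp add: contour_integrable_joinI)
qed

text \<open>The continuation of the Dirichlet series of c_q(n), by
  \<open>ramanujan_dirichlet_series\<close>.\<close>

definition mellin_kernel :: "nat \<Rightarrow> nat \<Rightarrow> complex \<Rightarrow> complex" where
  "mellin_kernel \<beta> n s = zeta_numerator \<beta> n s / riemann_zeta s"

text \<open>Here epsilon is the height of the lower edge: all zeros in the upper half plane lie
  above it, and epsilon < 1 <= T_m keeps it below the upper edge.\<close>

locale zeta_strip =
  fixes \<beta> n :: nat and \<epsilon> :: real
  assumes \<beta>: "\<beta> \<ge> 1" and n: "n \<ge> 1" and \<epsilon>: "0 < \<epsilon>" "\<epsilon> < 1"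
    and gap: "\<And>\<rho>. riemann_zeta \<rho> = 0 \<Longrightarrow> 0 < Im \<rho> \<Longrightarrow> \<epsilon> < Im \<rho>"
begin

definition integrand :: "complex \<Rightarrow> complex \<Rightarrow> complex" where
  "integrand z s = mellin_kernel \<beta> n s * exp (s * z)"

definition edge :: real where "edge = real \<beta> + 2"

lemma edge_ge: "edge \<ge> 3" using \<beta> by (simp add: edge_def)

lemma holomorphic_mellin_kernel: 
  assumes "\<And>s. s \<in> A \<Longrightarrow> Im s > 0 \<and> riemann_zeta s \<noteq> 0"
  shows "mellin_kernel \<beta> n holomorphic_on A"
proof -
  have "A \<subseteq> - {1}" using assms by force
  thus ?thesis unfolding mellin_kernel_def using assms
    by (intro holomorphic_intros holomorphic_on_subset[OF holomorphic_riemann_zeta]) auto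
qed

lemma holomorphic_integrand: 
  assumes "\<And>s. s \<in> A \<Longrightarrow> Im s > 0 \<and> riemann_zeta s \<noteq> 0"
  shows "integrand z holomorphic_on A"
  unfolding integrand_def by (intro holomorphic_intros holomorphic_mellin_kernel assms)

lemma zeta_nonzero_left:
  assumes "Re s \<le> -1" "Im s > 0"
  shows "riemann_zeta s \<noteq> 0"
  using riemann_zeta_zero_Re(1)[of s] assms by auto

lemma zeta_nonzero_right:
  assumes "Re s \<ge> 2"
  shows "riemann_zeta s \<noteq> 0"
  using norm_riemann_zeta_ge[OF assms] by auto

lemma left_bound:
  "\<exists>K>0. \<forall>s z. Re s \<le> -1 \<and> Im s \<ge> \<epsilon> \<and> \<bar>Re z\<bar> \<le> X \<longrightarrow> norm (integrand z s) \<le> K * exp (Re s) * exp (- Im s * Im z)"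
proof -
  \<comment> \<open>The factor n absorbs the growth n^(-Re s) of the numerator, exp(X) absorbs the
    real part of z in exp(sz), and the surplus factor e leaves the decay exp(Re s).\<close>
  define B where "B = real n * exp (X + 1)"
  have B: "B > 0" using n by (simp add: B_def)
  obtain K where K: "K > 0" "\<And>s. Re s \<le> -1 \<Longrightarrow> Im s \<ge> \<epsilon> \<Longrightarrow> norm (1 / riemann_zeta s) \<le> K * B powr Re s"
    using inverse_riemann_zeta_left_bound[OF \<epsilon>(1) B] by blast
  have "norm (integrand z s) \<le> (real n * real n powr real \<beta> * K) * exp (Re s) * exp (- Im s * Im z)"
    if s: "Re s \<le> -1" "Im s \<ge> \<epsilon>" and z: "\<bar>Re z\<bar> \<le> X" for s z
  proof -
    have "norm (integrand z s) = norm (zeta_numerator \<beta> n s) * norm (1 / riemann_zeta s) * exp (Re (s * z))"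
      by (simp add: integrand_def mellin_kernel_def norm_mult norm_divide)
    also have "\<dots> \<le> (real n * real n powr (real \<beta> - Re s)) * (K * B powr Re s) * exp (Re (s * z))"
    proof (intro mult_mono K s)
      show "norm (zeta_numerator \<beta> n s) \<le> real n * real n powr (real \<beta> - Re s)"
        using norm_zeta_numerator_le[OF \<beta> n, of s] s by (simp add: max_def)
    qed (use K in auto)
    also have "B powr Re s = real n powr Re s * exp (Re s * (X + 1))"
      using n unfolding B_def by (subst powr_mult) (auto simp: powr_def mult_ac)
    also have "(real n * real n powr (real \<beta> - Re s)) * (K * (real n powr Re s * exp (Re s * (X + 1)))) * exp (Re (s * z)) =
               (real n * real n powr real \<beta> * K) * (exp (Re s * (X + 1)) * exp (Re (s * z)))"
      using n by (simp add: powr_diff)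
    also have "\<dots> \<le> (real n * real n powr real \<beta> * K) * (exp (Re s) * exp (- Im s * Im z))"
    proof (rule mult_left_mono)
      have "Re s * (X + Re z) \<le> 0" using s z by (intro mult_nonpos_nonneg) auto
      thus "exp (Re s * (X + 1)) * exp (Re (s * z)) \<le> exp (Re s) * exp (- Im s * Im z)"
        by (simp add: exp_add[symmetric] algebra_simps)
    qed (use K in auto)
    finally show ?thesis by (simp add: mult.assoc)
  qed
  thus ?thesis using K n by (intro exI[of _ "real n * real n powr real \<beta> * K"]) auto
qed

text \<open>Unit pieces of the lower edge turn the integral towards minus infinity into a series of
  entire functions, to which the M-test applies.\<close>

definition bottom_segment :: "nat \<Rightarrow> complex \<Rightarrow> complex" where
  "bottom_segment j z = contour_integral (linepath (Complex (- real (j + 2)) \<epsilon>) (Complex (- real (j + 1)) \<epsilon>)) (integrand z)"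

definition bottom_integral :: "complex \<Rightarrow> complex" where
  "bottom_integral z = contour_integral (linepath (Complex (-1) \<epsilon>) (Complex edge \<epsilon>)) (integrand z) + (\<Sum>j. bottom_segment j z)"

lemma horizontal_segment:
  assumes "s \<in> closed_segment (Complex a y) (Complex b y)" "a \<le> b"
  shows "Im s = y" "a \<le> Re s" "Re s \<le> b"
  using assms by (auto simp: closed_segment_same_Im closed_segment_eq_real_ivl)

lemma vertical_segment:
  assumes "s \<in> closed_segment (Complex x a) (Complex x b)" "a \<le> b"
  shows "Re s = x" "a \<le> Im s" "Im s \<le> b"
  using assms by (auto simp: closed_segment_same_Re closed_segment_eq_real_ivl)

lemma zeta_nonzero_bottom:
  assumes "Im s = \<epsilon>"
  shows "riemann_zeta s \<noteq> 0"
  using gap[of s] assms \<epsilon> by auto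

lemma continuous_bottom: "continuous_on {s. Im s = \<epsilon>} (mellin_kernel \<beta> n)"
  by (intro holomorphic_on_imp_continuous_on holomorphic_mellin_kernel) (auto simp: zeta_nonzero_bottom \<epsilon>)

lemma continuous_bottom_segment: "a \<le> b \<Longrightarrow> continuous_on (closed_segment (Complex a \<epsilon>) (Complex b \<epsilon>)) (mellin_kernel \<beta> n)"
  by (rule continuous_on_subset[OF continuous_bottom]) (auto dest: horizontal_segment)

lemma continuous_bottom_integrand: "a \<le> b \<Longrightarrow> continuous_on (closed_segment (Complex a \<epsilon>) (Complex b \<epsilon>)) (integrand z)"
  unfolding integrand_def by (intro continuous_intros continuous_bottom_segment)

text \<open>At the fixed height epsilon the factor exp(-epsilon Im z) is bounded for z in any
  bounded set, also below the real axis. This is why the lower edge yields an entire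
  function.\<close>

lemma bottom_segment_bound:
  assumes "X \<ge> 0"
  shows "\<exists>M. summable M \<and> (\<forall>j z. \<bar>Re z\<bar> \<le> X \<and> \<bar>Im z\<bar> \<le> X \<longrightarrow> norm (bottom_segment j z) \<le> M j)"
proof -
  obtain K where K: "K > 0"
    "\<And>s z. Re s \<le> -1 \<Longrightarrow> Im s \<ge> \<epsilon> \<Longrightarrow> \<bar>Re z\<bar> \<le> X \<Longrightarrow> norm (integrand z s) \<le> K * exp (Re s) * exp (- Im s * Im z)"
    using left_bound[of X] by blast
  define M where "M = (\<lambda>j::nat. K * exp (- real (j + 1)) * exp X)"
  have "summable (\<lambda>j. K * exp (-1) * exp X * exp (-1) ^ j)" by (intro summable_mult summable_geometric) auto
  also have "(\<lambda>j. K * exp (-1) * exp X * exp (-1) ^ j) = M"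
    by (auto simp: M_def fun_eq_iff exp_of_nat_mult[symmetric] exp_add[symmetric] mult_ac)
  finally have "summable M" .
  moreover have "norm (bottom_segment j z) \<le> M j" if z: "\<bar>Re z\<bar> \<le> X" "\<bar>Im z\<bar> \<le> X" for j z
  proof -
    have "norm (bottom_segment j z) \<le> M j * norm (Complex (- real (j + 1)) \<epsilon> - Complex (- real (j + 2)) \<epsilon>)"
      unfolding bottom_segment_def
    proof (rule contour_integral_bound_linepath)
      show "integrand z contour_integrable_on linepath (Complex (- real (j + 2)) \<epsilon>) (Complex (- real (j + 1)) \<epsilon>)"
        by (intro contour_integrable_continuous_linepath continuous_bottom_integrand) auto
      show "0 \<le> M j" using K by (simp add: M_def)
      fix s assume "s \<in> closed_segment (Complex (- real (j + 2)) \<epsilon>) (Complex (- real (j + 1)) \<epsilon>)"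
      from horizontal_segment[OF this] have s: "Im s = \<epsilon>" "Re s \<le> - real (j + 1)" by auto
      have "norm (integrand z s) \<le> K * exp (Re s) * exp (- Im s * Im z)"
        using s z by (intro K) auto
      also have "\<dots> \<le> M j" unfolding M_def
      proof (intro mult_mono)
        have "- Im s * Im z \<le> \<bar>Im s * Im z\<bar>" by linarith
        also have "\<dots> = \<epsilon> * \<bar>Im z\<bar>" using s \<epsilon> by (simp add: abs_mult)
        also have "\<dots> \<le> 1 * X" using \<epsilon> z by (intro mult_mono) auto
        finally show "exp (- Im s * Im z) \<le> exp X" by simp
      qed (use s K in auto)
      finally show "norm (integrand z s) \<le> M j" .
    qed
    also have "Complex (- real (j + 1)) \<epsilon> - Complex (- real (j + 2)) \<epsilon> = 1" by (simp add: complex_eq_iff)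
    finally show ?thesis by simp
  qed
  ultimately show ?thesis by blast
qed

lemma holomorphic_bottom_integral: "bottom_integral holomorphic_on UNIV"
proof -
  have "(\<lambda>z. \<Sum>j. bottom_segment j z) holomorphic_on UNIV"
  proof (rule holomorphic_on_suminf)
    show "bottom_segment j holomorphic_on UNIV" for j
      unfolding bottom_segment_def integrand_def
      by (intro holomorphic_contour_integral_exp continuous_bottom_segment) auto
    fix z0 :: complex
    obtain M where M: "summable M" "\<And>j z. \<bar>Re z\<bar> \<le> norm z0 + 1 \<Longrightarrow> \<bar>Im z\<bar> \<le> norm z0 + 1 \<Longrightarrow> norm (bottom_segment j z) \<le> M j"
      using bottom_segment_bound[of "norm z0 + 1"] by auto
    show "\<exists>d>0. \<exists>M. summable M \<and> (\<forall>j. \<forall>w\<in>cball z0 d \<inter> UNIV. norm (bottom_segment j w) \<le> M j)"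
    proof (intro exI[of _ 1] exI[of _ M] conjI allI ballI M)
      fix w assume "w \<in> cball z0 1 \<inter> UNIV"
      hence "norm w \<le> norm z0 + 1" using norm_triangle_ineq2[of w z0] by (auto simp: dist_norm norm_minus_commute)
      thus "\<bar>Re w\<bar> \<le> norm z0 + 1" "\<bar>Im w\<bar> \<le> norm z0 + 1"
        using abs_Re_le_cmod[of w] abs_Im_le_cmod[of w] by linarith+
    qed auto
  qed auto
  moreover have "(\<lambda>z. contour_integral (linepath (Complex (-1) \<epsilon>) (Complex edge \<epsilon>)) (integrand z)) holomorphic_on UNIV"
    unfolding integrand_def using edge_ge by (intro holomorphic_contour_integral_exp continuous_bottom_segment) auto
  ultimately show ?thesis unfolding bottom_integral_def by (intro holomorphic_intros)
qed

lemma bottom_integral_LIMSEQ: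
  "(\<lambda>m. contour_integral (linepath (Complex (- real (m + 1)) \<epsilon>) (Complex edge \<epsilon>)) (integrand z)) \<longlonglongrightarrow> bottom_integral z"
proof -
  have eq: "contour_integral (linepath (Complex (- real (m + 1)) \<epsilon>) (Complex edge \<epsilon>)) (integrand z) =
            contour_integral (linepath (Complex (-1) \<epsilon>) (Complex edge \<epsilon>)) (integrand z) + (\<Sum>j<m. bottom_segment j z)" for m
  proof (induction m)
    case (Suc m)
    have "contour_integral (linepath (Complex (- real (Suc m + 1)) \<epsilon>) (Complex edge \<epsilon>)) (integrand z) =
          contour_integral (linepath (Complex (- real (Suc m + 1)) \<epsilon>) (Complex (- real (m + 1)) \<epsilon>)) (integrand z) +
          contour_integral (linepath (Complex (- real (m + 1)) \<epsilon>) (Complex edge \<epsilon>)) (integrand z)"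
      using edge_ge by (intro contour_integral_split_linepath continuous_bottom_integrand)
        (auto simp: closed_segment_same_Im closed_segment_eq_real_ivl)
    also have "contour_integral (linepath (Complex (- real (Suc m + 1)) \<epsilon>) (Complex (- real (m + 1)) \<epsilon>)) (integrand z) = bottom_segment m z"
      by (simp add: bottom_segment_def)
    finally show ?case using Suc.IH by simp
  qed auto
  obtain M where M: "summable M" "\<And>j. norm (bottom_segment j z) \<le> M j"
    using bottom_segment_bound[of "norm z"] abs_Re_le_cmod[of z] abs_Im_le_cmod[of z] by auto
  have "summable (\<lambda>j. bottom_segment j z)"
    by (rule summable_comparison_test'[OF M(1), of 0]) (use M in auto)
  thus ?thesis unfolding eq bottom_integral_def by (intro tendsto_intros summable_LIMSEQ)
qed

text \<open>At a simple zero rho the quotient (w - rho)/zeta(w) tends to 1/zeta'(rho). The limit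
  criterion also covers a zero of the numerator at rho, where the singularity is removable.\<close>

lemma residue_integrand:
  assumes "riemann_zeta \<rho> = 0" "Im \<rho> > 0" "deriv riemann_zeta \<rho> \<noteq> 0"
  shows "residue (integrand z) \<rho> = zeta_numerator \<beta> n \<rho> / deriv riemann_zeta \<rho> * exp (\<rho> * z)"
proof -
  define Z where "Z = {s. riemann_zeta s = 0 \<and> 0 < Im s \<and> Im s \<le> Im \<rho> + 1}"
  define S where "S = {s. 0 < Im s} \<inter> {s. Im s < Im \<rho> + 1} - (Z - {\<rho>})"
  have fin: "finite Z" unfolding Z_def by (rule finite_riemann_zeta_zeros)
  show ?thesis
  proof (rule residue_simple')
    show "open S" unfolding S_def
      by (intro open_Diff open_Int open_halfspace_Im_gt open_halfspace_Im_lt finite_imp_closed) (use fin in auto)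
    show "\<rho> \<in> S" using assms by (auto simp: S_def)
    show "integrand z holomorphic_on S - {\<rho>}"
      by (rule holomorphic_integrand) (auto simp: S_def Z_def)
    have "\<rho> \<noteq> 1" using assms by auto
    have "riemann_zeta field_differentiable (at \<rho>)"
      by (rule holomorphic_on_imp_differentiable_at[OF holomorphic_riemann_zeta]) (use \<open>\<rho> \<noteq> 1\<close> in auto)
    hence "(riemann_zeta has_field_derivative deriv riemann_zeta \<rho>) (at \<rho>)"
      by (rule field_differentiable_derivI)
    hence lim: "((\<lambda>w. riemann_zeta w / (w - \<rho>)) \<longlongrightarrow> deriv riemann_zeta \<rho>) (at \<rho>)"
      unfolding has_field_derivative_iff using assms(1) by simp
    have "isCont (zeta_numerator \<beta> n) \<rho>"
      using holomorphic_on_imp_continuous_on[OF holomorphic_zeta_numerator[of \<beta> n UNIV]]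
      by (simp add: continuous_on_eq_continuous_at)
    hence "((\<lambda>w. zeta_numerator \<beta> n w * exp (w * z) / (riemann_zeta w / (w - \<rho>))) \<longlongrightarrow> zeta_numerator \<beta> n \<rho> * exp (\<rho> * z) / deriv riemann_zeta \<rho>) (at \<rho>)"
      using assms(3) by (intro tendsto_intros lim) (auto simp: isCont_def)
    thus "((\<lambda>w. integrand z w * (w - \<rho>)) \<longlongrightarrow> zeta_numerator \<beta> n \<rho> / deriv riemann_zeta \<rho> * exp (\<rho> * z)) (at \<rho>)"
      by (simp add: integrand_def mellin_kernel_def mult_ac)
  qed
qed

lemma rectangle_integral:
  assumes simple: "\<And>\<rho>. nontrivial_zero \<rho> \<Longrightarrow> deriv riemann_zeta \<rho> \<noteq> 0"
    and T: "T > \<epsilon>" "\<And>s. Im s = T \<Longrightarrow> riemann_zeta s \<noteq> 0" and R: "R \<ge> 1"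
  shows "contour_integral (linepath (Complex (-R) \<epsilon>) (Complex edge \<epsilon>)) (integrand z) +
         contour_integral (linepath (Complex edge \<epsilon>) (Complex edge T)) (integrand z) +
         contour_integral (linepath (Complex edge T) (Complex (-R) T)) (integrand z) +
         contour_integral (linepath (Complex (-R) T) (Complex (-R) \<epsilon>)) (integrand z) =
         2 * of_real pi * \<i> * varpi_partial \<beta> n T z"
proof -
  define p where "p = Complex (-R) \<epsilon>"
  define r where "r = Complex edge T"
  \<comment> \<open>The open strip around the rectangle may contain zeros above height T; they are
    among the excluded points of the residue theorem, with winding number 0.\<close>
  define Z where "Z = {s. riemann_zeta s = 0 \<and> 0 < Im s \<and> Im s \<le> T + 1}"
  define Z' where "Z' = {s. riemann_zeta s = 0 \<and> 0 < Im s \<and> Im s < T}"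
  define S where "S = {s. 0 < Im s} \<inter> {s. Im s < T + 1}"
  have fin: "finite Z" unfolding Z_def by (rule finite_riemann_zeta_zeros)
  have R1: "-R \<le> edge" using R edge_ge by simp
  have pi: "path_image (rectpath p r) = {w. Re w \<in> {-R, edge} \<and> Im w \<in> {\<epsilon>..T}} \<union> {w. Im w \<in> {\<epsilon>, T} \<and> Re w \<in> {-R..edge}}"
    using R1 T by (subst path_image_rectpath) (auto simp: p_def r_def)
  have nz: "Im w > 0 \<and> riemann_zeta w \<noteq> 0" if w: "w \<in> path_image (rectpath p r)" for w
  proof
    show i: "Im w > 0" using w \<epsilon> T unfolding pi by auto
    have "Re w = -R \<or> Re w = edge \<or> Im w = \<epsilon> \<or> Im w = T" using w unfolding pi by auto
    thus "riemann_zeta w \<noteq> 0"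
      using zeta_nonzero_left[of w] zeta_nonzero_right[of w] zeta_nonzero_bottom[of w] T(2)[of w] R edge_ge i by auto
  qed
  have "contour_integral (rectpath p r) (integrand z) = 2 * pi * \<i> * (\<Sum>w\<in>Z. winding_number (rectpath p r) w * residue (integrand z) w)"
  proof (rule Residue_theorem)
    show "open S" unfolding S_def by (intro open_Int open_halfspace_Im_gt open_halfspace_Im_lt)
    show "connected S" unfolding S_def
      by (intro convex_connected convex_Int convex_halfspace_Im_gt convex_halfspace_Im_lt)
    show "integrand z holomorphic_on S - Z" by (rule holomorphic_integrand) (auto simp: S_def Z_def)
    show "path_image (rectpath p r) \<subseteq> S - Z"
    proof
      fix w assume w: "w \<in> path_image (rectpath p r)"
      have "Im w \<le> T" using w T unfolding pi by auto
      thus "w \<in> S - Z" using nz[OF w] by (auto simp: S_def Z_def)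
    qed
    show "\<forall>w. w \<notin> S \<longrightarrow> winding_number (rectpath p r) w = 0"
    proof (intro allI impI winding_number_rectpath_outside)
      fix w assume "w \<notin> S"
      thus "w \<notin> cbox p r" using \<epsilon> by (auto simp: S_def in_cbox_complex_iff p_def r_def)
    qed (use R1 T in \<open>auto simp: p_def r_def\<close>)
  qed (use fin in auto)
  also have "(\<Sum>w\<in>Z. winding_number (rectpath p r) w * residue (integrand z) w) = (\<Sum>w\<in>Z'. residue (integrand z) w)"
  proof (rule sum.mono_neutral_cong_right[OF _ _ ballI])
    fix w assume w: "w \<in> Z - Z'"
    hence "Im w > T" using T(2)[of w] by (cases "Im w = T") (auto simp: Z_def Z'_def)
    hence "winding_number (rectpath p r) w = 0"
      using R1 T by (intro winding_number_rectpath_outside) (auto simp: p_def r_def in_cbox_complex_iff)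
    thus "winding_number (rectpath p r) w * residue (integrand z) w = 0" by simp
  next
    fix w assume w: "w \<in> Z'"
    hence "-1 < Re w" "Re w < 2" "\<epsilon> < Im w" "Im w < T" using riemann_zeta_zero_Re[of w] gap[of w] by (auto simp: Z'_def)
    hence "winding_number (rectpath p r) w = 1"
      using R edge_ge by (intro winding_number_rectpath) (auto simp: p_def r_def in_box_complex_iff)
    thus "winding_number (rectpath p r) w * residue (integrand z) w = residue (integrand z) w" by simp
  qed (use fin in \<open>auto simp: Z_def Z'_def\<close>)
  also have "\<dots> = (\<Sum>\<rho>\<in>Z'. divisor_sigma_beta \<beta> (1 - \<rho> / of_nat \<beta>) n / deriv riemann_zeta \<rho> * exp (\<rho> * z))"
  proof (rule sum.cong[OF refl])
    fix \<rho> assume "\<rho> \<in> Z'"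
    hence \<rho>: "riemann_zeta \<rho> = 0" "Im \<rho> > 0" by (auto simp: Z'_def)
    show "residue (integrand z) \<rho> = divisor_sigma_beta \<beta> (1 - \<rho> / of_nat \<beta>) n / deriv riemann_zeta \<rho> * exp (\<rho> * z)"
      unfolding divisor_sigma_beta_eq[OF \<beta>] using \<rho> by (intro residue_integrand simple) (auto simp: nontrivial_zero_iff)
  qed
  also have "Z' = {\<rho>. nontrivial_zero \<rho> \<and> 0 < Im \<rho> \<and> Im \<rho> < T}"
    by (auto simp: Z'_def nontrivial_zero_iff)
  also have "(\<Sum>\<rho>\<in>\<dots>. divisor_sigma_beta \<beta> (1 - \<rho> / of_nat \<beta>) n / deriv riemann_zeta \<rho> * exp (\<rho> * z)) = varpi_partial \<beta> n T z"
    by (simp add: varpi_partial_def)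
  also have "contour_integral (rectpath p r) (integrand z) = contour_integral (linepath (Complex (-R) \<epsilon>) (Complex edge \<epsilon>)) (integrand z) +
         contour_integral (linepath (Complex edge \<epsilon>) (Complex edge T)) (integrand z) +
         contour_integral (linepath (Complex edge T) (Complex (-R) T)) (integrand z) +
         contour_integral (linepath (Complex (-R) T) (Complex (-R) \<epsilon>)) (integrand z)"
  proof -
    have "continuous_on (path_image (rectpath p r)) (integrand z)"
      by (intro holomorphic_on_imp_continuous_on holomorphic_integrand nz)
    from contour_integral_rectpath_split[OF this] show ?thesis by (simp add: p_def r_def)
  qed
  finally show ?thesis by simp
qed

end

section \<open>The right and upper edges\<close>

context zeta_strip
begin

definition coef :: "nat \<Rightarrow> complex" where "coef k = ramanujan_sum_beta \<beta> (Suc k) n"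

definition pole :: "nat \<Rightarrow> complex" where "pole k = of_real (ln (real (Suc k)))"

text \<open>The value at s = edge + i tau of a primitive in s of c_q(n) exp(s(z - log q)), where q =
  k + 1.\<close>

definition pole_term :: "real \<Rightarrow> nat \<Rightarrow> complex \<Rightarrow> complex" where
  "pole_term \<tau> k z = coef k * exp (Complex edge \<tau> * (z - pole k)) / (z - pole k)"

definition pole_series :: "complex \<Rightarrow> complex" where
  "pole_series z = (\<Sum>k. pole_term \<epsilon> k z)"

lemma pole_inj: "pole j = pole k \<longleftrightarrow> j = k"
  by (simp add: pole_def del: of_nat_Suc)

lemma exp_pole_diff: "exp (s * (z - pole k)) = exp (s * z) / of_nat (Suc k) powr s"
proof -
  have "Ln (of_nat (Suc k)) = pole k"
    unfolding pole_def using Ln_of_real[of "real (Suc k)"] by simp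
  thus ?thesis by (simp add: powr_def exp_diff right_diff_distrib del: of_nat_Suc)
qed

lemma norm_coef_exp_le:
  assumes "Re s = edge"
  shows "norm (coef k * exp (s * (z - pole k))) \<le> real (Suc k) powr (-2) * exp (Re (s * z))"
proof -
  have "norm (coef k * exp (s * (z - pole k))) = norm (coef k / of_nat (Suc k) powr s) * exp (Re (s * z))"
    unfolding exp_pole_diff by (simp add: norm_mult norm_divide)
  also have "\<dots> \<le> real (Suc k) powr (-2) * exp (Re (s * z))"
    unfolding coef_def using assms by (intro mult_right_mono norm_ramanujan_term_le) (auto simp: edge_def)
  finally show ?thesis .
qed

lemma norm_pole_term_le:
  assumes "norm (z - pole k) \<ge> d" "d > 0"
  shows "norm (pole_term \<tau> k z) \<le> real (Suc k) powr (-2) * (exp (edge * Re z - \<tau> * Im z) / d)"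
proof -
  have "norm (pole_term \<tau> k z) = norm (coef k * exp (Complex edge \<tau> * (z - pole k))) / norm (z - pole k)"
    by (simp add: pole_term_def norm_divide)
  also have "\<dots> \<le> (real (Suc k) powr (-2) * exp (Re (Complex edge \<tau> * z))) / d"
    using assms by (intro frac_le norm_coef_exp_le) auto
  finally show ?thesis by simp
qed

lemma summable_powr_minus_2: "summable (\<lambda>k. real (Suc k) powr (-2))"
  by (rule summable_powr_Suc) auto

lemma summable_pole_term:
  assumes "d > 0" "\<And>k. norm (z - pole k) \<ge> d"
  shows "summable (\<lambda>k. norm (pole_term \<tau> k z))"
proof (rule summable_comparison_test')
  show "summable (\<lambda>k. real (Suc k) powr (-2) * (exp (edge * Re z - \<tau> * Im z) / d))"
    by (intro summable_mult2 summable_powr_minus_2)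
  show "norm (norm (pole_term \<tau> k z)) \<le> real (Suc k) powr (-2) * (exp (edge * Re z - \<tau> * Im z) / d)" for k
    using norm_pole_term_le[OF assms(2,1)] by simp
qed

lemma norm_diff_pole_ge: "norm (z - pole k) \<ge> Im z"
  using abs_Im_le_cmod[of "z - pole k"] by (simp add: pole_def)

text \<open>On the right edge exp(sz) is bounded by exp(edge Re z), since both imaginary parts are
  positive. So the series converges uniformly there, and each term is integrated by its
  primitive.\<close>

lemma right_integral_sums:
  assumes z: "Im z > 0" and T: "T \<ge> \<epsilon>"
  shows "(\<lambda>k. pole_term T k z - pole_term \<epsilon> k z) sums
           contour_integral (linepath (Complex edge \<epsilon>) (Complex edge T)) (integrand z)"
proof -
  define L where "L = linepath (Complex edge \<epsilon>) (Complex edge T)"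
  have on_path: "Re s = edge" "Im s \<ge> \<epsilon>" if "s \<in> path_image L" for s
    using vertical_segment[of s edge \<epsilon> T] that T by (auto simp: L_def)
  have int_eq: "integrand z s = (\<Sum>k. coef k * exp (s * (z - pole k)))" if s: "s \<in> path_image L" for s
  proof -
    have Re: "Re s \<ge> real \<beta> + 2" using on_path(1)[OF s] by (simp add: edge_def)
    have "riemann_zeta s \<noteq> 0" using Re by (intro zeta_nonzero_right) auto
    hence "mellin_kernel \<beta> n s = (\<Sum>k. coef k / of_nat (Suc k) powr s)"
      unfolding mellin_kernel_def coef_def using ramanujan_dirichlet_series[OF \<beta> n Re] by (simp add: field_simps del: of_nat_Suc)
    hence "integrand z s = (\<Sum>k. coef k / of_nat (Suc k) powr s) * exp (s * z)"
      by (simp add: integrand_def)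
    also have "\<dots> = (\<Sum>k. coef k / of_nat (Suc k) powr s * exp (s * z))"
      by (intro suminf_mult2 summable_norm_cancel[OF summable_ramanujan_series[OF Re, of n, folded coef_def]])
    finally show ?thesis unfolding exp_pole_diff by simp
  qed
  have ul: "uniform_limit (path_image L) (\<lambda>N s. \<Sum>k<N. coef k * exp (s * (z - pole k))) (\<lambda>s. \<Sum>k. coef k * exp (s * (z - pole k))) sequentially"
  proof (rule Weierstrass_m_test[where M = "\<lambda>k. real (Suc k) powr (-2) * exp (edge * Re z)"])
    fix k s assume s: "s \<in> path_image L"
    have "norm (coef k * exp (s * (z - pole k))) \<le> real (Suc k) powr (-2) * exp (Re (s * z))"
      by (rule norm_coef_exp_le[OF on_path(1)[OF s]])
    also have "\<dots> \<le> real (Suc k) powr (-2) * exp (edge * Re z)"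
      using on_path[OF s] z \<epsilon> by (intro mult_left_mono) auto
    finally show "norm (coef k * exp (s * (z - pole k))) \<le> real (Suc k) powr (-2) * exp (edge * Re z)" .
  qed (intro summable_mult2 summable_powr_minus_2)
  also have "?this \<longleftrightarrow> uniform_limit (path_image L) (\<lambda>N s. \<Sum>k<N. coef k * exp (s * (z - pole k))) (integrand z) sequentially"
    by (intro uniform_limit_cong') (auto simp: int_eq)
  finally have ul: "uniform_limit (path_image L) (\<lambda>N s. \<Sum>k<N. coef k * exp (s * (z - pole k))) (integrand z) sequentially" .
  have hci: "((\<lambda>s. coef k * exp (s * (z - pole k))) has_contour_integral (pole_term T k z - pole_term \<epsilon> k z)) L" for k
  proof -
    have nz: "z - pole k \<noteq> 0" using norm_diff_pole_ge[of z k] z by auto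
    have "((\<lambda>s. coef k * exp (s * (z - pole k))) has_contour_integral
             (coef k * exp (pathfinish L * (z - pole k)) / (z - pole k) - coef k * exp (pathstart L * (z - pole k)) / (z - pole k))) L"
      by (rule contour_integral_primitive[where S = UNIV])
         (use nz in \<open>auto intro!: derivative_eq_intros simp: L_def\<close>)
    thus ?thesis by (simp add: L_def pole_term_def)
  qed
  have "((\<lambda>N. contour_integral L (\<lambda>s. \<Sum>k<N. coef k * exp (s * (z - pole k)))) \<longlongrightarrow> contour_integral L (integrand z)) sequentially"
  proof (rule contour_integral_uniform_limit(2)[OF _ ul])
    show "norm (vector_derivative L (at t)) \<le> norm (Complex edge T - Complex edge \<epsilon>)" for t
      by (simp add: L_def)
    show "\<forall>\<^sub>F N in sequentially. (\<lambda>s. \<Sum>k<N. coef k * exp (s * (z - pole k))) contour_integrable_on L"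
      by (intro always_eventually allI contour_integrable_sum) (use hci in \<open>auto simp: contour_integrable_on_def\<close>)
  qed (auto simp: L_def)
  moreover have "contour_integral L (\<lambda>s. \<Sum>k<N. coef k * exp (s * (z - pole k))) = (\<Sum>k<N. pole_term T k z - pole_term \<epsilon> k z)" for N
    by (intro contour_integral_unique has_contour_integral_sum hci) auto
  ultimately show ?thesis by (simp add: sums_def L_def)
qed

text \<open>The upper end point contributes a factor exp(-T Im z), and every pole is at distance at
  least Im z, so only the terms at the lower end point survive.\<close>

lemma right_integral_LIMSEQ:
  assumes z: "Im z > 0" and T: "filterlim T at_top sequentially" "\<And>m. T m \<ge> \<epsilon>"
  shows "(\<lambda>m. contour_integral (linepath (Complex edge \<epsilon>) (Complex edge (T m))) (integrand z)) \<longlonglongrightarrow> - pole_series z"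
proof -
  note summ = summable_pole_term[OF z, of z, OF norm_diff_pole_ge]
  have eq: "contour_integral (linepath (Complex edge \<epsilon>) (Complex edge (T m))) (integrand z) = (\<Sum>k. pole_term (T m) k z) - pole_series z" for m
  proof -
    have "(\<lambda>k. pole_term (T m) k z - pole_term \<epsilon> k z) sums ((\<Sum>k. pole_term (T m) k z) - pole_series z)"
      unfolding pole_series_def by (intro sums_diff summable_sums summable_norm_cancel[OF summ])
    with right_integral_sums[OF z T(2)] show ?thesis by (rule sums_unique2)
  qed
  have "(\<lambda>m. \<Sum>k. pole_term (T m) k z) \<longlonglongrightarrow> 0"
  proof (rule Lim_null_comparison[OF always_eventually[OF allI]])
    fix m
    have "norm (\<Sum>k. pole_term (T m) k z) \<le> (\<Sum>k. real (Suc k) powr (-2) * (exp (edge * Re z - T m * Im z) / Im z))"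
      by (intro norm_suminf_le norm_pole_term_le norm_diff_pole_ge z summable_mult2 summable_powr_minus_2)
    also have "\<dots> = (\<Sum>k. real (Suc k) powr (-2)) * (exp (edge * Re z - T m * Im z) / Im z)"
      by (intro suminf_mult2[symmetric] summable_powr_minus_2)
    finally show "norm (\<Sum>k. pole_term (T m) k z) \<le> (\<Sum>k. real (Suc k) powr (-2)) * (exp (edge * Re z - T m * Im z) / Im z)" .
  next
    have "((\<lambda>t. C * (exp (a - t * y) / y)) \<longlongrightarrow> 0) at_top" if "y > 0" for C a y :: real
      using that by real_asymp
    hence "((\<lambda>t. (\<Sum>k. real (Suc k) powr (-2)) * (exp (edge * Re z - t * Im z) / Im z)) \<longlongrightarrow> 0) at_top"
      using z by blast
    thus "(\<lambda>m. (\<Sum>k. real (Suc k) powr (-2)) * (exp (edge * Re z - T m * Im z) / Im z)) \<longlonglongrightarrow> 0"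
      by (rule filterlim_compose[OF _ T(1)])
  qed
  hence "(\<lambda>m. (\<Sum>k. pole_term (T m) k z) - pole_series z) \<longlonglongrightarrow> 0 - pole_series z"
    by (intro tendsto_intros)
  thus ?thesis unfolding eq by simp
qed

text \<open>Three ranges of Re s: up to -1 the functional equation bounds 1/zeta, between -1 and 2
  the hypothesis does, and beyond 2 the constant 3 does. The summand 1 in 1 + T^c lets a single
  bound serve all three, also for negative c.\<close>

lemma horizontal_bound:
  "\<exists>K\<ge>0. \<forall>T s. T \<ge> 1 \<and> Im s = T \<and> Re s \<le> edge \<and>
       (-1 \<le> Re s \<and> Re s \<le> 2 \<longrightarrow> norm (1 / riemann_zeta s) \<le> T powr c) \<longrightarrow>
       norm (integrand z s) \<le> K * (1 + T powr c) * exp (- T * Im z)"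
proof -
  obtain K0 where K0: "K0 > 0"
    "\<And>s w. Re s \<le> -1 \<Longrightarrow> Im s \<ge> \<epsilon> \<Longrightarrow> \<bar>Re w\<bar> \<le> \<bar>Re z\<bar> \<Longrightarrow> norm (integrand w s) \<le> K0 * exp (Re s) * exp (- Im s * Im w)"
    using left_bound[of "\<bar>Re z\<bar>"] by blast
  \<comment> \<open>For -1 < Re s <= edge: 3 comes from 1/zeta, the power of n from the numerator,
    and the exponential from |Re s| <= edge.\<close>
  define K1 where "K1 = 3 * (real n * real n powr (real \<beta> + 1)) * exp (edge * \<bar>Re z\<bar>)"
  have K1: "K1 \<ge> 0" by (simp add: K1_def)
  have "norm (integrand z s) \<le> (K0 + K1) * (1 + T powr c) * exp (- T * Im z)"
    if T: "T \<ge> 1" and s: "Im s = T" "Re s \<le> edge"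
      and zb: "-1 \<le> Re s \<Longrightarrow> Re s \<le> 2 \<Longrightarrow> norm (1 / riemann_zeta s) \<le> T powr c" for T s
  proof (cases "Re s \<le> -1")
    case True
    have "norm (integrand z s) \<le> K0 * exp (Re s) * exp (- Im s * Im z)"
      using True s T \<epsilon> by (intro K0) auto
    also have "\<dots> \<le> ((K0 + K1) * (1 + T powr c)) * exp (- T * Im z)"
      unfolding s(1)
    proof (rule mult_right_mono)
      have "exp (Re s) \<le> 1" using True by simp
      hence "exp (Re s) \<le> 1 + T powr c" using powr_ge_zero[of T c] by linarith
      thus "K0 * exp (Re s) \<le> (K0 + K1) * (1 + T powr c)"
        using K0 K1 by (intro mult_mono) auto
    qed auto
    finally show ?thesis .
  next
    case False
    have inv: "norm (1 / riemann_zeta s) \<le> 3 * (1 + T powr c)"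
    proof (cases "Re s \<le> 2")
      case True
      hence "norm (1 / riemann_zeta s) \<le> T powr c" using zb False by simp
      thus ?thesis using powr_ge_zero[of T c] by (smt (verit))
    next
      case F2: False
      have "1 / norm (riemann_zeta s) \<le> 1 / (1 / 3)"
        using norm_riemann_zeta_ge[of s] F2 zeta_nonzero_right[of s] by (intro divide_left_mono) auto
      also have "1 / (1 / 3) = (3::real)" by simp
      also have "3 \<le> 3 * (1 + T powr c)" by simp
      finally show ?thesis by (simp add: norm_divide)
    qed
    have num: "norm (zeta_numerator \<beta> n s) \<le> real n * real n powr (real \<beta> + 1)"
    proof -
      have "real n powr max 0 (real \<beta> - Re s) \<le> real n powr (real \<beta> + 1)"
        using n False by (intro powr_mono) auto
      thus ?thesis using norm_zeta_numerator_le[OF \<beta> n, of s]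
        by (meson mult_left_mono of_nat_0_le_iff order_trans)
    qed
    have ex: "exp (Re (s * z)) \<le> exp (edge * \<bar>Re z\<bar>) * exp (- T * Im z)"
    proof -
      have "Re s * Re z \<le> \<bar>Re s\<bar> * \<bar>Re z\<bar>" by (metis abs_ge_self abs_mult)
      also have "\<dots> \<le> edge * \<bar>Re z\<bar>" using False s edge_ge by (intro mult_right_mono) auto
      finally show ?thesis using s by (simp add: exp_add[symmetric])
    qed
    have "norm (integrand z s) = norm (zeta_numerator \<beta> n s) * norm (1 / riemann_zeta s) * exp (Re (s * z))"
      by (simp add: integrand_def mellin_kernel_def norm_mult norm_divide)
    also have "\<dots> \<le> (real n * real n powr (real \<beta> + 1)) * (3 * (1 + T powr c)) * (exp (edge * \<bar>Re z\<bar>) * exp (- T * Im z))"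
      by (intro mult_mono inv num ex) (auto intro!: mult_nonneg_nonneg)
    also have "\<dots> = (K1 * (1 + T powr c)) * exp (- T * Im z)" by (simp add: K1_def)
    also have "\<dots> \<le> ((K0 + K1) * (1 + T powr c)) * exp (- T * Im z)"
      using K0 by (intro mult_right_mono) (auto intro!: add_nonneg_nonneg)
    finally show ?thesis .
  qed
  thus ?thesis using K0 K1 by (intro exI[of _ "K0 + K1"]) auto
qed

section \<open>Poles of the series\<close>

text \<open>In a half plane bounded on the right only finitely many poles matter; working there
  replaces a discussion of the infinite set of poles.\<close>

lemma open_delete_poles:
  "open ({z. Re z < x} - pole ` (A \<inter> {..<N::nat}))"
  by (intro open_Diff open_halfspace_Re_lt finite_imp_closed) auto

text \<open>The margin 1 in the half plane keeps all poles of index at least N at distance at least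
  1, so that the tail is dominated.\<close>

lemma pole_tail:
  assumes "Re z < ln (real (Suc N)) - 1"
  shows "norm (z - pole (k + N)) \<ge> 1"
proof -
  have "ln (real (Suc N)) \<le> ln (real (Suc (k + N)))" by (subst ln_le_cancel_iff) auto
  moreover have "Re (z - pole (k + N)) = Re z - ln (real (Suc (k + N)))" by (simp add: pole_def)
  ultimately show ?thesis using assms abs_Re_le_cmod[of "z - pole (k + N)"] by linarith
qed

lemma holomorphic_pole_tail:
  "(\<lambda>z. \<Sum>k. pole_term \<epsilon> (k + N) z) holomorphic_on {z. Re z < ln (real (Suc N)) - 1}"
proof (rule holomorphic_on_suminf)
  fix k
  have "z - pole (k + N) \<noteq> 0" if "Re z < ln (real (Suc N)) - 1" for z using pole_tail[OF that, of k] by auto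
  thus "pole_term \<epsilon> (k + N) holomorphic_on {z. Re z < ln (real (Suc N)) - 1}"
    unfolding pole_term_def by (intro holomorphic_intros) auto
next
  fix z0 :: complex
  define X where "X = norm z0 + 1"
  define M where "M = (\<lambda>k. real (Suc (k + N)) powr (-2) * exp (edge * X + X))"
  have "summable (\<lambda>k. real (Suc (k + N)) powr (-2))"
    using summable_iff_shift[of "\<lambda>k. real (Suc k) powr (-2)" N] summable_powr_minus_2 by simp
  hence M: "summable M" unfolding M_def by (intro summable_mult2)
  show "\<exists>d>0. \<exists>M. summable M \<and> (\<forall>k. \<forall>w\<in>cball z0 d \<inter> {z. Re z < ln (real (Suc N)) - 1}. norm (pole_term \<epsilon> (k + N) w) \<le> M k)"
  proof (intro exI[of _ 1] exI[of _ M] conjI allI ballI M)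
    fix k w assume w: "w \<in> cball z0 1 \<inter> {z. Re z < ln (real (Suc N)) - 1}"
    have "norm w \<le> X" using w norm_triangle_ineq2[of w z0] by (auto simp: X_def dist_norm norm_minus_commute)
    hence X: "Re w \<le> X" "- Im w \<le> X" "X \<ge> 0"
      using abs_Re_le_cmod[of w] abs_Im_le_cmod[of w] by (auto simp: X_def)
    have "norm (pole_term \<epsilon> (k + N) w) \<le> real (Suc (k + N)) powr (-2) * (exp (edge * Re w - \<epsilon> * Im w) / 1)"
      using w by (intro norm_pole_term_le pole_tail) auto
    also have "\<dots> \<le> M k"
      unfolding M_def
    proof (rule mult_left_mono)
      have "edge * Re w \<le> edge * X" using X edge_ge by (intro mult_left_mono) auto
      moreover have "\<epsilon> * (- Im w) \<le> \<epsilon> * X" using X \<epsilon> by (intro mult_left_mono) auto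
      moreover have "\<epsilon> * X \<le> 1 * X" using X \<epsilon> by (intro mult_right_mono) auto
      ultimately show "exp (edge * Re w - \<epsilon> * Im w) / 1 \<le> exp (edge * X + X)" by simp
    qed auto
    finally show "norm (pole_term \<epsilon> (k + N) w) \<le> M k" .
  qed auto
qed (rule open_halfspace_Re_lt)

lemma pole_series_split:
  assumes "Re z < ln (real (Suc N)) - 1"
  shows "pole_series z = (\<Sum>k<N. pole_term \<epsilon> k z) + (\<Sum>k. pole_term \<epsilon> (k + N) z)"
proof -
  have "summable (\<lambda>k. pole_term \<epsilon> (k + N) z)"
  proof (rule summable_comparison_test'[of _ 0])
    have "summable (\<lambda>k. real (Suc (k + N)) powr (-2))"
      using summable_iff_shift[of "\<lambda>k. real (Suc k) powr (-2)" N] summable_powr_minus_2 by simp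
    thus "summable (\<lambda>k. real (Suc (k + N)) powr (-2) * (exp (edge * Re z - \<epsilon> * Im z) / 1))" by (intro summable_mult2)
    show "norm (pole_term \<epsilon> (k + N) z) \<le> real (Suc (k + N)) powr (-2) * (exp (edge * Re z - \<epsilon> * Im z) / 1)" for k
      using assms by (intro norm_pole_term_le pole_tail) auto
  qed
  hence "summable (\<lambda>k. pole_term \<epsilon> k z)"
    using summable_iff_shift[of "\<lambda>k. pole_term \<epsilon> k z" N] by simp
  thus ?thesis unfolding pole_series_def
    using suminf_split_initial_segment[of "\<lambda>k. pole_term \<epsilon> k z" N] by (simp add: add.commute)
qed

lemma holomorphic_pole_term:
  assumes "coef k = 0 \<or> pole k \<notin> A"
  shows "pole_term \<epsilon> k holomorphic_on A"
proof (cases "coef k = 0")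
  case True
  hence "pole_term \<epsilon> k = (\<lambda>_. 0)" by (simp add: pole_term_def fun_eq_iff)
  thus ?thesis by simp
next
  case False
  hence "z - pole k \<noteq> 0" if "z \<in> A" for z using assms that by auto
  thus ?thesis unfolding pole_term_def by (intro holomorphic_intros) auto
qed

lemma ex_index_beyond: "\<exists>N\<ge>j. x < ln (real (Suc N)) - 1"
proof -
  define N where "N = max j (nat \<lceil>exp (x + 2)\<rceil>)"
  have "exp (x + 2) \<le> real N" unfolding N_def by linarith
  hence "exp (x + 2) \<le> real (Suc N)" by simp
  hence "x + 2 \<le> ln (real (Suc N))" by (subst ln_ge_iff) auto
  thus ?thesis by (intro exI[of _ N]) (auto simp: N_def)
qed

lemma pole_set_altdef: "{of_real (ln (real q)) | q::nat. q \<ge> 1 \<and> ramanujan_sum_beta \<beta> q n \<noteq> 0} = pole ` {k. coef k \<noteq> 0}"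
proof (intro equalityI subsetI)
  fix z :: complex assume "z \<in> {of_real (ln (real q)) | q::nat. q \<ge> 1 \<and> ramanujan_sum_beta \<beta> q n \<noteq> 0}"
  then obtain q where q: "z = of_real (ln (real q))" "q \<ge> 1" "ramanujan_sum_beta \<beta> q n \<noteq> 0" by blast
  obtain k where "q = Suc k" using q(2) by (cases q) auto
  with q have "z = pole k" "coef k \<noteq> 0" by (simp_all add: pole_def coef_def)
  thus "z \<in> pole ` {k. coef k \<noteq> 0}" by blast
next
  fix z assume "z \<in> pole ` {k. coef k \<noteq> 0}"
  then obtain k where "z = pole k" "coef k \<noteq> 0" by blast
  thus "z \<in> {of_real (ln (real q)) | q::nat. q \<ge> 1 \<and> ramanujan_sum_beta \<beta> q n \<noteq> 0}"
    unfolding pole_def coef_def by (intro CollectI exI[of _ "Suc k"]) auto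
qed

text \<open>Locally the series is a finite sum plus a holomorphic tail. Terms with c_q(n) = 0 vanish
  identically, so the corresponding log q is no singularity.\<close>

lemma holomorphic_pole_series: "pole_series holomorphic_on - (pole ` {k. coef k \<noteq> 0})"
proof -
  have "pole_series field_differentiable at z" if z: "z \<notin> pole ` {k. coef k \<noteq> 0}" for z
  proof -
    obtain N where N: "Re z < ln (real (Suc N)) - 1" using ex_index_beyond[of 0 "Re z"] by blast
    define V where "V = {z. Re z < ln (real (Suc N)) - 1} - pole ` ({k. coef k \<noteq> 0} \<inter> {..<N})"
    have V: "open V" unfolding V_def by (rule open_delete_poles)
    have "(\<lambda>z. (\<Sum>k<N. pole_term \<epsilon> k z) + (\<Sum>k. pole_term \<epsilon> (k + N) z)) holomorphic_on V"
      by (intro holomorphic_intros holomorphic_pole_term holomorphic_on_subset[OF holomorphic_pole_tail])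
         (auto simp: V_def)
    hence "pole_series holomorphic_on V"
      by (rule holomorphic_transform) (auto simp: V_def pole_series_split)
    moreover have "z \<in> V" using z N by (auto simp: V_def)
    ultimately show ?thesis using V holomorphic_on_imp_differentiable_at by blast
  qed
  thus ?thesis unfolding holomorphic_on_def by (auto intro: field_differentiable_at_within)
qed

text \<open>The exponential in the j-th term equals 1 at the pole, so subtracting the principal part
  leaves a multiple of a difference quotient, whose singularity is removable.\<close>

lemma pole_series_principal_part:
  "\<exists>\<delta>>0. \<exists>g. g holomorphic_on ball (pole j) \<delta> \<and>
     (\<forall>z\<in>ball (pole j) \<delta> - {pole j}. pole_series z = coef j / (z - pole j) + g z)"
proof -
  obtain N where N: "N \<ge> Suc j" "Re (pole j) < ln (real (Suc N)) - 1" using ex_index_beyond[of "Suc j" "Re (pole j)"] by blast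
  define V where "V = {z. Re z < ln (real (Suc N)) - 1} - pole ` ((- {j}) \<inter> {..<N})"
  have "open V" unfolding V_def by (rule open_delete_poles)
  moreover have "pole j \<in> V" using N by (auto simp: V_def pole_inj)
  ultimately obtain \<delta> where \<delta>: "\<delta> > 0" "ball (pole j) \<delta> \<subseteq> V" using open_contains_ball by blast
  define E where "E = (\<lambda>z. exp (Complex edge \<epsilon> * (z - pole j)))"
  define \<phi> where "\<phi> = (\<lambda>z. if z = pole j then deriv E (pole j) else (E z - E (pole j)) / (z - pole j))"
  have \<phi>: "\<phi> holomorphic_on UNIV"
    unfolding \<phi>_def by (rule pole_lemma) (auto simp: E_def intro!: holomorphic_intros)
  define g where "g = (\<lambda>z. coef j * \<phi> z + (\<Sum>k\<in>{..<N} - {j}. pole_term \<epsilon> k z) + (\<Sum>k. pole_term \<epsilon> (k + N) z))"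
  have "g holomorphic_on V"
    unfolding g_def
    by (intro holomorphic_intros holomorphic_pole_term holomorphic_on_subset[OF holomorphic_pole_tail] holomorphic_on_subset[OF \<phi>])
       (auto simp: V_def)
  hence "g holomorphic_on ball (pole j) \<delta>" using \<delta>(2) by (rule holomorphic_on_subset)
  moreover have "pole_series z = coef j / (z - pole j) + g z" if z: "z \<in> ball (pole j) \<delta> - {pole j}" for z
  proof -
    have "Re z < ln (real (Suc N)) - 1" using z \<delta>(2) by (auto simp: V_def)
    hence "pole_series z = (\<Sum>k<N. pole_term \<epsilon> k z) + (\<Sum>k. pole_term \<epsilon> (k + N) z)" by (rule pole_series_split)
    also have "(\<Sum>k<N. pole_term \<epsilon> k z) = pole_term \<epsilon> j z + (\<Sum>k\<in>{..<N} - {j}. pole_term \<epsilon> k z)"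
      using N by (intro sum.remove) auto
    also have "pole_term \<epsilon> j z = coef j / (z - pole j) + coef j * \<phi> z"
    proof -
      have "pole_term \<epsilon> j z = coef j * E z / (z - pole j)" by (simp add: pole_term_def E_def)
      moreover have "\<phi> z = (E z - 1) / (z - pole j)" using z by (simp add: \<phi>_def E_def)
      ultimately show ?thesis by (simp add: diff_divide_distrib right_diff_distrib)
    qed
    finally show ?thesis by (simp add: g_def)
  qed
  ultimately show ?thesis using \<delta>(1) by blast
qed

text \<open>The left edge moves out at the rate of T_m: the upper edge then has length about T_m
  against a factor exp(-T_m Im z) times a power of T_m, and the left edge has length about m against
  exp(-m).\<close>

lemma varpi_partial_LIMSEQ:
  assumes simple: "\<And>\<rho>. nontrivial_zero \<rho> \<Longrightarrow> deriv riemann_zeta \<rho> \<noteq> 0"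
    and T: "\<And>m. m \<ge> 1 \<Longrightarrow> real m \<le> T m \<and> T m \<le> real m + 1"
    and Tz: "\<And>m \<sigma>. m \<ge> 1 \<Longrightarrow> -1 \<le> \<sigma> \<Longrightarrow> \<sigma> \<le> 2 \<Longrightarrow>
        riemann_zeta (Complex \<sigma> (T m)) \<noteq> 0 \<and> 1 / norm (riemann_zeta (Complex \<sigma> (T m))) < T m powr c"
    and z: "Im z > 0"
  shows "(\<lambda>m. varpi_partial \<beta> n (T m) z) \<longlonglongrightarrow> 1 / (2 * of_real pi * \<i>) * (bottom_integral z - pole_series z)"
proof -
  \<comment> \<open>Shifted by one because the hypotheses on T start at m = 1.\<close>
  define \<tau> where "\<tau> = (\<lambda>m. T (Suc m))"
  have \<tau>: "real m + 1 \<le> \<tau> m" for m using T[of "Suc m"] by (simp add: \<tau>_def)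
  have \<tau>1: "\<tau> m \<ge> 1" for m using \<tau>[of m] by linarith
  have \<tau>\<epsilon>: "\<tau> m > \<epsilon>" for m using \<tau>1[of m] \<epsilon> by linarith
  have \<tau>_lim: "filterlim \<tau> at_top sequentially"
  proof (rule filterlim_at_top_mono)
    show "filterlim (\<lambda>m. real m + 1) at_top sequentially" by real_asymp
  qed (auto simp: \<tau>)
  \<comment> \<open>The hypothesis covers real parts from -1 to 2; outside this range zeta has no
    zero at positive height.\<close>
  have nz: "riemann_zeta s \<noteq> 0" if s: "Im s = \<tau> m" for s m
  proof -
    have "s = Complex (Re s) (\<tau> m)" using s by (simp add: complex_eq_iff)
    moreover have "Im s > 0" using s \<tau>1[of m] by simp
    ultimately show ?thesis
      using zeta_nonzero_left[of s] zeta_nonzero_right[of s] Tz[of "Suc m" "Re s"] unfolding \<tau>_def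
      by (metis One_nat_def Suc_le_mono le0 linear)
  qed
  define R where "R = (\<lambda>m::nat. real (m + 1))"
  define bot where "bot = (\<lambda>m. contour_integral (linepath (Complex (- R m) \<epsilon>) (Complex edge \<epsilon>)) (integrand z))"
  define right where "right = (\<lambda>m. contour_integral (linepath (Complex edge \<epsilon>) (Complex edge (\<tau> m))) (integrand z))"
  define upper where "upper = (\<lambda>m. contour_integral (linepath (Complex edge (\<tau> m)) (Complex (- R m) (\<tau> m))) (integrand z))"
  define left where "left = (\<lambda>m. contour_integral (linepath (Complex (- R m) (\<tau> m)) (Complex (- R m) \<epsilon>)) (integrand z))"
  have R: "- R m \<le> -1" "- R m \<le> edge" "R m \<ge> 1" for m using edge_ge by (auto simp: R_def)
  have eq: "varpi_partial \<beta> n (\<tau> m) z = 1 / (2 * of_real pi * \<i>) * (bot m + right m + upper m + left m)" for m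
    using rectangle_integral[OF simple \<tau>\<epsilon>[of m] nz[of _ m] R(3)[of m], of z]
    by (simp add: bot_def right_def upper_def left_def)
  have l1: "bot \<longlonglongrightarrow> bottom_integral z"
    unfolding bot_def R_def by (rule bottom_integral_LIMSEQ)
  have l2: "right \<longlonglongrightarrow> - pole_series z"
    unfolding right_def using \<tau>\<epsilon> by (intro right_integral_LIMSEQ z \<tau>_lim) (auto intro: less_imp_le)
  obtain K where K: "K \<ge> 0"
    "\<And>T s. T \<ge> 1 \<Longrightarrow> Im s = T \<Longrightarrow> Re s \<le> edge \<Longrightarrow>
       (-1 \<le> Re s \<and> Re s \<le> 2 \<Longrightarrow> norm (1 / riemann_zeta s) \<le> T powr c) \<Longrightarrow>
       norm (integrand z s) \<le> K * (1 + T powr c) * exp (- T * Im z)"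
    using horizontal_bound[of c z] by blast
  define y where "y = Im z"
  have y: "y > 0" using z by (simp add: y_def)
  have l3: "upper \<longlonglongrightarrow> 0"
  proof (rule Lim_null_comparison[OF always_eventually[OF allI]])
    fix m
    have "norm (upper m) \<le> (K * (1 + \<tau> m powr c) * exp (- \<tau> m * y)) * norm (Complex (- R m) (\<tau> m) - Complex edge (\<tau> m))"
      unfolding upper_def
    proof (rule contour_integral_bound_linepath)
      have seg: "Im s = \<tau> m" "Re s \<le> edge" if "s \<in> closed_segment (Complex edge (\<tau> m)) (Complex (- R m) (\<tau> m))" for s
        using that R(2)[of m] horizontal_segment[of s "- R m" "\<tau> m" edge] by (auto simp: closed_segment_commute)
      show "integrand z contour_integrable_on linepath (Complex edge (\<tau> m)) (Complex (- R m) (\<tau> m))"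
        by (intro contour_integrable_continuous_linepath holomorphic_on_imp_continuous_on holomorphic_integrand)
           (use seg nz \<tau>1[of m] in \<open>force\<close>)
      show "0 \<le> K * (1 + \<tau> m powr c) * exp (- \<tau> m * y)"
        using K by (intro mult_nonneg_nonneg add_nonneg_nonneg) auto
      fix s assume s: "s \<in> closed_segment (Complex edge (\<tau> m)) (Complex (- R m) (\<tau> m))"
      show "norm (integrand z s) \<le> K * (1 + \<tau> m powr c) * exp (- \<tau> m * y)"
        unfolding y_def
      proof (intro K \<tau>1 seg[OF s])
        assume *: "-1 \<le> Re s \<and> Re s \<le> 2"
        have "s = Complex (Re s) (\<tau> m)" using seg(1)[OF s] by (simp add: complex_eq_iff)
        thus "norm (1 / riemann_zeta s) \<le> \<tau> m powr c"
          using Tz[of "Suc m" "Re s"] * by (simp add: norm_divide \<tau>_def)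
      qed
    qed
    also have "norm (Complex (- R m) (\<tau> m) - Complex edge (\<tau> m)) = R m + edge"
      using R(3)[of m] edge_ge by (simp add: complex_norm cmod_def)
    also have "\<dots> \<le> \<tau> m + edge" using \<tau>[of m] by (simp add: R_def)
    finally show "norm (upper m) \<le> (K * (1 + \<tau> m powr c) * exp (- \<tau> m * y)) * (\<tau> m + edge)"
      using K by (simp add: mult_left_mono)
  next
    have "((\<lambda>t. (K * (1 + t powr c) * exp (- t * y)) * (t + edge)) \<longlongrightarrow> 0) at_top"
      using y by real_asymp
    thus "(\<lambda>m. (K * (1 + \<tau> m powr c) * exp (- \<tau> m * y)) * (\<tau> m + edge)) \<longlonglongrightarrow> 0"
      by (rule filterlim_compose[OF _ \<tau>_lim])
  qed
  obtain K0 where K0: "K0 > 0"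
    "\<And>s w. Re s \<le> -1 \<Longrightarrow> Im s \<ge> \<epsilon> \<Longrightarrow> \<bar>Re w\<bar> \<le> \<bar>Re z\<bar> \<Longrightarrow> norm (integrand w s) \<le> K0 * exp (Re s) * exp (- Im s * Im w)"
    using left_bound[of "\<bar>Re z\<bar>"] by blast
  have l4: "left \<longlonglongrightarrow> 0"
  proof (rule Lim_null_comparison[OF always_eventually[OF allI]])
    fix m
    have seg: "Re s = - R m" "\<epsilon> \<le> Im s" if "s \<in> closed_segment (Complex (- R m) (\<tau> m)) (Complex (- R m) \<epsilon>)" for s
      using that \<tau>\<epsilon>[of m] vertical_segment[of s "- R m" \<epsilon> "\<tau> m"] by (auto simp: closed_segment_commute)
    have "norm (left m) \<le> (K0 * exp (- R m)) * norm (Complex (- R m) \<epsilon> - Complex (- R m) (\<tau> m))"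
      unfolding left_def
    proof (rule contour_integral_bound_linepath)
      show "integrand z contour_integrable_on linepath (Complex (- R m) (\<tau> m)) (Complex (- R m) \<epsilon>)"
      proof (intro contour_integrable_continuous_linepath holomorphic_on_imp_continuous_on holomorphic_integrand)
        fix s assume "s \<in> closed_segment (Complex (- R m) (\<tau> m)) (Complex (- R m) \<epsilon>)"
        thus "Im s > 0 \<and> riemann_zeta s \<noteq> 0"
          using seg[of s] \<epsilon> R(1)[of m] zeta_nonzero_left[of s] by auto
      qed
      fix s assume s: "s \<in> closed_segment (Complex (- R m) (\<tau> m)) (Complex (- R m) \<epsilon>)"
      have "norm (integrand z s) \<le> K0 * exp (Re s) * exp (- Im s * Im z)"
        using seg[OF s] R(1)[of m] by (intro K0) auto
      also have "\<dots> \<le> K0 * exp (Re s) * 1"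
        using seg[OF s] \<epsilon> z K0(1) by (intro mult_left_mono) auto
      finally show "norm (integrand z s) \<le> K0 * exp (- R m)" using seg[OF s] by simp
    qed (use K0 in auto)
    also have "norm (Complex (- R m) \<epsilon> - Complex (- R m) (\<tau> m)) = \<tau> m - \<epsilon>"
      using \<tau>\<epsilon>[of m] by (simp add: complex_norm cmod_def)
    also have "\<dots> \<le> real m + 2" using T[of "Suc m"] \<epsilon> by (simp add: \<tau>_def)
    finally show "norm (left m) \<le> (K0 * exp (- 1 - real m)) * (real m + 2)"
      using K0 by (simp add: mult_left_mono R_def)
  next
    show "(\<lambda>m. (K0 * exp (- 1 - real m)) * (real m + 2)) \<longlonglongrightarrow> 0"
      by real_asymp
  qed
  have "(\<lambda>m. 1 / (2 * of_real pi * \<i>) * (bot m + right m + upper m + left m)) \<longlonglongrightarrow> 1 / (2 * of_real pi * \<i>) * (bottom_integral z + - pole_series z + 0 + 0)"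
    by (intro tendsto_intros l1 l2 l3 l4)
  hence "(\<lambda>m. varpi_partial \<beta> n (T (Suc m)) z) \<longlonglongrightarrow> 1 / (2 * of_real pi * \<i>) * (bottom_integral z - pole_series z)"
    unfolding eq[symmetric] by (simp add: \<tau>_def)
  thus ?thesis by (rule LIMSEQ_imp_Suc)
qed

end

theorem theorem10:
  fixes \<beta> n :: nat and T :: "nat \<Rightarrow> real"
  assumes simple_zeros: "\<And>\<rho>. nontrivial_zero \<rho> \<Longrightarrow> deriv riemann_zeta \<rho> \<noteq> 0"
    and T_bounds: "\<And>m. m \<ge> 1 \<Longrightarrow> real m \<le> T m \<and> T m \<le> real m + 1"
    and T_zeta: "\<exists>c1::real. \<forall>m\<ge>1. \<forall>\<sigma>::real. -1 \<le> \<sigma> \<and> \<sigma> \<le> 2 \<longrightarrow>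
        riemann_zeta (Complex \<sigma> (T m)) \<noteq> 0 \<and> riemann_zeta (Complex \<sigma> (- T m)) \<noteq> 0 \<and>
        1 / norm (riemann_zeta (Complex \<sigma> (T m))) < T m powr c1 \<and>
        1 / norm (riemann_zeta (Complex \<sigma> (- T m))) < T m powr c1"
    and "\<beta> \<ge> 1" and "n \<ge> 1"
  shows "\<exists>F. F holomorphic_on
              (- {of_real (ln (real q)) | q::nat. q \<ge> 1 \<and> ramanujan_sum_beta \<beta> q n \<noteq> 0}) \<and>
            (\<forall>z. 0 < Im z \<longrightarrow> (\<lambda>m. varpi_partial \<beta> n (T m) z) \<longlonglongrightarrow> F z) \<and>
            (\<forall>q::nat. q \<ge> 1 \<and> ramanujan_sum_beta \<beta> q n \<noteq> 0 \<longrightarrow>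
               (\<exists>\<epsilon>>0. \<exists>g. g holomorphic_on ball (of_real (ln (real q))) \<epsilon> \<and>
                  (\<forall>z \<in> ball (of_real (ln (real q))) \<epsilon> - {of_real (ln (real q))}.
                     F z = (- ramanujan_sum_beta \<beta> q n / (2 * of_real pi * \<i>))
                             / (z - of_real (ln (real q))) + g z)))"
proof -
  obtain \<epsilon> where \<epsilon>: "\<epsilon> > 0" "\<epsilon> < 1" "\<And>\<rho>. riemann_zeta \<rho> = 0 \<Longrightarrow> 0 < Im \<rho> \<Longrightarrow> \<epsilon> < Im \<rho>"
    using riemann_zeta_zero_gap by blast
  interpret zeta_strip \<beta> n \<epsilon>
    using assms \<epsilon> by unfold_locales auto
  obtain c where c: "\<And>m \<sigma>. m \<ge> 1 \<Longrightarrow> -1 \<le> \<sigma> \<Longrightarrow> \<sigma> \<le> 2 \<Longrightarrow>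
        riemann_zeta (Complex \<sigma> (T m)) \<noteq> 0 \<and> 1 / norm (riemann_zeta (Complex \<sigma> (T m))) < T m powr c"
    using T_zeta by blast
  \<comment> \<open>The limit for Im z > 0, written in terms that make sense everywhere off the
    poles. The minus sign of the residue comes from the lower end point of the right edge.\<close>
  define F where "F = (\<lambda>z. 1 / (2 * of_real pi * \<i>) * (bottom_integral z - pole_series z))"
  show ?thesis
  proof (intro exI[of _ F] conjI allI impI)
    show "F holomorphic_on (- {of_real (ln (real q)) | q::nat. q \<ge> 1 \<and> ramanujan_sum_beta \<beta> q n \<noteq> 0})"
      unfolding pole_set_altdef F_def
      by (intro holomorphic_intros holomorphic_pole_series holomorphic_on_subset[OF holomorphic_bottom_integral]) auto
    show "(\<lambda>m. varpi_partial \<beta> n (T m) z) \<longlonglongrightarrow> F z" if "0 < Im z" for z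
      unfolding F_def by (rule varpi_partial_LIMSEQ[OF simple_zeros T_bounds c that])
  next
    fix q :: nat assume q: "q \<ge> 1 \<and> ramanujan_sum_beta \<beta> q n \<noteq> 0"
    then obtain j where j: "q = Suc j" by (cases q) auto
    have q_pole: "of_real (ln (real q)) = pole j" and q_coef: "ramanujan_sum_beta \<beta> q n = coef j"
      by (simp_all add: j pole_def coef_def)
    obtain \<delta> g where g: "\<delta> > 0" "g holomorphic_on ball (pole j) \<delta>"
      "\<And>z. z \<in> ball (pole j) \<delta> - {pole j} \<Longrightarrow> pole_series z = coef j / (z - pole j) + g z"
      using pole_series_principal_part[of j] by blast
    show "\<exists>\<epsilon>>0. \<exists>g. g holomorphic_on ball (of_real (ln (real q))) \<epsilon> \<and>
                  (\<forall>z \<in> ball (of_real (ln (real q))) \<epsilon> - {of_real (ln (real q))}.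
                     F z = (- ramanujan_sum_beta \<beta> q n / (2 * of_real pi * \<i>))
                             / (z - of_real (ln (real q))) + g z)"
      unfolding q_pole q_coef
    proof (intro exI[of _ \<delta>] exI[of _ "\<lambda>z. 1 / (2 * of_real pi * \<i>) * (bottom_integral z - g z)"] conjI ballI g)
      show "(\<lambda>z. 1 / (2 * of_real pi * \<i>) * (bottom_integral z - g z)) holomorphic_on ball (pole j) \<delta>"
        by (intro holomorphic_intros g holomorphic_on_subset[OF holomorphic_bottom_integral]) auto
      fix z assume z: "z \<in> ball (pole j) \<delta> - {pole j}"
      have *: "x * (b - (c' / w + d)) = - c' * x / w + x * (b - d)" for x b c' w d :: complex
        by (simp add: algebra_simps)
      show "F z = - coef j / (2 * of_real pi * \<i>) / (z - pole j) + 1 / (2 * of_real pi * \<i>) * (bottom_integral z - g z)"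
        unfolding F_def g(3)[OF z] * by simp
    qed
  qed
qed

end
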